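(* Let $r\ge 6$ and $n\ge 5r+18$ be integers. Then $$\sigma\big(K_{r+1}-(K_3\cup P_3),\,n\big)=\begin{cases}(r-1)(2n-r)-3(n-r)-1, & \text{if } n-r \text{ is odd},\\ (r-1)(2n-r)-3(n-r), & \text{if } n-r \text{ is even}.\end{cases}$$
   Context: A sequence $\pi=(d_1,\dots,d_n)$ of non-increasing nonnegative integers is graphic if it is the degree sequence of a simple graph on $n$ vertices (a realization of $\pi$); write $\sigma(\pi)=d_1+\dots+d_n$. For a graph $H$, $\pi$ is potentially $H$-graphic if some realization of $\pi$ contains $H$ as a (not necessarily induced) subgraph. $\sigma(H,n)$ denotes the smallest even integer $l$ such that every $n$-term graphic sequence $\pi$ with $\sigma(\pi)\ge l$ is potentially $H$-graphic. For a graph $H$ that is a subgraph of $K_m$, $K_m-H$ is the graph obtained from $K_m$ by deleting the edges of $H$. $K_3$ is the triangle, $P_3$ denotes the path with $3$ edges (on $4$ vertices), and $K_3\cup P_3$ is their disjoint union (7 vertices, 6 edges). *)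

theory Defs
  imports Main
begin

definition realizes :: "(nat \<Rightarrow> nat \<Rightarrow> bool) \<Rightarrow> nat list \<Rightarrow> bool" where
  "realizes E d \<longleftrightarrow>
     (\<forall>i j. E i j \<longrightarrow> i < length d \<and> j < length d) \<and>
     (\<forall>i j. E i j \<longrightarrow> E j i) \<and>
     (\<forall>i. \<not> E i i) \<and>
     (\<forall>i < length d. card {j. E i j} = d ! i)"

definition graphic :: "nat list \<Rightarrow> bool" where
  "graphic d \<longleftrightarrow> sorted_wrt (\<ge>) d \<and> (\<exists>E. realizes E d)"

definition contains_subgraph :: "(nat \<Rightarrow> nat \<Rightarrow> bool) \<Rightarrow> nat \<Rightarrow> (nat \<Rightarrow> nat \<Rightarrow> bool) \<Rightarrow> bool" where
  "contains_subgraph E m EH \<longleftrightarrow>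
     (\<exists>f. inj_on f {..<m} \<and> (\<forall>i<m. \<forall>j<m. EH i j \<longrightarrow> E (f i) (f j)))"

definition potentially_graphic :: "nat \<Rightarrow> (nat \<Rightarrow> nat \<Rightarrow> bool) \<Rightarrow> nat list \<Rightarrow> bool" where
  "potentially_graphic m EH d \<longleftrightarrow> (\<exists>E. realizes E d \<and> contains_subgraph E m EH)"

definition sigma :: "nat \<Rightarrow> (nat \<Rightarrow> nat \<Rightarrow> bool) \<Rightarrow> nat \<Rightarrow> nat" where
  "sigma m EH n = (LEAST l::nat. even l \<and>
     (\<forall>d. length d = n \<and> graphic d \<and> sum_list d \<ge> l \<longrightarrow> potentially_graphic m EH d))"

text \<open>K_{r+1} - (K_3 \<union> P_3) on vertices {0..r}: the triangle is on 0,1,2 and the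
  path with three edges is 3-4-5-6.\<close>
definition removed_edges :: "nat set set" where
  "removed_edges = {{0,1},{1,2},{0,2},{3,4},{4,5},{5,6}}"

definition K_minus_K3_P3 :: "nat \<Rightarrow> nat \<Rightarrow> nat \<Rightarrow> bool" where
  "K_minus_K3_P3 r i j \<longleftrightarrow> i \<le> r \<and> j \<le> r \<and> i \<noteq> j \<and> {i, j} \<notin> removed_edges"

end

theory Submission
  imports Defs
begin

text \<open>
  Write \<open>f = (2r - 5)n - r\<^sup>2 + 4r\<close>, so that the claimed value is \<open>f\<close> rounded down to an even number; only
  a degree sum of at least \<open>f - 1\<close> is used.

  If at least \<open>r + 1\<close> vertices have degree at least \<open>r\<close>, some realization contains \<open>K\<^bsub>r+1\<^esub>\<close> minus a
  triangle. This goes by induction on \<open>r\<close>: delete a vertex \<open>v\<close> of maximum degree (this lowers \<open>f\<close> by exactly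
  \<open>2(n - 1)\<close> when \<open>n\<close> and \<open>r\<close> drop by one) and find the smaller graph on a set \<open>S\<close>, where \<open>(G, S)\<close> maximizes the
  degree sum of \<open>S\<close> and then \<open>|N(v) \<inter> S|\<close>. If \<open>j \<in> S\<close> is not adjacent to \<open>v\<close>, all switches along alternating
  4- and 6-cycles through the pair \<open>vj\<close> are blocked. For \<open>d(j) \<ge> 2r\<close> this makes \<open>N(v) - S\<close> or \<open>N(j) - S\<close> a clique
  on \<open>r + 1\<close> vertices, and for \<open>d(j) < 2r\<close> it bounds the degree sum below \<open>f - 1\<close>.

  Otherwise let \<open>T\<close> consist of \<open>r + 1\<close> vertices of largest degree, and take a realization with the fewest
  non-adjacent pairs in \<open>T\<close>. All vertices outside \<open>T\<close> have degree less than \<open>r\<close>, so edges leaving \<open>T\<close> can be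
  rerouted freely. Hence the vertices of \<open>T\<close> with a neighbour outside \<open>T\<close> are pairwise adjacent, and counting shows
  that at most three pairs are missing in \<open>T\<close>, which can be fitted into the disjoint union of a triangle and a path.

  For the lower bound, join \<open>K\<^bsub>r-3\<^esub>\<close> completely to a perfect matching, or to a matching together with a path on
  three vertices. Four vertices outside the clique span at most two edges, but any four vertices of
  \<open>K\<^bsub>r+1\<^esub> - (K\<^sub>3 \<union> P\<^sub>3)\<close> span at least three.
\<close>

section \<open>Degree-preserving edge switches\<close>

definition graph_on :: "'a set \<Rightarrow> ('a \<Rightarrow> 'a \<Rightarrow> bool) \<Rightarrow> bool" where
  "graph_on V E \<longleftrightarrow> finite V \<and> (\<forall>x y. E x y \<longrightarrow> x \<in> V \<and> y \<in> V \<and> x \<noteq> y \<and> E y x)"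

definition nbrs :: "('a \<Rightarrow> 'a \<Rightarrow> bool) \<Rightarrow> 'a \<Rightarrow> 'a set" where
  "nbrs E x = {y. E x y}"

definition degree :: "('a \<Rightarrow> 'a \<Rightarrow> bool) \<Rightarrow> 'a \<Rightarrow> nat" where
  "degree E x = card (nbrs E x)"

definition add_edge :: "'a \<Rightarrow> 'a \<Rightarrow> ('a \<Rightarrow> 'a \<Rightarrow> bool) \<Rightarrow> 'a \<Rightarrow> 'a \<Rightarrow> bool" where
  "add_edge a b E = (\<lambda>x y. E x y \<or> x = a \<and> y = b \<or> x = b \<and> y = a)"

definition del_edge :: "'a \<Rightarrow> 'a \<Rightarrow> ('a \<Rightarrow> 'a \<Rightarrow> bool) \<Rightarrow> 'a \<Rightarrow> 'a \<Rightarrow> bool" where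
  "del_edge a b E = (\<lambda>x y. E x y \<and> \<not> (x = a \<and> y = b) \<and> \<not> (x = b \<and> y = a))"

lemma in_nbrs [simp]: "y \<in> nbrs E x \<longleftrightarrow> E x y"
  by (simp add: nbrs_def)

lemma graph_onD:
  assumes "graph_on V E" "E x y"
  shows "x \<in> V" "y \<in> V" "x \<noteq> y" "E y x"
  using assms unfolding graph_on_def by blast+

lemma graph_on_finite: "graph_on V E \<Longrightarrow> finite V"
  by (simp add: graph_on_def)

lemma graph_on_sym: "graph_on V E \<Longrightarrow> E x y \<longleftrightarrow> E y x"
  using graph_onD(4) by metis

lemma graph_on_irrefl: "graph_on V E \<Longrightarrow> \<not> E x x"
  using graph_onD(3) by metis

lemma nbrs_subset: "graph_on V E \<Longrightarrow> nbrs E x \<subseteq> V - {x}"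
  unfolding graph_on_def nbrs_def by blast

lemma finite_nbrs: "graph_on V E \<Longrightarrow> finite (nbrs E x)"
  by (meson finite_Diff finite_subset graph_on_finite nbrs_subset)

lemma degree_le: "graph_on V E \<Longrightarrow> x \<in> V \<Longrightarrow> degree E x \<le> card V - 1"
  unfolding degree_def using nbrs_subset[of V E x] graph_on_finite[of V E]
  by (metis card_Diff_singleton card_mono finite_Diff)

lemma degree_outside: "graph_on V E \<Longrightarrow> x \<notin> V \<Longrightarrow> degree E x = 0"
proof -
  assume "graph_on V E" "x \<notin> V"
  then have "nbrs E x = {}" unfolding graph_on_def nbrs_def by blast
  then show ?thesis by (simp add: degree_def)
qed

lemma graph_on_add_edge: "graph_on V E \<Longrightarrow> a \<in> V \<Longrightarrow> b \<in> V \<Longrightarrow> a \<noteq> b \<Longrightarrow> graph_on V (add_edge a b E)"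
  by (auto simp: graph_on_def add_edge_def)

lemma graph_on_del_edge: "graph_on V E \<Longrightarrow> graph_on V (del_edge a b E)"
  by (auto simp: graph_on_def del_edge_def)

lemma degree_add_edge:
  assumes "graph_on V E" "a \<noteq> b" "\<not> E a b"
  shows "degree (add_edge a b E) x = degree E x + of_bool (x = a) + of_bool (x = b)"
proof -
  have "\<not> E b a" using assms graph_on_sym by metis
  have "nbrs (add_edge a b E) x = (if x = a then insert b (nbrs E x) else if x = b then insert a (nbrs E x) else nbrs E x)"
    using assms by (auto simp: add_edge_def)
  then show ?thesis
    using assms \<open>\<not> E b a\<close> finite_nbrs[OF assms(1)] by (simp add: degree_def card_insert_if)
qed

lemma degree_del_edge:
  assumes "graph_on V E" "E a b"
  shows "degree E x = degree (del_edge a b E) x + of_bool (x = a) + of_bool (x = b)"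
proof -
  have ab: "a \<noteq> b" "E b a" using assms graph_onD by metis+
  have "E = add_edge a b (del_edge a b E)"
    using assms ab by (auto simp: add_edge_def del_edge_def fun_eq_iff)
  moreover have "\<not> del_edge a b E a b" by (simp add: del_edge_def)
  ultimately show ?thesis
    using degree_add_edge[OF graph_on_del_edge[OF assms(1)] ab(1)] by metis
qed

text \<open>Alternating 4-cycle \<open>u a b w\<close>: each of the four vertices loses one edge and
  gains one. They are distinct, since \<open>u = b\<close> would make the edge \<open>wb\<close>
  equal to the non-edge \<open>uw\<close>, and likewise for \<open>w = a\<close>.\<close>

lemma switch_edges:
  assumes "graph_on V E" "E u a" "E w b" "\<not> E u w" "\<not> E a b" "u \<noteq> w" "a \<noteq> b"
  shows "graph_on V (add_edge u w (add_edge a b (del_edge u a (del_edge w b E))))" "degree (add_edge u w (add_edge a b (del_edge u a (del_edge w b E)))) x = degree E x"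
proof -
  note s = graph_on_sym[OF assms(1)]
  have ne: "u \<noteq> a" "w \<noteq> b" "u \<noteq> b" "w \<noteq> a" and V: "u \<in> V" "a \<in> V" "w \<in> V" "b \<in> V"
    using assms graph_onD[OF assms(1)] s by metis+
  have g1: "graph_on V (del_edge w b E)" and g2: "graph_on V (del_edge u a (del_edge w b E))"
    by (intro graph_on_del_edge assms(1))+
  have g3: "graph_on V (add_edge a b (del_edge u a (del_edge w b E)))"
    by (rule graph_on_add_edge[OF g2]) (use V assms in auto)
  show "graph_on V (add_edge u w (add_edge a b (del_edge u a (del_edge w b E))))" by (rule graph_on_add_edge[OF g3]) (use V assms in auto)
  have "degree (add_edge u w (add_edge a b (del_edge u a (del_edge w b E)))) x = degree (add_edge a b (del_edge u a (del_edge w b E))) x + of_bool (x = u) + of_bool (x = w)"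
    using assms ne by (intro degree_add_edge[OF g3]) (auto simp: add_edge_def del_edge_def)
  moreover have "degree (add_edge a b (del_edge u a (del_edge w b E))) x = degree (del_edge u a (del_edge w b E)) x + of_bool (x = a) + of_bool (x = b)"
    using assms ne by (intro degree_add_edge[OF g2]) (auto simp: add_edge_def del_edge_def)
  moreover have "degree (del_edge w b E) x = degree (del_edge u a (del_edge w b E)) x + of_bool (x = u) + of_bool (x = a)"
    using assms ne by (intro degree_del_edge[OF g1]) (auto simp: add_edge_def del_edge_def)
  moreover have "degree E x = degree (del_edge w b E) x + of_bool (x = w) + of_bool (x = b)"
    using assms ne by (intro degree_del_edge[OF assms(1)]) auto
  ultimately show "degree (add_edge u w (add_edge a b (del_edge u a (del_edge w b E)))) x = degree E x" by simp
qed

text \<open>Half of the preceding switch: \<open>u\<close> and \<open>w\<close> each give up an edge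
  and only \<open>ab\<close> is put in. The case \<open>u = w\<close> is included; the two
  indicators then add up to a deficit of two.\<close>

lemma absorb_ends:
  assumes "graph_on V E" "E u a" "E w b" "\<not> E a b" "a \<noteq> b" "u \<noteq> b" "w \<noteq> a"
  shows "graph_on V (add_edge a b (del_edge u a (del_edge w b E)))" "degree E x = degree (add_edge a b (del_edge u a (del_edge w b E))) x + of_bool (x = u) + of_bool (x = w)"
proof -
  have ne: "u \<noteq> a" "w \<noteq> b" and V: "u \<in> V" "a \<in> V" "w \<in> V" "b \<in> V"
    using assms graph_onD[OF assms(1)] by metis+
  have g1: "graph_on V (del_edge w b E)" and g2: "graph_on V (del_edge u a (del_edge w b E))"
    by (intro graph_on_del_edge assms(1))+
  show "graph_on V (add_edge a b (del_edge u a (del_edge w b E)))" by (rule graph_on_add_edge[OF g2]) (use V assms in auto)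
  have "degree (add_edge a b (del_edge u a (del_edge w b E))) x = degree (del_edge u a (del_edge w b E)) x + of_bool (x = a) + of_bool (x = b)"
    using assms ne by (intro degree_add_edge[OF g2]) (auto simp: add_edge_def del_edge_def)
  moreover have "degree (del_edge w b E) x = degree (del_edge u a (del_edge w b E)) x + of_bool (x = u) + of_bool (x = a)"
    using assms ne by (intro degree_del_edge[OF g1]) (auto simp: add_edge_def del_edge_def)
  moreover have "degree E x = degree (del_edge w b E) x + of_bool (x = w) + of_bool (x = b)"
    using assms ne by (intro degree_del_edge[OF assms(1)]) auto
  ultimately show "degree E x = degree (add_edge a b (del_edge u a (del_edge w b E))) x + of_bool (x = u) + of_bool (x = w)" by simp
qed

text \<open>The same trade along the alternating path \<open>u a x y b w\<close>, for use when
  \<open>ab\<close> cannot be added. \<open>a = b\<close> is allowed as long as \<open>u\<close> and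
  \<open>w\<close> differ, hence the condition on \<open>(u, a)\<close> and
  \<open>(w, b)\<close>.\<close>

lemma absorb_ends_via_edge:
  assumes "graph_on V E" "E u a" "E w b" "E x y" "\<not> E a x" "\<not> E b y" "a \<noteq> x" "b \<noteq> y"
    and "(u, a) \<noteq> (w, b)" "u \<noteq> b" "w \<noteq> a" "x \<noteq> u" "x \<noteq> w" "y \<noteq> a" "x \<noteq> b" "y \<noteq> u" "y \<noteq> w"
  shows "graph_on V (add_edge a x (add_edge b y (del_edge u a (del_edge w b (del_edge x y E)))))" "degree E z = degree (add_edge a x (add_edge b y (del_edge u a (del_edge w b (del_edge x y E))))) z + of_bool (z = u) + of_bool (z = w)"
proof -
  have ne: "u \<noteq> a" "w \<noteq> b" "x \<noteq> y" and V: "u \<in> V" "a \<in> V" "w \<in> V" "b \<in> V" "x \<in> V" "y \<in> V"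
    using assms graph_onD[OF assms(1)] by metis+
  have sy: "\<not> E x a" "\<not> E y b" using assms graph_on_sym by metis+
  have g0: "graph_on V (del_edge x y E)" and g1: "graph_on V (del_edge w b (del_edge x y E))" and g2: "graph_on V (del_edge u a (del_edge w b (del_edge x y E)))"
    by (intro graph_on_del_edge assms(1))+
  have g3: "graph_on V (add_edge b y (del_edge u a (del_edge w b (del_edge x y E))))"
    by (rule graph_on_add_edge[OF g2]) (use V assms in auto)
  show "graph_on V (add_edge a x (add_edge b y (del_edge u a (del_edge w b (del_edge x y E)))))" by (rule graph_on_add_edge[OF g3]) (use V assms in auto)
  have "degree (add_edge a x (add_edge b y (del_edge u a (del_edge w b (del_edge x y E))))) z = degree (add_edge b y (del_edge u a (del_edge w b (del_edge x y E)))) z + of_bool (z = a) + of_bool (z = x)"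
    using assms ne sy by (intro degree_add_edge[OF g3]) (auto simp: add_edge_def del_edge_def)
  moreover have "degree (add_edge b y (del_edge u a (del_edge w b (del_edge x y E)))) z = degree (del_edge u a (del_edge w b (del_edge x y E))) z + of_bool (z = b) + of_bool (z = y)"
    using assms ne sy by (intro degree_add_edge[OF g2]) (auto simp: add_edge_def del_edge_def)
  moreover have "degree (del_edge w b (del_edge x y E)) z = degree (del_edge u a (del_edge w b (del_edge x y E))) z + of_bool (z = u) + of_bool (z = a)"
    using assms ne sy by (intro degree_del_edge[OF g1]) (auto simp: add_edge_def del_edge_def)
  moreover have "degree (del_edge x y E) z = degree (del_edge w b (del_edge x y E)) z + of_bool (z = w) + of_bool (z = b)"
    using assms ne sy by (intro degree_del_edge[OF g0]) (auto simp: add_edge_def del_edge_def)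
  moreover have "degree E z = degree (del_edge x y E) z + of_bool (z = x) + of_bool (z = y)"
    using assms ne by (intro degree_del_edge[OF assms(1)]) auto
  ultimately show "degree E z = degree (add_edge a x (add_edge b y (del_edge u a (del_edge w b (del_edge x y E))))) z + of_bool (z = u) + of_bool (z = w)" by simp
qed

section \<open>Sequences with many terms of size at least r\<close>

text \<open>Each vertex of \<open>R\<close> that \<open>x\<close> lacks is a neighbour of
  \<open>j\<close>, and \<open>x\<close> can hand a private neighbour to \<open>j\<close> in return.
  Such a switch changes only pairs meeting \<open>x\<close> or \<open>j\<close> and lowers both
  sides of the cardinality inequality by one.\<close>

lemma transfer_neighbours:
  assumes "graph_on V E" "x \<noteq> j" "v \<noteq> x" "v \<noteq> j" "x \<notin> R" "v \<notin> R" "finite R"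
    and "R - nbrs E x \<subseteq> nbrs E j" "card (R - nbrs E x) \<le> card (nbrs E x - {v, j} - nbrs E j - R)"
  shows "\<exists>E'. graph_on V E' \<and> (\<forall>z. degree E' z = degree E z) \<and> nbrs E' v = nbrs E v \<and>
     (\<forall>p q. p \<notin> {x, j} \<longrightarrow> q \<notin> {x, j} \<longrightarrow> E' p q = E p q) \<and> R \<subseteq> nbrs E' x"
  using assms(1,8,9)
proof (induction "card (R - nbrs E x)" arbitrary: E)
  case 0
  then have "R \<subseteq> nbrs E x" using \<open>finite R\<close> by simp
  then show ?case using 0 by blast
next
  case (Suc k E)
  note g = \<open>graph_on V E\<close> and sub = Suc.prems(2) and le = Suc.prems(3)
  note sym = graph_on_sym[OF g] and irr = graph_on_irrefl[OF g]
  obtain r0 where r0: "r0 \<in> R" "\<not> E x r0"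
    using Suc(2) \<open>finite R\<close> by (metis DiffE card.empty equals0I in_nbrs nat.simps(3))
  then have jr: "E j r0" "r0 \<noteq> x" "r0 \<noteq> v" using sub assms by auto
  let ?Y = "nbrs E x - {v, j} - nbrs E j - R"
  have "card ?Y \<noteq> 0" using le Suc(2) by linarith
  then obtain y where yY: "y \<in> ?Y" by (metis card.empty ex_in_conv)
  then have y: "E x y" "y \<noteq> v" "y \<noteq> j" "\<not> E j y" "y \<notin> R" by auto
  define E1 where "E1 = add_edge x r0 (add_edge y j (del_edge x y (del_edge r0 j E)))"
  have E1: "graph_on V E1" "\<And>z. degree E1 z = degree E z"
    unfolding E1_def by (rule switch_edges[OF g]; use y jr r0 sym in auto)+
  have ne: "r0 \<noteq> y" "y \<noteq> r0" "y \<noteq> x" "x \<noteq> y" "r0 \<noteq> j" "j \<noteq> r0" "x \<noteq> r0" "j \<noteq> x" "j \<noteq> y" "v \<noteq> y" "v \<noteq> r0"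
    using y jr r0 irr assms(2) by metis+
  note ne = ne y(3) jr(2) assms(2-4) assms(3,4)[symmetric]
  have nbv: "nbrs E1 v = nbrs E v"
    unfolding nbrs_def E1_def add_edge_def del_edge_def by (simp add: ne)
  have same: "E1 p q = E p q" if "p \<notin> {x, j}" "q \<notin> {x, j}" for p q
    unfolding E1_def add_edge_def del_edge_def using that by simp
  have x1: "E1 x z \<longleftrightarrow> E x z \<and> z \<noteq> y \<or> z = r0" for z
    unfolding E1_def add_edge_def del_edge_def by (auto simp: ne)
  have j1: "E1 j z \<longleftrightarrow> E j z \<and> z \<noteq> r0 \<or> z = y" for z
    unfolding E1_def add_edge_def del_edge_def by (auto simp: ne)
  have eq: "R - nbrs E1 x = R - nbrs E x - {r0}" 
  proof (intro set_eqI)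
    fix z
    show "z \<in> R - nbrs E1 x \<longleftrightarrow> z \<in> R - nbrs E x - {r0}"
      using y(5) by (cases "z = y") (simp_all add: x1)
  qed
  have k: "k = card (R - nbrs E1 x)"
    using Suc(2) r0 \<open>finite R\<close> unfolding eq by simp
  moreover have "R - nbrs E1 x \<subseteq> nbrs E1 j"
  proof
    fix z assume "z \<in> R - nbrs E1 x"
    then show "z \<in> nbrs E1 j" using sub unfolding eq by (simp add: j1 subset_iff)
  qed
  moreover have "nbrs E1 x - {v, j} - nbrs E1 j - R = ?Y - {y}"
  proof (intro set_eqI)
    fix z
    show "z \<in> nbrs E1 x - {v, j} - nbrs E1 j - R \<longleftrightarrow> z \<in> ?Y - {y}"
      using r0 by (cases "z = r0"; cases "z = y") (simp_all add: x1 j1 ne)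
  qed
  then have "card (R - nbrs E1 x) \<le> card (nbrs E1 x - {v, j} - nbrs E1 j - R)"
    using yY le finite_nbrs[OF g] k Suc(2) by simp
  ultimately obtain E' where "graph_on V E'" "\<forall>z. degree E' z = degree E1 z" "nbrs E' v = nbrs E1 v"
    "\<forall>p q. p \<notin> {x, j} \<longrightarrow> q \<notin> {x, j} \<longrightarrow> E' p q = E1 p q" "R \<subseteq> nbrs E' x"
    using Suc(1)[of E1] E1(1) by blast
  then show ?case using E1 nbv same by (intro exI[of _ E']) auto
qed

text \<open>Lets \<open>x\<close> take over the role of \<open>j\<close> in a near-clique. The
  vertices seen only by \<open>x\<close> are at least as many as those seen only by
  \<open>j\<close>, even with \<open>v\<close> set aside: the strict degree inequality pays for
  \<open>v\<close>.\<close>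

lemma exchange:
  assumes g: "graph_on V E" and "x \<noteq> j" "v \<noteq> x" "v \<noteq> j" "x \<notin> R" "v \<notin> R"
    and "R \<subseteq> nbrs E j" "degree E j < degree E x"
  shows "\<exists>E'. graph_on V E' \<and> (\<forall>z. degree E' z = degree E z) \<and> nbrs E' v = nbrs E v \<and>
     (\<forall>p q. p \<notin> {x, j} \<longrightarrow> q \<notin> {x, j} \<longrightarrow> E' p q = E p q) \<and> R \<subseteq> nbrs E' x"
proof (rule transfer_neighbours[OF g])
  note sym = graph_on_sym[OF g] and irr = graph_on_irrefl[OF g] and fin = finite_nbrs[OF g]
  show "finite R" using finite_subset[OF \<open>R \<subseteq> nbrs E j\<close> fin] .
  let ?Y = "nbrs E x - {v, j} - nbrs E j" and ?X = "nbrs E j - nbrs E x - {x}" and ?C = "nbrs E x \<inter> nbrs E j"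
  have "nbrs E x \<subseteq> ?Y \<union> ?C \<union> {v} \<union> (if E x j then {j} else {})" by auto
  then have "degree E x \<le> card (?Y \<union> ?C \<union> {v} \<union> (if E x j then {j} else {}))"
    unfolding degree_def by (rule card_mono[rotated]) (use fin in auto)
  also have "\<dots> \<le> card ?Y + card ?C + 1 + of_bool (E x j)"
    by (intro order_trans[OF card_Un_le] add_mono) auto
  finally have 1: "degree E x \<le> card ?Y + card ?C + 1 + of_bool (E x j)" .
  have "card (?X \<union> ?C \<union> (if E x j then {x} else {})) = card ?X + card ?C + of_bool (E x j)"
    using fin irr sym by (subst card_Un_disjoint; (subst card_Un_disjoint)?; auto)
  moreover have "?X \<union> ?C \<union> (if E x j then {x} else {}) \<subseteq> nbrs E j" using sym by auto
  ultimately have "card ?X + card ?C + of_bool (E x j) \<le> degree E j"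
    unfolding degree_def using card_mono[OF fin] by metis
  then have "card ?X \<le> card ?Y" using 1 assms by linarith
  moreover have "card (R - nbrs E x) \<le> card ?X"
    using assms fin by (intro card_mono) auto
  moreover have "?Y - R = ?Y" using assms by auto
  ultimately show "card (R - nbrs E x) \<le> card (?Y - R)" by simp
qed (use assms in auto)

text \<open>\<open>E3\<close> and \<open>E4\<close> say that the switches along alternating 4- and 6-cycles that would make \<open>v\<close> adjacent to
  \<open>j\<close> without damaging \<open>S\<close> are blocked.\<close>

lemma stuck_clique:
  assumes g: "graph_on V E" and "finite S" "card S = r" "j \<in> S" "\<not> E v j" "v \<notin> S"
    and dmax: "\<And>x. degree E x \<le> degree E v" and "2 * r \<le> degree E j"
    and I: "I = nbrs E v - S" and B: "B = nbrs E j - S"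
    and E3: "\<And>i b. i \<in> I \<Longrightarrow> b \<in> B \<Longrightarrow> b = i \<or> E i b"
    and E4: "\<And>i b c e. i \<in> I \<Longrightarrow> b \<in> B \<Longrightarrow> E c e \<Longrightarrow> c \<notin> {v, j} \<Longrightarrow> e \<notin> {v, j} \<Longrightarrow> \<not> (c \<in> S \<and> e \<in> S)
      \<Longrightarrow> c = i \<or> E c i \<or> e = b \<or> E e b"
  shows "\<exists>Q\<subseteq>V. r + 1 \<le> card Q \<and> (\<forall>x\<in>Q. \<forall>y\<in>Q. x \<noteq> y \<longrightarrow> E x y)"
proof -
  note base = assms(2-6)
  note sym = graph_on_sym[OF g] and irr = graph_on_irrefl[OF g] and fin = finite_nbrs[OF g]
  have "0 < r" using base card_gt_0_iff by blast
  \<comment> \<open>At most \<open>r - 1\<close> neighbours of \<open>v\<close> or of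
    \<open>j\<close> lie in \<open>S\<close>, as neither is adjacent to \<open>j\<close>. Both
    degrees are at least \<open>2 * r\<close>, so at least \<open>r + 1\<close> neighbours remain
    outside.\<close>
  have c1: "card (S - {j}) = r - 1" using base by simp
  have "card (nbrs E z) - card (S - {j}) \<le> card (nbrs E z - (S - {j}))" for z
    using base by (intro diff_card_le_card_Diff) auto
  moreover have "I = nbrs E v - (S - {j})" "B = nbrs E j - (S - {j})" using I B irr base by auto
  ultimately have "degree E v - (r - 1) \<le> card I" "degree E j - (r - 1) \<le> card B"
    using c1 by (auto simp: degree_def)
  then have card: "r + 1 \<le> card I" "r + 1 \<le> card B"
    using dmax[of j] assms(8) \<open>0 < r\<close> by linarith+
  have sub: "I \<subseteq> V" "B \<subseteq> V" using I B nbrs_subset[OF g] by blast+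
  show ?thesis
  proof (rule ccontr)
    assume no: "\<not> ?thesis"
    \<comment> \<open>If neither set is a clique, non-adjacent pairs in both, together with the edge
      \<open>i'b'\<close> from \<open>E3\<close>, complete an alternating 6-cycle through
      \<open>v\<close>, \<open>i\<close>, \<open>b\<close>, \<open>j\<close>, which
      \<open>E4\<close> forbids.\<close>
    obtain i i' where i: "i \<in> I" "i' \<in> I" "i \<noteq> i'" "\<not> E i i'" using no card sub by blast
    obtain b b' where b: "b \<in> B" "b' \<in> B" "b \<noteq> b'" "\<not> E b b'" using no card sub by blast
    have "i' \<noteq> b'" using E3[OF i(1) b(2)] i by auto
    then have "E i' b'" using E3[OF i(2) b(2)] by auto
    moreover have "i' \<notin> {v, j}" "b' \<notin> {v, j}" using i b I B base irr sym by auto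
    moreover have "i' \<notin> S" using i I by auto
    ultimately have "i' = i \<or> E i' i \<or> b' = b \<or> E b' b" using E4[OF i(1) b(1)] by blast
    then show False using i b sym by blast
  qed
qed

lemma card_nbrs_Int: "finite Y \<Longrightarrow> card (nbrs E x \<inter> Y) = (\<Sum>y\<in>Y. of_bool (E x y))"
proof -
  assume "finite Y"
  have "nbrs E x \<inter> Y = Y \<inter> {y. E x y}" by (auto simp: nbrs_def)
  then show ?thesis using \<open>finite Y\<close> by (simp add: of_bool_def sum.If_cases)
qed

text \<open>Double counting of edges between two sets, which may overlap.\<close>

lemma card_nbr_count:
  assumes "finite X" "finite Y" "\<And>x y. E x y \<longleftrightarrow> E y x"
  shows "(\<Sum>x\<in>X. card (nbrs E x \<inter> Y)) = (\<Sum>y\<in>Y. card (nbrs E y \<inter> X))"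
proof -
  have "(\<Sum>x\<in>X. card (nbrs E x \<inter> Y)) = (\<Sum>y\<in>Y. \<Sum>x\<in>X. of_bool (E x y))"
    using assms by (subst sum.swap) (simp add: card_nbrs_Int)
  also have "\<dots> = (\<Sum>y\<in>Y. card (nbrs E y \<inter> X))"
    using assms(1) by (simp add: card_nbrs_Int assms(3)[of _ y for y])
  finally show ?thesis .
qed

text \<open>\<open>V\<close> splits into \<open>v\<close>, \<open>S\<close>, the outside vertices
  \<open>W1\<close> in the closed neighbourhood of some \<open>b\<close> in \<open>B\<close>, and
  the rest \<open>W2\<close>. A vertex of \<open>W2\<close> can be adjacent only to \<open>j\<close>
  and to the at most \<open>m\<close> vertices that equal or see each member of \<open>I\<close>,
  and each of those has few neighbours left for \<open>W2\<close>.\<close>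

lemma stuck_count:
  assumes g: "graph_on V E" and "v \<in> V" "S \<subseteq> V - {v}" "card S = r" "j \<in> S" "\<not> E v j"
    and dmax: "\<And>x. degree E x \<le> degree E v"
    and m: "m = degree E j" and "r \<le> m"
    and low: "\<And>x. x \<in> V - S - {v} \<Longrightarrow> degree E x \<le> m"
    and I: "I = nbrs E v - S" and B: "B = nbrs E j - S" and "I \<noteq> {}"
    and Im: "\<And>i. i \<in> I \<Longrightarrow> degree E i = m"
    and E3: "\<And>i b. i \<in> I \<Longrightarrow> b \<in> B \<Longrightarrow> b = i \<or> E i b"
    and E4: "\<And>i b c e. i \<in> I \<Longrightarrow> b \<in> B \<Longrightarrow> E c e \<Longrightarrow> c \<notin> {v, j} \<Longrightarrow> e \<notin> {v, j} \<Longrightarrow> \<not> (c \<in> S \<and> e \<in> S)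
      \<Longrightarrow> c = i \<or> E c i \<or> e = b \<or> E e b"
  shows "(\<Sum>x\<in>V. degree E x) + 2 * r \<le> m * m + 2 * (m * r) + m + r * r"
proof -
  note base = assms(2-6)
  note sym = graph_on_sym[OF g] and irr = graph_on_irrefl[OF g] and fin = finite_nbrs[OF g]
  have finV: "finite V" "finite S" using graph_on_finite[OF g] assms(3) finite_subset by blast+
  have "0 < r" using base finV card_gt_0_iff by blast
  have c1: "card (S - {j}) = r - 1" using base finV by simp
  have "card (nbrs E j) - card (S - {j}) \<le> card (nbrs E j - (S - {j}))"
    using finV by (intro diff_card_le_card_Diff) auto
  moreover have "B = nbrs E j - (S - {j})" using B irr base by auto
  ultimately have "0 < card B" using c1 \<open>r \<le> m\<close> \<open>0 < r\<close> m by (simp add: degree_def)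
  then obtain b where b: "b \<in> B" by (metis card_gt_0_iff ex_in_conv)
  then have jb: "E j b" "b \<notin> S" "b \<noteq> v" "b \<noteq> j" "b \<in> V"
    using B base irr sym graph_onD(2)[OF g] by auto
  have db: "degree E b \<le> m" using low jb by auto
  obtain i where i: "i \<in> I" using \<open>I \<noteq> {}\<close> by blast
  have IS: "I \<inter> S = {}" "v \<notin> I" "j \<notin> I" "finite I" using I irr fin base by auto
  \<comment> \<open>\<open>b\<close> is adjacent to \<open>j\<close> and, by \<open>E3\<close>, to
    all of \<open>I\<close> except possibly itself; if \<open>b\<close> lies in \<open>I\<close>,
    its neighbour \<open>v\<close> replaces it in the count.\<close>
  have cI: "card I + 1 \<le> m"
  proof (cases "b \<in> I")
    case False
    then have "insert j I \<subseteq> nbrs E b" using E3 b jb sym by fastforce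
    then have "card (insert j I) \<le> degree E b" unfolding degree_def by (intro card_mono fin)
    then show ?thesis using IS db by simp
  next
    case True
    then have "insert v (insert j (I - {b})) \<subseteq> nbrs E b" using E3 b jb sym I by fastforce
    then have "card (insert v (insert j (I - {b}))) \<le> degree E b" unfolding degree_def by (intro card_mono fin)
    moreover have "card (insert v (insert j (I - {b}))) = card I + 1"
    proof -
      have "v \<noteq> j" "0 < card I" using base IS True card_gt_0_iff by auto
      then show ?thesis using IS True by (simp add: card_insert_if)
    qed
    ultimately show ?thesis using db by simp
  qed
  let ?s = "card (nbrs E v \<inter> S)"
  have s: "?s \<le> r - 1"
  proof -
    have "nbrs E v \<inter> S \<subseteq> S - {j}" using base by auto
    then show ?thesis using c1 finV card_mono[of "S - {j}"] by fastforce
  qed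
  have dv: "degree E v = ?s + card I"
    unfolding degree_def I using fin by (metis Int_commute card_Int_Diff)
  then have dv': "degree E v \<le> m + r - 2" using s cI \<open>0 < r\<close> by linarith
  define W where "W = V - S - {v}"
  define W1 where "W1 = W \<inter> insert b (nbrs E b)"
  define W2 where "W2 = W - insert b (nbrs E b)"
  have WW: "W1 \<union> W2 = W" "W1 \<inter> W2 = {}" "finite W1" "finite W2" using finV by (auto simp: W1_def W2_def W_def)
  have split: "(\<Sum>x\<in>V. degree E x) = (\<Sum>x\<in>W1. degree E x) + (\<Sum>x\<in>W2. degree E x) + (\<Sum>x\<in>S. degree E x) + degree E v"
  proof -
    have "V = insert v (S \<union> W)" using base by (auto simp: W_def)
    moreover have "v \<notin> S \<union> W" "S \<inter> W = {}" using base by (auto simp: W_def)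
    ultimately have "(\<Sum>x\<in>V. degree E x) = degree E v + ((\<Sum>x\<in>S. degree E x) + (\<Sum>x\<in>W. degree E x))"
      using finV WW by (metis finite_UnI sum.insert sum.union_disjoint)
    also have "(\<Sum>x\<in>W. degree E x) = (\<Sum>x\<in>W1. degree E x) + (\<Sum>x\<in>W2. degree E x)"
      using WW by (metis sum.union_disjoint)
    finally show ?thesis by simp
  qed
  have sumS: "(\<Sum>x\<in>S. degree E x) \<le> m + (r - 1) * (m + r - 2)"
  proof -
    have "(\<Sum>x\<in>S. degree E x) = degree E j + (\<Sum>x\<in>S-{j}. degree E x)"
      using base finV by (intro sum.remove) auto
    moreover have "(\<Sum>x\<in>S-{j}. degree E x) \<le> of_nat (card (S - {j})) * (m + r - 2)"
      using dmax dv' order_trans by (intro sum_bounded_above) blast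
    ultimately show ?thesis using m c1 by simp
  qed
  have sum1: "(\<Sum>x\<in>W1. degree E x) \<le> m * m"
  proof -
    have "W1 \<subseteq> insert b (nbrs E b - {j})" using base by (auto simp: W1_def W_def)
    then have "card W1 \<le> card (insert b (nbrs E b - {j}))" using fin by (intro card_mono) auto
    also have "\<dots> \<le> Suc (card (nbrs E b - {j}))" by (rule card_insert_le_m1) auto
    also have "\<dots> = degree E b" using fin jb sym unfolding degree_def by (intro card.remove[symmetric]) auto
    finally have "card W1 \<le> m" using db by simp
    moreover have "(\<Sum>x\<in>W1. degree E x) \<le> of_nat (card W1) * m"
      by (rule sum_bounded_above) (use low in \<open>auto simp: W1_def W_def\<close>)
    ultimately show ?thesis by (metis mult_le_mono1 of_nat_id order_trans)
  qed
  define C where "C = {c \<in> V - {v, j}. \<forall>i\<in>I. c = i \<or> E c i}"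
  have finC: "finite C" using finV by (simp add: C_def)
  have IW2: "I \<inter> W2 = {}"
  proof -
    have "x \<in> insert b (nbrs E b)" if "x \<in> I" for x using E3[OF that b] sym[of x b] by auto
    then show ?thesis unfolding W2_def by blast
  qed
  \<comment> \<open>\<open>e\<close> is not adjacent to \<open>b\<close>, so for an edge
    \<open>ce\<close> the alternative left by \<open>E4\<close> is that \<open>c\<close> equals or
    sees every \<open>i\<close> in \<open>I\<close>.\<close>
  have nbW2: "nbrs E e \<subseteq> C \<union> {j}" if "e \<in> W2" for e
  proof
    fix c assume "c \<in> nbrs E e"
    then have ec: "E e c" "E c e" using sym by auto
    have e: "e \<notin> S" "e \<noteq> v" "e \<noteq> b" "\<not> E b e" "\<not> E e b" using that sym by (auto simp: W2_def W_def)
    then have "e \<noteq> j" using base by auto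
    have "\<not> E v e" using that IW2 e by (auto simp: I)
    then have "c \<noteq> v" using ec by auto
    show "c \<in> C \<union> {j}"
    proof (cases "c = j")
      case False
      have "c = i \<or> E c i" if "i \<in> I" for i
        using E4[OF that b ec(2)] e \<open>c \<noteq> v\<close> False \<open>e \<noteq> j\<close> by auto
      then show ?thesis using \<open>c \<noteq> v\<close> False graph_onD[OF g ec(1)] by (auto simp: C_def)
    qed simp
  qed
  have cC: "card C \<le> m"
  proof -
    have "C \<subseteq> insert i (nbrs E i - {v})" using i sym by (auto simp: C_def)
    then have "card C \<le> card (insert i (nbrs E i - {v}))" using fin by (intro card_mono) auto
    also have "\<dots> \<le> Suc (card (nbrs E i - {v}))" by (rule card_insert_le_m1) auto
    also have "\<dots> = degree E i" using fin i I sym unfolding degree_def by (intro card.remove[symmetric]) auto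
    finally show ?thesis using Im i by simp
  qed
  \<comment> \<open>\<open>c\<close> spends \<open>card I\<close> of its degree on \<open>I\<close>,
    with \<open>v\<close> in place of \<open>c\<close> if \<open>c\<close> lies in \<open>I\<close>.
    Since \<open>degree E c \<le> degree E v\<close> and \<open>v\<close> has at most
    \<open>r - 1\<close> neighbours besides \<open>I\<close>, no more than \<open>r - 1\<close> are
    left for \<open>W2\<close>.\<close>
  have C2: "card (nbrs E c \<inter> W2) \<le> r - 1" if "c \<in> C" for c
  proof -
    have "card (nbrs E c \<inter> W2) + card I \<le> degree E c"
    proof (cases "c \<in> I")
      case False
      then have "(nbrs E c \<inter> W2) \<union> I \<subseteq> nbrs E c" using that by (auto simp: C_def)
      then have "card ((nbrs E c \<inter> W2) \<union> I) \<le> degree E c" unfolding degree_def by (intro card_mono fin)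
      then show ?thesis using IW2 IS fin by (subst card_Un_disjoint[symmetric]) auto
    next
      case True
      then have "E c v" using I sym by auto
      then have "(nbrs E c \<inter> W2) \<union> insert v (I - {c}) \<subseteq> nbrs E c" using that by (auto simp: C_def)
      then have "card ((nbrs E c \<inter> W2) \<union> insert v (I - {c})) \<le> degree E c" unfolding degree_def by (intro card_mono fin)
      moreover have "card (insert v (I - {c})) = card I"
      proof -
        have "0 < card I" using IS True card_gt_0_iff by auto
        then show ?thesis using IS True by (simp add: card_insert_if)
      qed
      moreover have "card ((nbrs E c \<inter> W2) \<union> insert v (I - {c})) = card (nbrs E c \<inter> W2) + card (insert v (I - {c}))"
      proof (rule card_Un_disjoint)
        have "v \<notin> W2" by (simp add: W2_def W_def)
        then show "(nbrs E c \<inter> W2) \<inter> insert v (I - {c}) = {}" using IW2 by blast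
      qed (use fin IS in auto)
      ultimately show ?thesis by simp
    qed
    then show ?thesis using dmax[of c] dv s by linarith
  qed
  have sum2: "(\<Sum>x\<in>W2. degree E x) \<le> m * r"
  proof -
    have "(\<Sum>x\<in>W2. degree E x) \<le> (\<Sum>x\<in>W2. card (nbrs E x \<inter> C) + card (nbrs E x \<inter> {j}))"
    proof (rule sum_mono)
      fix x assume "x \<in> W2"
      then have "nbrs E x = (nbrs E x \<inter> C) \<union> (nbrs E x \<inter> {j})" using nbW2[OF \<open>x \<in> W2\<close>] by blast
      then show "degree E x \<le> card (nbrs E x \<inter> C) + card (nbrs E x \<inter> {j})"
        unfolding degree_def by (metis card_Un_le)
    qed
    also have "\<dots> = (\<Sum>x\<in>C. card (nbrs E x \<inter> W2)) + (\<Sum>x\<in>{j}. card (nbrs E x \<inter> W2))"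
      using card_nbr_count[of W2 C E] card_nbr_count[of W2 "{j}" E] WW finC sym
      by (simp add: sum.distrib)
    finally have 1: "(\<Sum>x\<in>W2. degree E x) \<le> (\<Sum>x\<in>C. card (nbrs E x \<inter> W2)) + (\<Sum>x\<in>{j}. card (nbrs E x \<inter> W2))" .
    have 2: "(\<Sum>x\<in>C. card (nbrs E x \<inter> W2)) \<le> of_nat (card C) * (r - 1)"
      by (rule sum_bounded_above[OF C2])
    have 3: "of_nat (card C) * (r - 1) \<le> m * (r - 1)" using cC by simp
    have 4: "(\<Sum>x\<in>{j}. card (nbrs E x \<inter> W2)) \<le> m"
      using m fin by (simp add: degree_def card_mono)
    have "m * r = m * (r - 1) + m" using \<open>0 < r\<close> by (cases r) auto
    then show ?thesis using 1 2 3 4 by linarith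
  qed
  obtain q where q: "r = Suc q" using \<open>0 < r\<close> by (cases r) auto
  have dvq: "degree E v + 1 \<le> m + q" using dv' q \<open>r \<le> m\<close> by linarith
  have "(\<Sum>x\<in>S. degree E x) + q \<le> m + q * (m + q)"
    using sumS q \<open>r \<le> m\<close> by (cases "m + q") (auto simp: algebra_simps)
  then show ?thesis using split sum1 sum2 dvq unfolding q by (simp add: algebra_simps)
qed

text \<open>For \<open>card S = r + 1\<close> this is a complete graph minus at most a triangle.
  \<open>A\<close> is an explicit witness so that one of its vertices can be exchanged for
  another.\<close>

definition almost_clique :: "('a \<Rightarrow> 'a \<Rightarrow> bool) \<Rightarrow> 'a set \<Rightarrow> 'a set \<Rightarrow> bool" where
  "almost_clique E S A \<longleftrightarrow> A \<subseteq> S \<and> card A \<le> 3 \<and>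
     (\<forall>x\<in>S. \<forall>y\<in>S. x \<noteq> y \<longrightarrow> \<not> (x \<in> A \<and> y \<in> A) \<longrightarrow> E x y)"

section \<open>Deleting a vertex and attaching it again\<close>

definition detach :: "'a \<Rightarrow> ('a \<Rightarrow> 'a \<Rightarrow> bool) \<Rightarrow> 'a \<Rightarrow> 'a \<Rightarrow> bool" where
  "detach v E = (\<lambda>x y. E x y \<and> x \<noteq> v \<and> y \<noteq> v)"

definition attach :: "'a \<Rightarrow> 'a set \<Rightarrow> ('a \<Rightarrow> 'a \<Rightarrow> bool) \<Rightarrow> 'a \<Rightarrow> 'a \<Rightarrow> bool" where
  "attach v X E = (\<lambda>x y. E x y \<or> x = v \<and> y \<in> X \<or> y = v \<and> x \<in> X)"

lemma graph_on_detach: "graph_on V E \<Longrightarrow> graph_on (V - {v}) (detach v E)"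
  unfolding graph_on_def detach_def by blast

lemma degree_detach:
  assumes "graph_on V E" "x \<noteq> v"
  shows "degree E x = degree (detach v E) x + of_bool (E v x)"
proof -
  have 1: "nbrs (detach v E) x = nbrs E x - {v}" using assms by (auto simp: detach_def)
  show ?thesis
  proof (cases "E v x")
    case True
    then have "v \<in> nbrs E x" using graph_on_sym[OF assms(1)] by simp
    then have "card (nbrs E x) = Suc (card (nbrs E x - {v}))" using finite_nbrs[OF assms(1)] card.remove by metis
    then show ?thesis using True by (simp add: degree_def 1)
  next
    case False
    then have "nbrs E x - {v} = nbrs E x" using graph_on_sym[OF assms(1), of v x] by auto
    then show ?thesis using False by (simp add: degree_def 1)
  qed
qed

lemma graph_on_attach: "graph_on (V - {v}) E \<Longrightarrow> v \<in> V \<Longrightarrow> X \<subseteq> V - {v} \<Longrightarrow> graph_on V (attach v X E)"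
  unfolding graph_on_def attach_def by (metis DiffE finite.emptyI finite_Diff2 finite_insert insertI1 subsetD)

lemma nbrs_attach: "graph_on (V - {v}) E \<Longrightarrow> v \<notin> X \<Longrightarrow> nbrs (attach v X E) v = X"
  unfolding graph_on_def attach_def nbrs_def by blast

lemma degree_attach:
  assumes "graph_on (V - {v}) E" "v \<in> V" "X \<subseteq> V - {v}" "x \<noteq> v"
  shows "degree (attach v X E) x = degree E x + of_bool (x \<in> X)"
proof -
  have "detach v (attach v X E) = E"
    using graph_onD(1,2)[OF assms(1)] unfolding attach_def detach_def fun_eq_iff by blast
  moreover have "attach v X E v x \<longleftrightarrow> x \<in> X"
    using graph_onD(1)[OF assms(1), of v x] assms(4) unfolding attach_def by blast
  ultimately show ?thesis using degree_detach[OF graph_on_attach[OF assms(1-3)] assms(4)] by simp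
qed

text \<open>The switching argument behind the Havel-Hakimi theorem: take a realization in which the
  neighbours of \<open>v\<close> have the largest degree sum. A neighbour \<open>i\<close> of
  smaller degree than a non-neighbour \<open>j\<close> could be switched out, because
  \<open>j\<close> has a neighbour that \<open>i\<close> lacks.\<close>

lemma exists_top_neighbourhood:
  assumes g0: "graph_on V E0" and v: "v \<in> V"
  shows "\<exists>E. graph_on V E \<and> (\<forall>x. degree E x = degree E0 x) \<and>
    (\<forall>i j. E v i \<longrightarrow> j \<in> V \<longrightarrow> j \<noteq> v \<longrightarrow> \<not> E v j \<longrightarrow> degree E0 j \<le> degree E0 i)"
proof -
  let ?P = "\<lambda>E. graph_on V E \<and> (\<forall>x. degree E x = degree E0 x)"
  let ?f = "\<lambda>E. \<Sum>x\<in>nbrs E v. degree E0 x"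
  have bound: "?f E < Suc (\<Sum>x\<in>V. degree E0 x)" if "?P E" for E
    using that nbrs_subset[of V E v] graph_on_finite[OF g0] by (auto intro!: le_imp_less_Suc sum_mono2)
  obtain E where E: "?P E" and mx: "\<And>F. ?P F \<Longrightarrow> ?f F \<le> ?f E"
    using ex_has_greatest_nat[of ?P E0 ?f "Suc (\<Sum>x\<in>V. degree E0 x)"] bound g0 by blast
  have g: "graph_on V E" using E by blast
  note fin = finite_nbrs[OF g] and sym = graph_on_sym[OF g] and irr = graph_on_irrefl[OF g]
  have "degree E0 j \<le> degree E0 i" if h: "E v i" "j \<in> V" "j \<noteq> v" "\<not> E v j" for i j
  proof (rule ccontr)
    assume "\<not> degree E0 j \<le> degree E0 i"
    then have lt: "card (nbrs E i) < card (nbrs E j)" using E by (simp add: degree_def)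
    \<comment> \<open>\<open>v\<close> is a neighbour of \<open>i\<close> but not of
      \<open>j\<close>; this offsets the possibility that \<open>i\<close> itself is a neighbour of
      \<open>j\<close>.\<close>
    have "\<not> nbrs E j \<subseteq> insert i (nbrs E i - {v})"
    proof
      assume "nbrs E j \<subseteq> insert i (nbrs E i - {v})"
      then have "card (nbrs E j) \<le> card (insert i (nbrs E i - {v}))" using fin by (intro card_mono) auto
      also have "\<dots> \<le> Suc (card (nbrs E i - {v}))" by (rule card_insert_le_m1) auto
      also have "\<dots> = card (nbrs E i)" using fin h sym by (intro card.remove[symmetric]) auto
      finally show False using lt by simp
    qed
    then obtain w where w: "E j w" "w \<noteq> i" "\<not> E i w" proof -
      obtain w where "w \<in> nbrs E j" "w \<notin> insert i (nbrs E i - {v})" using \<open>\<not> nbrs E j \<subseteq> _\<close> by blast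
      moreover have "w \<noteq> v" using calculation(1) h(4) sym[of v j] by auto
      ultimately show ?thesis using that by simp
    qed
    define F where "F = add_edge v j (add_edge i w (del_edge v i (del_edge j w E)))"
    have F: "graph_on V F" "\<And>x. degree F x = degree E x"
      unfolding F_def by (rule switch_edges[OF g]; use w h in auto)+
    have "v \<noteq> w" using w h sym[of v j] by auto
    then have "nbrs F v = insert j (nbrs E v - {i})"
      using h w graph_onD(3)[OF g h(1)] unfolding F_def add_edge_def del_edge_def nbrs_def by auto
    then have "?f F = degree E0 j + (\<Sum>x\<in>nbrs E v - {i}. degree E0 x)"
      using h fin by simp
    moreover have "?f E = degree E0 i + (\<Sum>x\<in>nbrs E v - {i}. degree E0 x)"
      using h fin by (intro sum.remove) auto
    ultimately have "?f E < ?f F" using lt E by (simp add: degree_def)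
    then show False using mx[of F] F E by auto
  qed
  then show ?thesis using E by blast
qed

text \<open>The bound \<open>r + 42 \<le> n\<close> survives lowering \<open>r\<close> and
  \<open>n\<close> together. It settles \<open>r = 4\<close>, where
  \<open>5 * r + 18 \<le> n\<close> is too weak for the final estimate, and for
  \<open>r \<ge> 6\<close> it follows from the latter.\<close>

lemma almost_clique_step:
  fixes V :: "'a set"
  assumes g0: "graph_on V E0" and r4: "4 \<le> r" and n: "n = card V" "r + 42 \<le> n" "5 * r + 18 \<le> n"
    and sum: "(2 * int r - 5) * int n - int r * int r + 4 * int r - 1 \<le> int (\<Sum>x\<in>V. degree E0 x)"
    and many: "r + 1 \<le> card {x \<in> V. r \<le> degree E0 x}"
    and IH: "\<And>(V' :: 'a set) E'. graph_on V' E' \<Longrightarrow> card V' = n - 1 \<Longrightarrow>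
      (2 * (int r - 1) - 5) * (int n - 1) - (int r - 1) * (int r - 1) + 4 * (int r - 1) - 1 \<le> int (\<Sum>x\<in>V'. degree E' x) \<Longrightarrow>
      r \<le> card {x \<in> V'. r - 1 \<le> degree E' x} \<Longrightarrow>
      \<exists>E'' S A. graph_on V' E'' \<and> (\<forall>x. degree E'' x = degree E' x) \<and> S \<subseteq> V' \<and> card S = r \<and> almost_clique E'' S A"
  shows "\<exists>E' S A. graph_on V E' \<and> (\<forall>x. degree E' x = degree E0 x) \<and> S \<subseteq> V \<and> card S = r + 1 \<and> almost_clique E' S A"
proof -
  have finV: "finite V" using graph_on_finite[OF g0] .
  define d where "d = degree E0"
  have "V \<noteq> {}" using n by auto
  define D where "D = Max (d ` V)"
  have "D \<in> d ` V" unfolding D_def using finV \<open>V \<noteq> {}\<close> by (intro Max_in) auto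
  then obtain v where v: "v \<in> V" "d v = D" by auto
  have vmax: "d x \<le> d v" for x
  proof (cases "x \<in> V")
    case True
    then show ?thesis using finV v by (auto simp: D_def)
  next
    case False
    then show ?thesis using degree_outside[OF g0] by (simp add: d_def)
  qed
  have dvr: "r \<le> d v"
  proof -
    have "{x \<in> V. r \<le> degree E0 x} \<noteq> {}" using many by (metis add_is_0 card.empty le_zero_eq one_neq_zero)
    then obtain x where "r \<le> d x" by (auto simp: d_def)
    then show ?thesis using vmax[of x] by simp
  qed
  define top where "top E \<longleftrightarrow> (\<forall>i j. E v i \<longrightarrow> j \<in> V \<longrightarrow> j \<noteq> v \<longrightarrow> \<not> E v j \<longrightarrow> d j \<le> d i)" for E
  obtain E1 where g1: "graph_on V E1" and d1: "\<And>x. degree E1 x = d x" and t1: "top E1"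
    using exists_top_neighbourhood[OF g0 v(1)] unfolding top_def d_def by blast
  have nb1: "nbrs E1 v \<subseteq> V - {v}" using nbrs_subset[OF g1] .
  have detd: "d x = degree (detach v E1) x + of_bool (E1 v x)" if "x \<noteq> v" for x
    using degree_detach[OF g1 that] d1 by simp
  have "\<exists>E'' S A. graph_on (V - {v}) E'' \<and> (\<forall>x. degree E'' x = degree (detach v E1) x) \<and> S \<subseteq> V - {v} \<and> card S = r \<and> almost_clique E'' S A"
  proof (rule IH[OF graph_on_detach[OF g1]])
    show "card (V - {v}) = n - 1" using v n by simp
    \<comment> \<open>Deleting \<open>v\<close> costs twice its degree, at most
      \<open>2 * (n - 1)\<close>, which is exactly the drop of the threshold.\<close>
    have "(\<Sum>x\<in>V. d x) = d v + (\<Sum>x\<in>V-{v}. d x)" using finV v by (intro sum.remove) auto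
    also have "(\<Sum>x\<in>V-{v}. d x) = (\<Sum>x\<in>V-{v}. degree (detach v E1) x) + (\<Sum>x\<in>V-{v}. of_bool (E1 v x))"
      unfolding sum.distrib[symmetric] by (rule sum.cong) (auto simp: detd)
    also have "(\<Sum>x\<in>V-{v}. of_bool (E1 v x)) = card (nbrs E1 v \<inter> (V - {v}))"
      using finV by (simp add: card_nbrs_Int)
    also have "nbrs E1 v \<inter> (V - {v}) = nbrs E1 v" using nb1 by auto
    finally have "(\<Sum>x\<in>V. d x) = 2 * d v + (\<Sum>x\<in>V-{v}. degree (detach v E1) x)"
      using d1[of v] by (simp add: degree_def)
    moreover have "d v \<le> n - 1" using degree_le[OF g1 v(1)] d1 n by simp
    ultimately have "int (\<Sum>x\<in>V. degree E0 x) \<le> 2 * (int n - 1) + int (\<Sum>x\<in>V-{v}. degree (detach v E1) x)"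
      using n by (simp add: d_def)
    then show "(2 * (int r - 1) - 5) * (int n - 1) - (int r - 1) * (int r - 1) + 4 * (int r - 1) - 1 \<le> int (\<Sum>x\<in>V-{v}. degree (detach v E1) x)"
      using sum by (simp add: algebra_simps)
    have "{x \<in> V. r \<le> degree E0 x} - {v} \<subseteq> {x \<in> V - {v}. r - 1 \<le> degree (detach v E1) x}"
    proof
      fix x assume "x \<in> {x \<in> V. r \<le> degree E0 x} - {v}"
      then have "x \<in> V" "x \<noteq> v" "r \<le> d x" by (auto simp: d_def)
      then show "x \<in> {x \<in> V - {v}. r - 1 \<le> degree (detach v E1) x}" using detd[of x] by (cases "E1 v x") auto
    qed
    then have "card ({x \<in> V. r \<le> degree E0 x} - {v}) \<le> card {x \<in> V - {v}. r - 1 \<le> degree (detach v E1) x}"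
      using finV by (intro card_mono) auto
    moreover have "card {x \<in> V. r \<le> degree E0 x} - 1 \<le> card ({x \<in> V. r \<le> degree E0 x} - {v})"
      using diff_card_le_card_Diff[of "{v}" "{x \<in> V. r \<le> degree E0 x}"] by simp
    ultimately show "r \<le> card {x \<in> V - {v}. r - 1 \<le> degree (detach v E1) x}" using many by linarith
  qed
  then obtain E2 S0 A0 where g2: "graph_on (V - {v}) E2" and d2: "\<And>x. degree E2 x = degree (detach v E1) x"
    and S0: "S0 \<subseteq> V - {v}" "card S0 = r" "almost_clique E2 S0 A0" by blast
  define E3 where "E3 = attach v (nbrs E1 v) E2"
  have g3: "graph_on V E3" unfolding E3_def by (rule graph_on_attach[OF g2 v(1) nb1])
  have nb3: "nbrs E3 v = nbrs E1 v" unfolding E3_def by (rule nbrs_attach[OF g2]) (use nb1 in auto)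
  have d3: "degree E3 x = d x" for x
  proof (cases "x = v")
    case True
    then show ?thesis using nb3 d1[of v] by (simp add: degree_def)
  next
    case False
    then show ?thesis using degree_attach[OF g2 v(1) nb1 False] d2 detd[OF False] by (simp add: E3_def)
  qed
  have t3: "top E3" using t1 nb3 unfolding top_def nbrs_def set_eq_iff by simp
  have c3: "almost_clique E3 S0 A0" using S0(3) unfolding almost_clique_def E3_def attach_def by blast
  let ?P = "\<lambda>(E, S, A). graph_on V E \<and> (\<forall>x. degree E x = d x) \<and> top E \<and> S \<subseteq> V - {v} \<and> card S = r \<and> almost_clique E S A"
  \<comment> \<open>Lexicographic order in one number: the second component is at most
    \<open>n\<close>, so the factor \<open>n + 1\<close> gives priority to the degree sum of
    \<open>S\<close>.\<close>
  let ?f = "\<lambda>(E, S, A :: 'a set). (\<Sum>x\<in>S. d x) * (n + 1) + card (nbrs E v \<inter> S)"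
  have bound: "?f q < (\<Sum>x\<in>V. d x) * (n + 1) + n + 1" if "?P q" for q
  proof -
    obtain E S A where q: "q = (E, S, A)" by (cases q)
    have "(\<Sum>x\<in>S. d x) \<le> (\<Sum>x\<in>V. d x)" using that finV q by (intro sum_mono2) auto
    moreover have "card (nbrs E v \<inter> S) \<le> n" using that q finV n by (auto intro!: card_mono)
    ultimately show ?thesis using q by (simp add: add_le_less_mono less_Suc_eq_le mult_le_mono1 add_mono)
  qed
  have P3: "?P (E3, S0, A0)" using g3 d3 t3 S0 c3 by simp
  obtain q where q: "?P q" and mx: "\<And>q'. ?P q' \<Longrightarrow> ?f q' \<le> ?f q"
    using ex_has_greatest_nat[of ?P "(E3, S0, A0)" ?f "(\<Sum>x\<in>V. d x) * (n + 1) + n + 1"] bound P3 by blast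
  obtain E S A where qe: "q = (E, S, A)" by (cases q)
  have g: "graph_on V E" and dE: "\<And>x. degree E x = d x" and tE: "top E" and S: "S \<subseteq> V - {v}" "card S = r"
    and cl: "almost_clique E S A" using q qe by auto
  note sym = graph_on_sym[OF g] and irr = graph_on_irrefl[OF g] and fin = finite_nbrs[OF g]
  have finS: "finite S" using S finV finite_subset by blast
  have vS: "v \<notin> S" using S by auto
  have AS: "A \<subseteq> S" "card A \<le> 3" using cl by (auto simp: almost_clique_def)
  have clE: "E x y" if "x \<in> S" "y \<in> S" "x \<noteq> y" "\<not> (x \<in> A \<and> y \<in> A)" for x y
    using cl that unfolding almost_clique_def by blast
  show ?thesis
  proof (cases "S \<subseteq> nbrs E v")
    case True
    have "almost_clique E (insert v S) A"
      unfolding almost_clique_def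
    proof (intro conjI ballI impI)
      fix x y assume "x \<in> insert v S" "y \<in> insert v S" "x \<noteq> y" "\<not> (x \<in> A \<and> y \<in> A)"
      then show "E x y" using clE[of x y] True sym[of x y] by auto
    qed (use AS in auto)
    moreover have "card (insert v S) = r + 1" using finS vS S by simp
    ultimately show ?thesis using g dE S v unfolding d_def by (intro exI[of _ E] exI[of _ "insert v S"] exI[of _ A]) auto
  next
    case False
    then obtain j where j: "j \<in> S" "\<not> E v j" unfolding nbrs_def by blast
    define I where "I = nbrs E v - S"
    define B where "B = nbrs E j - S"
    define m where "m = d j"
    have jv: "j \<noteq> v" "j \<in> V" using j S by auto
    \<comment> \<open>Otherwise \<open>x\<close> could replace \<open>s\<close> in \<open>S\<close>
      (and in \<open>A\<close>, if \<open>s\<close> lies there), raising the degree sum.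
      \<open>R\<close> collects the vertices that the near-clique obliges \<open>s\<close> to
      see.\<close>
    have exch: "d x \<le> d s" if x: "x \<in> V - S - {v}" and s: "s \<in> S" for x s
    proof (rule ccontr)
      assume lt: "\<not> d x \<le> d s"
      define R where "R = {y \<in> S. y \<noteq> s \<and> \<not> (s \<in> A \<and> y \<in> A)}"
      have "R \<subseteq> nbrs E s" using clE s by (auto simp: R_def)
      moreover have "x \<noteq> s" "v \<noteq> x" "v \<noteq> s" "x \<notin> R" "v \<notin> R" using x s vS by (auto simp: R_def)
      moreover have "degree E s < degree E x" using lt dE by simp
      ultimately obtain F where gF: "graph_on V F" and dF: "\<And>z. degree F z = degree E z" and nbF: "nbrs F v = nbrs E v"
        and same: "\<And>p q. p \<notin> {x, s} \<Longrightarrow> q \<notin> {x, s} \<Longrightarrow> F p q = E p q" and RF: "R \<subseteq> nbrs F x"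
        using exchange[OF g, of x s v R] by blast
      define S' where "S' = insert x (S - {s})"
      define A' where "A' = (if s \<in> A then insert x (A - {s}) else A)"
      have xS: "x \<notin> S" using x by auto
      have finA: "finite A" using AS finS finite_subset by blast
      have "card A' = card A"
      proof (cases "s \<in> A")
        case True
        then show ?thesis using finA xS AS card_Suc_Diff1[OF finA True] by (auto simp: A'_def card_insert_if)
      qed (simp add: A'_def)
      moreover have "A' \<subseteq> S'" using AS by (auto simp: A'_def S'_def)
      moreover have "F p y" if h: "p \<in> S'" "y \<in> S'" "p \<noteq> y" "\<not> (p \<in> A' \<and> y \<in> A')" for p y
      proof -
        have key: "F x z" if "z \<in> S - {s}" "\<not> (x \<in> A' \<and> z \<in> A')" for z
        proof -
          have "z \<in> R" using that AS xS unfolding R_def A'_def by (auto split: if_splits)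
          then show ?thesis using RF by auto
        qed
        consider "p = x" | "y = x" | "p \<in> S - {s}" "y \<in> S - {s}" using h(1,2) unfolding S'_def by blast
        then show ?thesis
        proof cases
          case 1
          then show ?thesis using key[of y] h by (auto simp: S'_def)
        next
          case 2
          then have "F x p" using key[of p] h by (auto simp: S'_def)
          then show ?thesis using graph_on_sym[OF gF] 2 by simp
        next
          case 3
          then have "p \<notin> {x, s}" "y \<notin> {x, s}" using xS by auto
          moreover have "\<not> (p \<in> A \<and> y \<in> A)" using h 3 by (auto simp: A'_def split: if_splits)
          ultimately show ?thesis using same clE[of p y] 3 h by simp
        qed
      qed
      ultimately have "almost_clique F S' A'" using AS unfolding almost_clique_def by auto
      moreover have "top F" using tE nbF unfolding top_def nbrs_def set_eq_iff by simp
      moreover have "S' \<subseteq> V - {v}" using S x by (auto simp: S'_def)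
      moreover have "card S' = r" using finS xS s S card_Suc_Diff1[OF finS s] by (simp add: S'_def card_insert_if)
      ultimately have "?P (F, S', A')" using gF dF dE by simp
      then have "?f (F, S', A') \<le> ?f (E, S, A)" using mx qe by blast
      moreover have "(\<Sum>z\<in>S. d z) = d s + (\<Sum>z\<in>S-{s}. d z)" using finS s by (intro sum.remove) auto
      moreover have "(\<Sum>z\<in>S'. d z) = d x + (\<Sum>z\<in>S-{s}. d z)" using finS xS by (simp add: S'_def)
      ultimately have le: "(\<Sum>z\<in>S'. d z) * (n + 1) \<le> (\<Sum>z\<in>S. d z) * (n + 1) + card (nbrs E v \<inter> S)"
        and ge: "(\<Sum>z\<in>S. d z) + 1 \<le> (\<Sum>z\<in>S'. d z)" using lt by auto
      have "((\<Sum>z\<in>S. d z) + 1) * (n + 1) \<le> (\<Sum>z\<in>S'. d z) * (n + 1)" using ge by (rule mult_le_mono1)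
      then have "n + 1 \<le> card (nbrs E v \<inter> S)" using le by (simp add: algebra_simps)
      moreover have "card (nbrs E v \<inter> S) \<le> card S" using finS by (intro card_mono) auto
      ultimately show False using S n by linarith
    qed
    \<comment> \<open>\<open>exch\<close> gives one inequality; \<open>top\<close> gives the other,
      as \<open>i\<close> is a neighbour of \<open>v\<close> and \<open>j\<close> is not.\<close>
    have Im: "d i = m" if "i \<in> I" for i
    proof -
      have i: "E v i" "i \<notin> S" "i \<in> V" "i \<noteq> v" using that graph_onD[OF g] irr by (auto simp: I_def)
      have "d i \<le> m" using exch[of i j] i j by (simp add: m_def)
      moreover have "m \<le> d i" using tE i j jv unfolding top_def m_def by blast
      ultimately show ?thesis by simp
    qed
    \<comment> \<open>Trading \<open>i\<close> for \<open>j\<close> among the neighbours of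
      \<open>v\<close> preserves \<open>top\<close>, since both have degree \<open>m\<close>, but
      increases the second component of \<open>?f\<close>.\<close>
    have improve: False
      if F: "graph_on V F" "\<And>x. degree F x = degree E x" "almost_clique F S A" "nbrs F v = insert j (nbrs E v - {i})" and i: "i \<in> I" for F i
    proof -
      have iS: "E v i" "i \<notin> S" using i by (auto simp: I_def)
      have Fv: "F v y \<longleftrightarrow> y = j \<or> E v y \<and> y \<noteq> i" for y
        using F(4) unfolding nbrs_def set_eq_iff by simp
      have "top F" unfolding top_def
      proof (intro allI impI)
        fix p z assume h: "F v p" "z \<in> V" "z \<noteq> v" "\<not> F v z"
        have dij: "d i = d j" using Im[OF i] m_def by simp
        show "d z \<le> d p"
        proof (cases "p = j")
          case True
          then show ?thesis using h Fv dij tE iS unfolding top_def by (metis order_refl)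
        next
          case False
          then have "E v p" using h Fv by simp
          then show ?thesis using h Fv dij tE iS j jv unfolding top_def by metis
        qed
      qed
      then have "?P (F, S, A)" using F dE S by simp
      then have "?f (F, S, A) \<le> ?f (E, S, A)" using mx qe by blast
      then have "card (nbrs F v \<inter> S) \<le> card (nbrs E v \<inter> S)" by simp
      moreover have "nbrs F v \<inter> S = insert j (nbrs E v \<inter> S)" using F(4) iS j by auto
      ultimately show False using finS j by simp
    qed
    have E3: "b = i \<or> E i b" if i: "i \<in> I" and b: "b \<in> B" for i b
    proof (rule ccontr)
      assume no: "\<not> (b = i \<or> E i b)"
      have h: "E v i" "i \<notin> S" "E j b" "b \<notin> S" "b \<noteq> v" using i b j sym[of j v] by (auto simp: I_def B_def)
      define F where "F = add_edge v j (add_edge i b (del_edge v i (del_edge j b E)))"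
      have "graph_on V F" "\<And>x. degree F x = degree E x"
        unfolding F_def by (rule switch_edges[OF g]; use h no j jv in auto)+
      moreover have "almost_clique F S A"
        unfolding almost_clique_def
      proof (intro conjI ballI impI)
        fix x y assume "x \<in> S" "y \<in> S" "x \<noteq> y" "\<not> (x \<in> A \<and> y \<in> A)"
        then show "F x y" using clE[of x y] h vS unfolding F_def add_edge_def del_edge_def by blast
      qed (use AS in auto)
      moreover have "nbrs F v = insert j (nbrs E v - {i})"
      proof -
        have "v \<noteq> i" using h irr by auto
        then show ?thesis using h jv unfolding F_def add_edge_def del_edge_def nbrs_def by blast
      qed
      ultimately show False using improve i by blast
    qed
    \<comment> \<open>Alternating 6-cycle \<open>v i c e b j\<close>. None of the deleted edges
      \<open>vi\<close>, \<open>ce\<close>, \<open>jb\<close> has both ends in \<open>S\<close>, so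
      the near-clique survives.\<close>
    have E4: "c = i \<or> E c i \<or> e = b \<or> E e b"
      if i: "i \<in> I" and b: "b \<in> B" and ce: "E c e" "c \<notin> {v, j}" "e \<notin> {v, j}" "\<not> (c \<in> S \<and> e \<in> S)" for i b c e
    proof (rule ccontr)
      assume no: "\<not> (c = i \<or> E c i \<or> e = b \<or> E e b)"
      have h: "E v i" "i \<notin> S" "E j b" "b \<notin> S" "b \<noteq> v" using i b j sym[of j v] by (auto simp: I_def B_def)
      have ne: "\<not> E i c" "\<not> E b e" "i \<noteq> c" "b \<noteq> e" "c \<noteq> v" "c \<noteq> j" "e \<noteq> v" "e \<noteq> j" "v \<noteq> j"
        using no ce sym[of i c] sym[of b e] jv by auto
      have ne2: "e \<noteq> i" "c \<noteq> b" "j \<noteq> i" "v \<noteq> i" "j \<noteq> b"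
        using no ce h j E3[OF i b] irr sym[of c i] by auto
      define F0 where "F0 = add_edge i c (add_edge b e (del_edge v i (del_edge j b (del_edge c e E))))"
      have F0: "graph_on V F0" "\<And>x. degree E x = degree F0 x + of_bool (x = v) + of_bool (x = j)"
        unfolding F0_def by (rule absorb_ends_via_edge[OF g h(1) h(3) ce(1)]; use ne ne2 h in auto)+
      have F0v: "F0 v y \<longleftrightarrow> E v y \<and> y \<noteq> i" for y
        using ne ne2 h(5) unfolding F0_def add_edge_def del_edge_def by blast
      define F where "F = add_edge v j F0"
      have "graph_on V F" unfolding F_def by (rule graph_on_add_edge[OF F0(1)]) (use v jv in auto)
      moreover have "degree F x = degree E x" for x
        unfolding F_def using degree_add_edge[OF F0(1), of v j x] F0(2)[of x] jv F0v j by simp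
      moreover have "almost_clique F S A"
        unfolding almost_clique_def
      proof (intro conjI ballI impI)
        fix x y assume "x \<in> S" "y \<in> S" "x \<noteq> y" "\<not> (x \<in> A \<and> y \<in> A)"
        then show "F x y" using clE[of x y] h vS ce(4) unfolding F_def F0_def add_edge_def del_edge_def by blast
      qed (use AS in auto)
      moreover have "nbrs F v = insert j (nbrs E v - {i})"
      proof -
        have "F v y \<longleftrightarrow> y = j \<or> E v y \<and> y \<noteq> i" for y
          using F0v[of y] jv unfolding F_def add_edge_def by blast
        then show ?thesis by (auto simp: nbrs_def)
      qed
      ultimately show False using improve i by blast
    qed
    have "card (nbrs E v \<inter> S) \<le> r - 1"
    proof -
      have "nbrs E v \<inter> S \<subseteq> S - {j}" using j by auto
      then have "card (nbrs E v \<inter> S) \<le> card (S - {j})" using finS by (intro card_mono) auto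
      then show ?thesis using finS j S by simp
    qed
    moreover have "degree E v = card (nbrs E v \<inter> S) + card I"
      unfolding degree_def I_def using fin by (metis Int_commute card_Int_Diff)
    ultimately have "card I \<noteq> 0" using dvr dE[of v] r4 by linarith
    then have I0: "I \<noteq> {}" by auto
    \<comment> \<open>A smaller \<open>m\<close> would confine the vertices of degree at least
      \<open>r\<close> to \<open>v\<close> and \<open>S - {j}\<close>, only \<open>r\<close>
      vertices in all.\<close>
    have rm: "r \<le> m"
    proof (rule ccontr)
      assume "\<not> r \<le> m"
      then have "{x \<in> V. r \<le> degree E0 x} \<subseteq> insert v (S - {j})"
        using exch j unfolding m_def d_def by fastforce
      then have "card {x \<in> V. r \<le> degree E0 x} \<le> card (insert v (S - {j}))" using finS by (intro card_mono) auto
      also have "\<dots> = r" using finS vS j S r4 by (simp add: card_insert_if)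
      finally show False using many by simp
    qed
    have dmax: "degree E x \<le> degree E v" for x using dE vmax by simp
    show ?thesis
    proof (cases "2 * r \<le> m")
      case True
      obtain Q where Q: "Q \<subseteq> V" "r + 1 \<le> card Q" "\<forall>x\<in>Q. \<forall>y\<in>Q. x \<noteq> y \<longrightarrow> E x y"
        using stuck_clique[OF g finS S(2) j vS dmax _ I_def B_def E3 E4] True dE m_def by auto
      obtain Q' where "Q' \<subseteq> Q" "card Q' = r + 1" using Q(2) obtain_subset_with_card_n by metis
      then have "almost_clique E Q' {}" using Q unfolding almost_clique_def by auto
      then show ?thesis using g dE \<open>Q' \<subseteq> Q\<close> \<open>card Q' = r + 1\<close> Q unfolding d_def
        by (intro exI[of _ E] exI[of _ Q'] exI[of _ "{}"]) auto
    next
      case False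
      have "(\<Sum>x\<in>V. degree E x) + 2 * r \<le> m * m + 2 * (m * r) + m + r * r"
        by (rule stuck_count[OF g v(1) S(1) S(2) j dmax _ rm _ I_def B_def I0 _ E3 E4])
          (use dE m_def exch j Im in auto)
      then have "(\<Sum>x\<in>V. degree E0 x) + 2 * r \<le> m * m + 2 * (m * r) + m + r * r"
        using dE by (simp add: d_def)
      then have "int ((\<Sum>x\<in>V. degree E0 x) + 2 * r) \<le> int (m * m + 2 * (m * r) + m + r * r)"
        by (rule of_nat_mono)
      then have le: "int (\<Sum>x\<in>V. degree E0 x) + 2 * int r \<le> int m * int m + 2 * (int m * int r) + int m + int r * int r"
        by (simp only: of_nat_add of_nat_mult of_nat_numeral)
      have m2: "int m \<le> 2 * int r - 1" using False by linarith
      have "int m * int m \<le> (2 * int r - 1) * (2 * int r - 1)" using m2 by (intro mult_mono) auto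
      moreover have "int m * int r \<le> (2 * int r - 1) * int r" using m2 by (intro mult_mono) auto
      ultimately have ub: "int (\<Sum>x\<in>V. degree E0 x) \<le> 9 * (int r * int r) - 6 * int r"
        using le m2 by (simp add: algebra_simps)
      show ?thesis
      proof (cases "r = 4")
        case True
        then show ?thesis using ub sum n by simp
      next
        case False
        have "(2 * int r - 5) * (5 * int r + 18) \<le> (2 * int r - 5) * int n"
          using r4 n by (intro mult_left_mono) auto
        then show ?thesis using ub sum False r4 by (simp add: algebra_simps)
      qed
    qed
  qed
qed

text \<open>The induction starts at 3: a complete graph on four vertices minus a triangle is a star
  with three leaves, so one vertex of degree three suffices.\<close>

theorem potentially_almost_clique:
  assumes "3 \<le> r" "graph_on V E" "r + 42 \<le> card V" "5 * r + 18 \<le> card V"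
    and "(2 * int r - 5) * int (card V) - int r * int r + 4 * int r - 1 \<le> int (\<Sum>x\<in>V. degree E x)"
    and "r + 1 \<le> card {x \<in> V. r \<le> degree E x}"
  shows "\<exists>E' S A. graph_on V E' \<and> (\<forall>x. degree E' x = degree E x) \<and> S \<subseteq> V \<and> card S = r + 1 \<and> almost_clique E' S A"
  using assms
proof (induction r arbitrary: V E rule: dec_induct)
  case base
  have "{x \<in> V. 3 \<le> degree E x} \<noteq> {}" using base by (metis add_is_0 card.empty le_zero_eq one_neq_zero)
  then obtain x where x: "x \<in> V" "3 \<le> card (nbrs E x)" by (auto simp: degree_def)
  then obtain A where A: "A \<subseteq> nbrs E x" "card A = 3" "finite A" using obtain_subset_with_card_n by metis
  have "x \<notin> A" using A graph_on_irrefl[OF base(1)] by auto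
  moreover have "almost_clique E (insert x A) A"
    unfolding almost_clique_def using A graph_on_sym[OF base(1)] by auto
  moreover have "insert x A \<subseteq> V" using A x nbrs_subset[OF base(1)] by blast
  ultimately show ?case using A base(1) by (intro exI[of _ E] exI[of _ "insert x A"] exI[of _ A]) auto
next
  case (step r)
  show ?case
  proof (rule almost_clique_step[OF step.prems(1) _ refl])
    fix V' :: "'a set" and E' assume h: "graph_on V' E'" "card V' = card V - 1"
      "(2 * (int (Suc r) - 1) - 5) * (int (card V) - 1) - (int (Suc r) - 1) * (int (Suc r) - 1) + 4 * (int (Suc r) - 1) - 1 \<le> int (\<Sum>x\<in>V'. degree E' x)"
      "Suc r \<le> card {x \<in> V'. Suc r - 1 \<le> degree E' x}"
    have "int (card V') = int (card V) - 1" using h step.prems by simp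
    then have "\<exists>E'' S A. graph_on V' E'' \<and> (\<forall>x. degree E'' x = degree E' x) \<and> S \<subseteq> V' \<and> card S = r + 1 \<and> almost_clique E'' S A"
      using h step.prems by (intro step.IH) auto
    then show "\<exists>E'' S A. graph_on V' E'' \<and> (\<forall>x. degree E'' x = degree E' x) \<and> S \<subseteq> V' \<and> card S = Suc r \<and> almost_clique E'' S A"
      by simp
  qed (use step in auto)
qed

section \<open>Sequences with few terms of size at least r\<close>

text \<open>Ordered pairs: each non-adjacent pair counts twice, and the bound 6 proved below stands
  for three missing edges.\<close>

definition missing :: "('a \<Rightarrow> 'a \<Rightarrow> bool) \<Rightarrow> 'a set \<Rightarrow> ('a \<times> 'a) set" where
  "missing E T = {(x, y). x \<in> T \<and> y \<in> T \<and> x \<noteq> y \<and> \<not> E x y}"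

definition non_nbrs :: "('a \<Rightarrow> 'a \<Rightarrow> bool) \<Rightarrow> 'a set \<Rightarrow> 'a \<Rightarrow> 'a set" where
  "non_nbrs E T x = {y \<in> T. y \<noteq> x \<and> \<not> E x y}"

lemma finite_missing: "finite T \<Longrightarrow> finite (missing E T)"
  by (rule finite_subset[of _ "T \<times> T"]) (auto simp: missing_def)

lemma card_missing: "finite T \<Longrightarrow> card (missing E T) = (\<Sum>x\<in>T. card (non_nbrs E T x))"
proof -
  assume "finite T"
  have "missing E T = Sigma T (non_nbrs E T)" by (auto simp: missing_def non_nbrs_def)
  then show ?thesis using \<open>finite T\<close> by (simp add: non_nbrs_def)
qed

lemma four_term_bound:
  "int a \<le> x \<Longrightarrow> int b \<le> x \<Longrightarrow> int q \<le> p \<Longrightarrow> y \<le> a + b + q \<Longrightarrow> int y \<le> 2 * x + p"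
  by linarith

lemma even_le_7: "(M :: nat) = 2 * k \<Longrightarrow> M \<le> 7 \<Longrightarrow> M \<le> 6"
  by presburger

lemma double_bound: "int y \<le> x \<Longrightarrow> z \<le> 2 * y \<Longrightarrow> int z \<le> 2 * x"
  by linarith

text \<open>Used when fewer than \<open>r + 1\<close> vertices reach degree \<open>r\<close>.
  \<open>T\<close> holds \<open>r + 1\<close> vertices of largest degree, with \<open>m\<close>
  separating them from the rest; by \<open>mx\<close>, \<open>E\<close> minimizes the missing pairs
  in \<open>T\<close> among all realizations of its degrees.\<close>

locale top_split =
  fixes V :: "'a set" and E :: "'a \<Rightarrow> 'a \<Rightarrow> bool" and T :: "'a set" and r m :: nat
  assumes g: "graph_on V E" and TV: "T \<subseteq> V" and cT: "card T = r + 1" and r6: "6 \<le> r"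
    and n: "5 * r + 18 \<le> card V" and mr: "m + 1 = r \<or> m + 2 = r"
    and low: "\<And>x. x \<in> V - T \<Longrightarrow> degree E x \<le> m" and high: "\<And>x. x \<in> T \<Longrightarrow> m \<le> degree E x"
    and sum: "(2 * int r - 5) * int (card V) - int r * int r + 4 * int r - 1 \<le> int (\<Sum>x\<in>V. degree E x)"
    and mx: "\<And>F. graph_on V F \<Longrightarrow> (\<And>x. degree F x = degree E x) \<Longrightarrow> card (missing E T) \<le> card (missing F T)"
begin

section \<open>Edge counts between the top set and the remaining vertices\<close>

definition L where "L = V - T"
definition N where "N = card L"
definition out where "out x = card (nbrs E x \<inter> L)"
text \<open>Vertices with more neighbours in \<open>L\<close> than any vertex of \<open>L\<close>
  has in total, as \<open>m < r\<close>. The integer \<open>t\<close> below is chosen so that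
  \<open>T - big\<close> has \<open>t + 1\<close> elements.\<close>

definition big where "big = {z \<in> T. r \<le> out z}"
definition K where "K = (\<Sum>x\<in>T - big. out x)"
text \<open>Twice the number of edges inside \<open>L\<close>.\<close>

definition inner where "inner = (\<Sum>x\<in>L. card (nbrs E x \<inter> L))"
definition t where "t = int r - int (card big)"

lemmas sym = graph_on_sym[OF g] and irr = graph_on_irrefl[OF g] and fin = finite_nbrs[OF g]

lemma finV: "finite V" "finite T" "finite L" "finite big"
proof -
  show 1: "finite V" using graph_on_finite[OF g] .
  show "finite T" using 1 TV finite_subset by blast
  then show "finite big" unfolding big_def by simp
  show "finite L" using 1 by (simp add: L_def)
qed

lemma N_ge: "4 * int r + 17 \<le> int N" and card_V: "int (card V) = int N + int r + 1"
proof -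
  have "card V = card T + N" unfolding N_def L_def using finV TV
    by (metis card_Diff_subset card_mono le_add_diff_inverse)
  then show "int (card V) = int N + int r + 1" "4 * int r + 17 \<le> int N" using cT n by auto
qed

lemma degree_split: "degree E x = card (nbrs E x \<inter> T) + out x"
proof -
  have "nbrs E x = (nbrs E x \<inter> T) \<union> (nbrs E x \<inter> L)" using nbrs_subset[OF g] by (auto simp: L_def)
  moreover have "(nbrs E x \<inter> T) \<inter> (nbrs E x \<inter> L) = {}" by (auto simp: L_def)
  ultimately show ?thesis unfolding degree_def out_def using fin
    by (metis card_Un_disjoint finite_Int)
qed

lemma card_non_nbrs:
  assumes "x \<in> T" shows "card (nbrs E x \<inter> T) + card (non_nbrs E T x) = r"
proof -
  have "(nbrs E x \<inter> T) \<union> non_nbrs E T x = T - {x}" using irr assms unfolding non_nbrs_def nbrs_def by blast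
  moreover have "(nbrs E x \<inter> T) \<inter> non_nbrs E T x = {}" by (auto simp: non_nbrs_def)
  moreover have "card (T - {x}) = r" using assms cT finV by simp
  ultimately show ?thesis using finV by (metis card_Un_disjoint finite_Diff finite_Un)
qed

lemma degree_T: "x \<in> T \<Longrightarrow> degree E x + card (non_nbrs E T x) = r + out x"
  using degree_split[of x] card_non_nbrs[of x] by simp

lemma out_le: "out x \<le> N"
  unfolding out_def N_def using finV by (intro card_mono) auto

lemma sum_T: "int (\<Sum>x\<in>T. degree E x) + int (card (missing E T)) = int (\<Sum>x\<in>T. out x) + (int r + 1) * int r"
proof -
  have "(\<Sum>x\<in>T. degree E x) + card (missing E T) = (\<Sum>x\<in>T. degree E x + card (non_nbrs E T x))"
    using finV by (simp add: card_missing sum.distrib)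
  also have "\<dots> = (\<Sum>x\<in>T. r + out x)" by (rule sum.cong) (simp_all add: degree_T)
  also have "\<dots> = (\<Sum>x\<in>T. out x) + (r + 1) * r" using cT by (simp add: sum.distrib)
  finally have "int ((\<Sum>x\<in>T. degree E x) + card (missing E T)) = int ((\<Sum>x\<in>T. out x) + (r + 1) * r)" by simp
  then show ?thesis by (simp only: of_nat_add of_nat_mult of_nat_1)
qed

lemma sum_L: "(\<Sum>x\<in>L. degree E x) = inner + (\<Sum>x\<in>T. out x)"
proof -
  have "(\<Sum>x\<in>L. degree E x) = (\<Sum>x\<in>L. card (nbrs E x \<inter> T)) + inner"
    unfolding inner_def sum.distrib[symmetric] by (rule sum.cong) (simp_all add: degree_split out_def)
  also have "(\<Sum>x\<in>L. card (nbrs E x \<inter> T)) = (\<Sum>x\<in>T. card (nbrs E x \<inter> L))"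
    by (rule card_nbr_count) (use finV sym in auto)
  finally show ?thesis by (simp add: out_def)
qed

lemma sum_V: "(\<Sum>x\<in>V. degree E x) = (\<Sum>x\<in>T. degree E x) + (\<Sum>x\<in>L. degree E x)"
  unfolding L_def using finV TV by (metis add.commute sum.subset_diff)

text \<open>Subtracting the contribution \<open>(r + 1) * r\<close> of a complete \<open>T\<close>
  from the threshold leaves the constant \<open>-6\<close>, the source of the final bound of six
  missing ordered pairs.\<close>

lemma sum_lower: "(2 * int r - 5) * int N - 6 + int (card (missing E T)) \<le> int (\<Sum>x\<in>T. out x) + int (\<Sum>x\<in>L. degree E x)"
proof -
  have "(2 * int r - 5) * int (card V) = (2 * int r - 5) * int N + (2 * int r - 5) * (int r + 1)"
    using card_V by (simp add: algebra_simps)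
  then show ?thesis using sum sum_T sum_V by (simp add: algebra_simps)
qed

lemma out_sum_le: "int (\<Sum>x\<in>T. out x) \<le> (int r - t) * int N + int K"
proof -
  have "(\<Sum>x\<in>T. out x) = (\<Sum>x\<in>big. out x) + K"
    unfolding K_def using finV by (metis (no_types, lifting) add.commute big_def mem_Collect_eq subsetI sum.subset_diff)
  moreover have "(\<Sum>x\<in>big. out x) \<le> of_nat (card big) * N" by (rule sum_bounded_above[OF out_le])
  then have "int (\<Sum>x\<in>big. out x) \<le> int (card big) * int N" by (metis of_nat_id of_nat_le_iff of_nat_mult)
  ultimately show ?thesis by (simp add: t_def)
qed

text \<open>Vertices of \<open>L\<close> contribute at most \<open>m\<close> each and vertices of
  \<open>big\<close> send out at most \<open>N\<close> edges each; the rest must come from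
  \<open>T - big\<close>. A positive coefficient of \<open>N\<close> is what later contradicts
  \<open>K_le\<close>.\<close>

lemma K_lower: "(t - 5 + (int r - int m)) * int N - 6 + int (card (missing E T)) \<le> int K"
proof -
  have "(\<Sum>x\<in>L. degree E x) \<le> of_nat (card L) * m" by (rule sum_bounded_above) (use low in \<open>auto simp: L_def\<close>)
  then have "int (\<Sum>x\<in>L. degree E x) \<le> int N * int m" by (metis N_def of_nat_id of_nat_le_iff of_nat_mult)
  then show ?thesis using sum_lower out_sum_le by (simp add: algebra_simps)
qed

text \<open>Companion of \<open>K_lower\<close> for small \<open>t\<close>: degrees in
  \<open>L\<close> are not estimated by \<open>m\<close> but split into edges inside
  \<open>L\<close> and edges to \<open>T\<close>.\<close>

lemma inner_lower: "(2 * t - 5) * int N - 6 + int (card (missing E T)) - 2 * int K \<le> int inner"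
  using sum_lower out_sum_le sum_L by (simp add: algebra_simps)

lemma card_T_big: "int (card (T - big)) = t + 1"
proof -
  have "card (T - big) = card T - card big" using finV by (intro card_Diff_subset) (auto simp: big_def)
  moreover have "card big \<le> card T" using finV by (intro card_mono) (auto simp: big_def)
  ultimately show ?thesis using cT by (simp add: t_def)
qed

lemma K_le:
  assumes "X \<subseteq> T - big"
  shows "int K \<le> int (\<Sum>x\<in>X. out x) + (t + 1 - int (card X)) * (int r - 1)" "int (card X) \<le> t + 1"
proof -
  have finX: "finite X" "finite (T - big)" using assms finV finite_subset by auto
  have "K = (\<Sum>x\<in>T - big - X. out x) + (\<Sum>x\<in>X. out x)"
    unfolding K_def using assms finX by (intro sum.subset_diff) auto
  moreover have "(\<Sum>x\<in>T - big - X. out x) \<le> of_nat (card (T - big - X)) * (r - 1)"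
    by (rule sum_bounded_above) (auto simp: big_def)
  then have "int (\<Sum>x\<in>T - big - X. out x) \<le> int (card (T - big - X)) * (int r - 1)"
  proof -
    assume "(\<Sum>x\<in>T - big - X. out x) \<le> of_nat (card (T - big - X)) * (r - 1)"
    then have "int (\<Sum>x\<in>T - big - X. out x) \<le> int (card (T - big - X) * (r - 1))"
      unfolding of_nat_id by (rule of_nat_mono)
    then show ?thesis using r6 by (simp add: of_nat_diff)
  qed
  moreover have "card (T - big - X) = card (T - big) - card X" "card X \<le> card (T - big)"
    using assms finX by (auto simp: card_Diff_subset card_mono)
  ultimately show "int K \<le> int (\<Sum>x\<in>X. out x) + (t + 1 - int (card X)) * (int r - 1)" "int (card X) \<le> t + 1"
    using card_T_big by auto
qed

text \<open>If \<open>absorbable u w\<close>, then \<open>u\<close> and \<open>w\<close> can each trade an edge leaving \<open>T\<close> for an edge inside \<open>T\<close>. This fails only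
  if the outside neighbours of \<open>u\<close> and \<open>w\<close> are completely joined; as they have degree less than \<open>r\<close> and must be
  adjacent to every vertex in \<open>big\<close>, there is then too little room for the degree sum.\<close>

definition absorbable where
  "absorbable u w \<longleftrightarrow> (\<exists>F. graph_on V F \<and> (\<forall>x\<in>T. \<forall>y\<in>T. F x y = E x y) \<and>
     (\<forall>x. degree E x = degree F x + of_bool (x = u) + of_bool (x = w)))"

lemma absorbable_sym: "absorbable u w \<Longrightarrow> absorbable w u"
  unfolding absorbable_def by (simp add: add.commute add.left_commute)

lemma L_neq_T: "x \<in> L \<Longrightarrow> y \<in> T \<Longrightarrow> x \<noteq> y"
  by (auto simp: L_def)

lemma nonabs_adj:
  assumes "\<not> absorbable u w" "u \<in> T" "w \<in> T" "a \<in> L" "b \<in> L" "E u a" "E w b" "a \<noteq> b"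
  shows "E a b"
proof (rule ccontr)
  assume "\<not> E a b"
  note L_neq_T[OF \<open>b \<in> L\<close> \<open>u \<in> T\<close>] L_neq_T[OF \<open>a \<in> L\<close> \<open>w \<in> T\<close>]
  then have "graph_on V (add_edge a b (del_edge u a (del_edge w b E)))"
    "\<And>x. degree E x = degree (add_edge a b (del_edge u a (del_edge w b E))) x + of_bool (x = u) + of_bool (x = w)"
    using absorb_ends[OF g assms(6,7) \<open>\<not> E a b\<close> assms(8)] by blast+
  moreover have "\<forall>x\<in>T. \<forall>y\<in>T. add_edge a b (del_edge u a (del_edge w b E)) x y = E x y"
    using L_neq_T[OF assms(4)] L_neq_T[OF assms(5)] unfolding add_edge_def del_edge_def by blast
  ultimately show False using assms(1) unfolding absorbable_def by blast
qed

lemma nonabs_blocked: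
  assumes "\<not> absorbable u w" "u \<in> T" "w \<in> T" "a \<in> L" "b \<in> L" "E u a" "E w b" "(u, a) \<noteq> (w, b)"
    and xy: "E x y" "x \<noteq> u" "x \<noteq> w" "x \<noteq> a" "x \<noteq> b" "y \<in> L" "y \<noteq> a" "y \<noteq> b"
  shows "E a x \<or> E b y"
proof (rule ccontr)
  assume no: "\<not> (E a x \<or> E b y)"
  let ?F = "add_edge a x (add_edge b y (del_edge u a (del_edge w b (del_edge x y E))))"
  have ne: "u \<noteq> b" "w \<noteq> a" "y \<noteq> u" "y \<noteq> w" using L_neq_T assms by metis+
  have "graph_on V ?F" "\<And>z. degree E z = degree ?F z + of_bool (z = u) + of_bool (z = w)"
    by (rule absorb_ends_via_edge[OF g assms(6,7) xy(1)]; use no xy ne assms(8) in auto)+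
  moreover have "\<forall>x\<in>T. \<forall>y\<in>T. ?F x y = E x y"
    using L_neq_T[OF assms(4)] L_neq_T[OF assms(5)] L_neq_T[OF xy(6)] unfolding add_edge_def del_edge_def by blast
  ultimately show False using assms(1) unfolding absorbable_def by blast
qed

lemma degree_L: "a \<in> L \<Longrightarrow> degree E a \<le> m"
  using low by (auto simp: L_def)

text \<open>Everything counted is adjacent to \<open>a\<close>, whose degree is at most
  \<open>m\<close>: \<open>X\<close>, \<open>u\<close>, and by \<open>nonabs_adj\<close> the outside
  neighbours of \<open>w\<close>. If \<open>a\<close> is itself one of these, \<open>w\<close> takes
  its place.\<close>

lemma nonabs_out:
  assumes "\<not> absorbable u w" "u \<in> T" "w \<in> T" "a \<in> L" "E u a" "u \<noteq> w \<or> E w a"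
    and X: "X \<subseteq> T - {u, w}" "\<And>z. z \<in> X \<Longrightarrow> E a z"
  shows "card X + out w + of_bool (u \<noteq> w) \<le> m"
proof -
  have finX: "finite X" using X finV finite_subset by blast
  let ?O = "nbrs E w \<inter> L - {a}" and ?W = "if E w a then {w} else {}"
  have sub: "X \<union> ?O \<union> ?W \<union> {u} \<subseteq> nbrs E a"
  proof -
    have "E a y" if "y \<in> ?O" for y using nonabs_adj[OF assms(1-4) _ assms(5), of y] that by auto
    moreover have "E a u" "E w a \<Longrightarrow> E a w" using assms(5) sym by metis+
    ultimately show ?thesis using X(2) unfolding nbrs_def by (auto split: if_splits)
  qed
  have O: "card ?O + card ?W = out w"
  proof (cases "E w a")
    case True
    then have "a \<in> nbrs E w \<inter> L" using assms by simp
    then have "card (nbrs E w \<inter> L) = Suc (card ?O)" using fin card.remove[of "nbrs E w \<inter> L" a] by simp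
    then show ?thesis using True by (simp add: out_def)
  next
    case False
    then have "?O = nbrs E w \<inter> L" by auto
    then show ?thesis using False by (simp add: out_def)
  qed
  have XO: "(X \<union> ?O) \<inter> ?W = {}" "X \<inter> ?O = {}" using X assms L_neq_T by auto
  have c3: "card (X \<union> ?O \<union> ?W) = card X + out w"
    using XO finX fin O by (simp add: card_Un_disjoint)
  have "card X + out w + of_bool (u \<noteq> w) \<le> card (X \<union> ?O \<union> ?W \<union> {u})"
  proof (cases "u = w")
    case True
    have "card (X \<union> ?O \<union> ?W) \<le> card (X \<union> ?O \<union> ?W \<union> {u})"
      by (rule card_mono) (use finX fin in auto)
    then show ?thesis using c3 True by simp
  next
    case False
    then have "u \<notin> X \<union> ?O \<union> ?W" using X assms L_neq_T by auto
    then show ?thesis using False c3 finX fin by simp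
  qed
  also have "\<dots> \<le> degree E a" unfolding degree_def using sub by (intro card_mono fin)
  also have "\<dots> \<le> m" using degree_L assms by blast
  finally show ?thesis .
qed

lemma m_bounds: "m < r" "2 \<le> m" using mr r6 by auto

text \<open>\<open>z\<close> has more neighbours in \<open>L\<close> than \<open>b\<close> has room
  for, so some \<open>y\<close> in \<open>L\<close> is adjacent to \<open>z\<close> but neither
  equal nor adjacent to \<open>b\<close>. The edge \<open>zy\<close> would allow the longer trade
  unless \<open>a\<close> sees \<open>z\<close>.\<close>

lemma nonabs_big_adj:
  assumes "\<not> absorbable u w" "u \<in> T" "w \<in> T" "a \<in> L" "b \<in> L" "E u a" "E w b" "(u, a) \<noteq> (w, b)"
    and z: "z \<in> big" "z \<noteq> u" "z \<noteq> w"
  shows "E a z"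
proof (rule ccontr)
  assume az: "\<not> E a z"
  have zT: "z \<in> T" "r \<le> out z" using z by (auto simp: big_def)
  have "insert b (nbrs E b \<inter> L) \<subseteq> insert b (nbrs E b - {w})" using L_neq_T assms(3) by auto
  then have "card (insert b (nbrs E b \<inter> L)) \<le> card (insert b (nbrs E b - {w}))" using fin by (intro card_mono) auto
  also have "\<dots> \<le> Suc (card (nbrs E b - {w}))" by (rule card_insert_le_m1) auto
  also have "\<dots> = degree E b" unfolding degree_def using fin assms(7) sym by (intro card.remove[symmetric]) auto
  also have "\<dots> < out z" using degree_L[OF assms(5)] zT m_bounds by linarith
  finally have "\<not> nbrs E z \<inter> L \<subseteq> insert b (nbrs E b \<inter> L)"
    unfolding out_def using fin by (metis card_mono finite.insertI finite_Int not_le)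
  then obtain y where y: "E z y" "y \<in> L" "y \<noteq> b" "\<not> E b y" unfolding nbrs_def by blast
  have "z \<noteq> a" "z \<noteq> b" using L_neq_T zT assms(4,5) by metis+
  moreover have "y \<noteq> a" using y az sym by metis
  ultimately have "E a z \<or> E b y" using nonabs_blocked[OF assms(1-8) y(1)] z y by blast
  then show False using az y by blast
qed

lemma nonabs_not_big:
  assumes "\<not> absorbable u w" "u \<in> T" "w \<in> T" "a \<in> L" "E u a" "u \<noteq> w \<or> E w a"
  shows "w \<notin> big"
  using nonabs_out[OF assms, of "{}"] m_bounds by (simp add: big_def)

text \<open>\<open>a\<close> already spends degree on \<open>u\<close> and on all of
  \<open>big\<close>. The second bound gains one more: \<open>b\<close> is among the neighbours in
  \<open>L\<close> or, if \<open>a = b\<close>, the vertex \<open>w\<close> is a further neighbour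
  in \<open>T\<close>.\<close>

lemma nonabs_inner_nbrs:
  assumes "\<not> absorbable u w" "u \<in> T" "w \<in> T" "a \<in> L" "b \<in> L" "E u a" "E w b" "(u, a) \<noteq> (w, b)" "u \<notin> big" "w \<notin> big"
  shows "int (card (nbrs E a \<inter> L)) \<le> int m - 1 - int (card big)"
    and "int (card (nbrs E a \<inter> L - {b})) \<le> int m - 2 - int (card big)"
proof -
  have bigT: "big \<subseteq> T" by (auto simp: big_def)
  have adj: "E a z" if "z \<in> big" for z
    using nonabs_big_adj[OF assms(1-8) that] that assms(9,10) by metis
  have ua: "E a u" using assms(6) sym by simp
  have d: "card (big \<union> (nbrs E a \<inter> L) \<union> {u}) \<le> m"
  proof -
    have "big \<union> (nbrs E a \<inter> L) \<union> {u} \<subseteq> nbrs E a" using adj ua by auto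
    then have "card (big \<union> (nbrs E a \<inter> L) \<union> {u}) \<le> degree E a" unfolding degree_def by (intro card_mono fin)
    then show ?thesis using degree_L[OF assms(4)] by simp
  qed
  have disj: "big \<inter> (nbrs E a \<inter> L) = {}" using bigT L_neq_T by blast
  have unot: "u \<notin> big \<union> (nbrs E a \<inter> L)" using assms(2,9) L_neq_T by blast
  have c: "card (big \<union> (nbrs E a \<inter> L) \<union> {u}) = card big + card (nbrs E a \<inter> L) + 1"
    using disj unot finV fin by (simp add: card_Un_disjoint)
  then show 1: "int (card (nbrs E a \<inter> L)) \<le> int m - 1 - int (card big)" using d by simp
  show "int (card (nbrs E a \<inter> L - {b})) \<le> int m - 2 - int (card big)"
  proof (cases "a = b")
    case False
    then have "E a b" using nonabs_adj[OF assms(1-7)] by simp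
    then have "b \<in> nbrs E a \<inter> L" using assms(5) by simp
    then have "card (nbrs E a \<inter> L) = Suc (card (nbrs E a \<inter> L - {b}))" using fin card.remove[of "nbrs E a \<inter> L" b] by simp
    then show ?thesis using 1 by simp
  next
    case True
    then have "u \<noteq> w" "E a w" using assms(7,8) sym by auto
    then have "big \<union> (nbrs E a \<inter> L) \<union> {u} \<union> {w} \<subseteq> nbrs E a" using adj ua by auto
    then have "card (big \<union> (nbrs E a \<inter> L) \<union> {u} \<union> {w}) \<le> degree E a" unfolding degree_def by (intro card_mono fin)
    moreover have "w \<notin> big \<union> (nbrs E a \<inter> L) \<union> {u}" using assms(3,10) L_neq_T \<open>u \<noteq> w\<close> by blast
    ultimately have "card big + card (nbrs E a \<inter> L) + 2 \<le> m"
      using c finV fin degree_L[OF assms(4)] by simp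
    moreover have "card (nbrs E a \<inter> L - {b}) \<le> card (nbrs E a \<inter> L)" using fin by (intro card_mono) auto
    ultimately show ?thesis by simp
  qed
qed

text \<open>Every edge inside \<open>L\<close> meets the small set \<open>Z\<close>. An edge
  \<open>xy\<close> avoiding it is blocked in both orientations, so \<open>b\<close> would see
  \<open>x\<close> and \<open>y\<close>, two neighbours in \<open>L\<close> apart from
  \<open>a\<close> where at most \<open>t - 3 \<le> 1\<close> are possible.\<close>

lemma nonabs_inner:
  assumes h: "\<not> absorbable u w" "u \<in> T" "w \<in> T" "a \<in> L" "b \<in> L" "E u a" "E w b" "(u, a) \<noteq> (w, b)" "u \<notin> big" "w \<notin> big"
    and m: "m + 1 = r" and t4: "t \<le> 4"
  shows "int inner \<le> 2 * (2 * (t - 2) + (t - 3) * (int r - 1))"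
proof -
  have h': "\<not> absorbable w u" "w \<in> T" "u \<in> T" "b \<in> L" "a \<in> L" "E w b" "E u a" "(w, b) \<noteq> (u, a)" "w \<notin> big" "u \<notin> big"
    using h absorbable_sym by auto
  define Z where "Z = {a, b} \<union> (nbrs E a \<inter> L - {b})"
  have finZ: "finite Z" using fin by (simp add: Z_def)
  have touch: "x \<in> Z \<or> y \<in> Z" if "x \<in> L" "y \<in> L" "E x y" for x y
  proof (rule ccontr)
    assume no: "\<not> (x \<in> Z \<or> y \<in> Z)"
    then have ne: "x \<noteq> a" "x \<noteq> b" "y \<noteq> a" "y \<noteq> b" "\<not> E a x" "\<not> E a y" using that by (auto simp: Z_def)
    have "x \<noteq> u" "x \<noteq> w" "y \<noteq> u" "y \<noteq> w" using that L_neq_T h(2,3) by metis+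
    then have "E a x \<or> E b y" "E a y \<or> E b x"
      using nonabs_blocked[OF h(1-8) that(3)] nonabs_blocked[OF h(1-8), of y x] that ne sym[of x y] by blast+
    then have "{x, y} \<subseteq> nbrs E b \<inter> L - {a}" using ne that by auto
    then have "card {x, y} \<le> card (nbrs E b \<inter> L - {a})" using fin by (intro card_mono) auto
    moreover have "x \<noteq> y" using that irr by metis
    ultimately have "2 \<le> card (nbrs E b \<inter> L - {a})" by simp
    then show False using nonabs_inner_nbrs(2)[OF h'] m t4 by (simp add: t_def)
  qed
  have "inner \<le> (\<Sum>x\<in>L. card (nbrs E x \<inter> Z) + (if x \<in> Z then card (nbrs E x \<inter> L) else 0))"
    unfolding inner_def
  proof (rule sum_mono)
    fix x assume x: "x \<in> L"
    show "card (nbrs E x \<inter> L) \<le> card (nbrs E x \<inter> Z) + (if x \<in> Z then card (nbrs E x \<inter> L) else 0)"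
    proof (cases "x \<in> Z")
      case False
      then have "nbrs E x \<inter> L \<subseteq> nbrs E x \<inter> Z" using touch[OF x] False unfolding nbrs_def by blast
      then show ?thesis using fin by (simp add: card_mono False)
    qed simp
  qed
  also have "\<dots> = (\<Sum>x\<in>Z. card (nbrs E x \<inter> L)) + (\<Sum>x\<in>L. (if x \<in> Z then card (nbrs E x \<inter> L) else 0))"
    using card_nbr_count[of L Z E] finV finZ sym by (simp add: sum.distrib)
  also have "(\<Sum>x\<in>L. (if x \<in> Z then card (nbrs E x \<inter> L) else 0)) = (\<Sum>x\<in>Z. card (nbrs E x \<inter> L))"
  proof -
    have "L \<inter> Z = Z" using h(4,5) by (auto simp: Z_def)
    then show ?thesis using finV by (simp add: sum.If_cases flip: sum.inter_restrict)
  qed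
  finally have inn: "inner \<le> 2 * (\<Sum>x\<in>Z. card (nbrs E x \<inter> L))" by simp
  have "(\<Sum>x\<in>Z. card (nbrs E x \<inter> L)) \<le> (\<Sum>x\<in>{a, b}. card (nbrs E x \<inter> L)) + (\<Sum>x\<in>nbrs E a \<inter> L - {b}. card (nbrs E x \<inter> L))"
    unfolding Z_def using fin irr by (subst sum.union_disjoint) auto
  moreover have "(\<Sum>x\<in>{a, b}. card (nbrs E x \<inter> L)) \<le> card (nbrs E a \<inter> L) + card (nbrs E b \<inter> L)"
    by (cases "a = b") auto
  moreover have "(\<Sum>x\<in>nbrs E a \<inter> L - {b}. card (nbrs E x \<inter> L)) \<le> of_nat (card (nbrs E a \<inter> L - {b})) * (r - 1)"
  proof (rule sum_bounded_above)
    fix x assume "x \<in> nbrs E a \<inter> L - {b}"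
    then have "degree E x \<le> m" using degree_L by auto
    moreover have "card (nbrs E x \<inter> L) \<le> degree E x" unfolding degree_def using fin by (intro card_mono) auto
    ultimately show "card (nbrs E x \<inter> L) \<le> r - 1" using m by linarith
  qed
  ultimately have le: "(\<Sum>x\<in>Z. card (nbrs E x \<inter> L)) \<le> card (nbrs E a \<inter> L) + card (nbrs E b \<inter> L) + card (nbrs E a \<inter> L - {b}) * (r - 1)"
    by simp
  define Y where "Y = (\<Sum>x\<in>Z. card (nbrs E x \<inter> L))"
  define Q where "Q = card (nbrs E a \<inter> L - {b}) * (r - 1)"
  define P where "P = (t - 3) * (int r - 1)"
  have 1: "int (card (nbrs E a \<inter> L)) \<le> t - 2" "int (card (nbrs E b \<inter> L)) \<le> t - 2" "int (card (nbrs E a \<inter> L - {b})) \<le> t - 3"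
    using nonabs_inner_nbrs(1)[OF h] nonabs_inner_nbrs(1)[OF h'] nonabs_inner_nbrs(2)[OF h] m by (auto simp: t_def)
  have "int Q = int (card (nbrs E a \<inter> L - {b})) * (int r - 1)"
    using r6 by (simp add: of_nat_diff Q_def)
  also have "\<dots> \<le> P"
    unfolding P_def using 1(3) r6 by (intro mult_right_mono) auto
  finally have "int Q \<le> P" .
  moreover have "Y \<le> card (nbrs E a \<inter> L) + card (nbrs E b \<inter> L) + Q"
    using le by (simp add: Q_def Y_def)
  ultimately have "int Y \<le> 2 * (t - 2) + P"
    using 1(1,2) by (rule four_term_bound[rotated 2])
  moreover have "inner \<le> 2 * Y" using inn by (simp add: Y_def)
  ultimately have "int inner \<le> 2 * (2 * (t - 2) + P)"
    by (rule double_bound)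
  then show ?thesis by (simp add: P_def)
qed

text \<open>Otherwise \<open>out u\<close> and \<open>out w\<close> are at most
  \<open>m - 1 - card big\<close>, which keeps \<open>K\<close> small and forces
  \<open>t \<ge> 3\<close>. Large \<open>t\<close> contradicts \<open>K_lower\<close>; the values 3
  and 4 left over for \<open>m = r - 1\<close> contradict \<open>inner_lower\<close>.\<close>

lemma absorb_distinct:
  assumes u: "u \<in> T" "w \<in> T" "u \<noteq> w" "0 < out u" "0 < out w"
  shows "absorbable u w"
proof (rule ccontr)
  assume no: "\<not> absorbable u w"
  obtain a b where a: "a \<in> L" "E u a" and b: "b \<in> L" "E w b"
    using u(4,5) unfolding out_def card_gt_0_iff nbrs_def by blast
  have no': "\<not> absorbable w u" using no absorbable_sym by blast
  have ab: "(u, a) \<noteq> (w, b)" "(w, b) \<noteq> (u, a)" using u by auto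
  have nbig: "w \<notin> big" "u \<notin> big"
    using nonabs_not_big[OF no u(1,2) a] nonabs_not_big[OF no' u(2,1) b] u by auto
  have bigT: "big \<subseteq> T - {u, w}" "big \<subseteq> T - {w, u}" using nbig by (auto simp: big_def)
  have adj: "\<And>z. z \<in> big \<Longrightarrow> E a z" "\<And>z. z \<in> big \<Longrightarrow> E b z"
    using nonabs_big_adj[OF no u(1,2) a(1) b(1) a(2) b(2) ab(1)] nonabs_big_adj[OF no' u(2,1) b(1) a(1) b(2) a(2) ab(2)] nbig
    by metis+
  have "card big + out w + of_bool (u \<noteq> w) \<le> m" "card big + out u + of_bool (w \<noteq> u) \<le> m"
    using nonabs_out[OF no u(1,2) a _ bigT(1) adj(1)] nonabs_out[OF no' u(2,1) b _ bigT(2) adj(2)] u by auto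
  then have ou: "int (out w) \<le> int m - 1 - int r + t" "int (out u) \<le> int m - 1 - int r + t"
    using u(3) by (simp_all add: t_def)
  have "{u, w} \<subseteq> T - big" using u nbig by auto
  note Kb = K_le[OF this]
  have Kl: "int K \<le> 2 * (int m - 1 - int r + t) + (t - 1) * (int r - 1)"
    using Kb(1) ou u(3) by (simp add: algebra_simps)
  have M0: "0 \<le> int (card (missing E T))" by simp
  have r: "6 \<le> int r" using r6 by simp
  show False
  proof (cases "m + 2 = r")
    case True
    then have m: "int m = int r - 2" by simp
    have t: "4 \<le> t" using ou u m by linarith
    have "(t - 3) * int N \<le> 6 + 2 * (t - 3) + (t - 1) * (int r - 1)" using K_lower Kl M0 m by (simp add: algebra_simps)
    moreover have "(t - 3) * (4 * int r + 17) \<le> (t - 3) * int N" using t N_ge by (intro mult_left_mono) auto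
    moreover have "0 \<le> (t - 4) * (int r - 6)" using t r by simp
    ultimately show False using t r by (simp add: algebra_simps)
  next
    case False
    then have m: "int m = int r - 1" and m1: "m + 1 = r" using mr by auto
    have t: "3 \<le> t" using ou u m by linarith
    show False
    proof (cases "5 \<le> t")
      case True
      have "(t - 4) * int N \<le> 6 + 2 * (t - 2) + (t - 1) * (int r - 1)" using K_lower Kl M0 m by (simp add: algebra_simps)
      moreover have "(t - 4) * (4 * int r + 17) \<le> (t - 4) * int N" using True N_ge by (intro mult_left_mono) auto
      moreover have "0 \<le> (t - 5) * (int r - 6)" using True r by simp
      ultimately show False using True r by (simp add: algebra_simps)
    next
      case False
      have "int inner \<le> 2 * (2 * (t - 2) + (t - 3) * (int r - 1))"
        using nonabs_inner[OF no u(1,2) a(1) b(1) a(2) b(2) ab(1) nbig(2,1) m1] False by simp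
      moreover have "t = 3 \<or> t = 4" using t False by linarith
      ultimately show False using inner_lower Kl M0 N_ge r m by auto
    qed
  qed
qed

text \<open>Here \<open>u\<close> gives up two outside edges and the bound on \<open>out u\<close>
  is weaker by one. The vertices \<open>p\<close> and \<open>q\<close> without outside edges
  compensate by lowering the bound on \<open>K\<close>.\<close>

lemma absorb_same:
  assumes u: "u \<in> T" "2 \<le> out u" and p: "p \<in> T" "q \<in> T" "p \<noteq> q" "out p = 0" "out q = 0"
  shows "absorbable u u"
proof (rule ccontr)
  assume no: "\<not> absorbable u u"
  obtain a b where ab: "a \<in> L" "E u a" "b \<in> L" "E u b" "a \<noteq> b"
  proof -
    have "\<exists>a b. a \<in> nbrs E u \<inter> L \<and> b \<in> nbrs E u \<inter> L \<and> a \<noteq> b"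
    proof (rule ccontr)
      assume "\<not> ?thesis"
      then have "card (nbrs E u \<inter> L) \<le> 1" using fin card_le_Suc0_iff_eq[of "nbrs E u \<inter> L"] by auto
      then show False using u by (simp add: out_def)
    qed
    then show ?thesis using that unfolding nbrs_def by blast
  qed
  have ne: "(u, a) \<noteq> (u, b)" using ab by auto
  have nbig: "u \<notin> big" using nonabs_not_big[OF no u(1,1) ab(1,2)] ab by blast
  have bigT: "big \<subseteq> T - {u, u}" using nbig by (auto simp: big_def)
  have adj: "\<And>z. z \<in> big \<Longrightarrow> E a z"
    using nonabs_big_adj[OF no u(1,1) ab(1,3,2,4) ne] nbig by metis
  have "card big + out u + of_bool (u \<noteq> u) \<le> m"
    by (rule nonabs_out[OF no u(1,1) ab(1,2) _ bigT adj]) (use ab in auto)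
  then have ou: "int (out u) \<le> int m - int r + t" by (simp add: t_def)
  have up: "u \<noteq> p" "u \<noteq> q" using u p by auto
  have "{u, p, q} \<subseteq> T - big" using u p nbig r6 by (auto simp: big_def)
  note Kb = K_le[OF this]
  have Kl: "int K \<le> int m - int r + t + (t - 2) * (int r - 1)"
    using Kb(1) ou up p by (simp add: algebra_simps)
  have M0: "0 \<le> int (card (missing E T))" by simp
  have r: "6 \<le> int r" using r6 by simp
  show False
  proof (cases "m + 2 = r")
    case True
    then have m: "int m = int r - 2" by simp
    have t: "4 \<le> t" using ou u m by linarith
    have "(t - 3) * int N \<le> 6 + (t - 2) + (t - 2) * (int r - 1)" using K_lower Kl M0 m by (simp add: algebra_simps)
    moreover have "(t - 3) * (4 * int r + 17) \<le> (t - 3) * int N" using t N_ge by (intro mult_left_mono) auto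
    moreover have "0 \<le> (t - 4) * (int r - 6)" using t r by simp
    ultimately show False using t r by (simp add: algebra_simps)
  next
    case False
    then have m: "int m = int r - 1" and m1: "m + 1 = r" using mr by auto
    have t: "3 \<le> t" using ou u m by linarith
    show False
    proof (cases "5 \<le> t")
      case True
      have "(t - 4) * int N \<le> 6 + (t - 1) + (t - 2) * (int r - 1)" using K_lower Kl M0 m by (simp add: algebra_simps)
      moreover have "(t - 4) * (4 * int r + 17) \<le> (t - 4) * int N" using True N_ge by (intro mult_left_mono) auto
      moreover have "0 \<le> (t - 5) * (int r - 6)" using True r by simp
      ultimately show False using True r by (simp add: algebra_simps)
    next
      case False
      have "int inner \<le> 2 * (2 * (t - 2) + (t - 3) * (int r - 1))"
        using nonabs_inner[OF no u(1,1) ab(1,3,2,4) ne nbig nbig m1] False by simp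
      moreover have "t = 3 \<or> t = 4" using t False by linarith
      ultimately show False using inner_lower Kl M0 N_ge r m by auto
    qed
  qed
qed

text \<open>Otherwise both could give up an outside edge in exchange for the edge \<open>uw\<close>,
  against the minimality in \<open>mx\<close>.\<close>

lemma open_adjacent:
  assumes u: "u \<in> T" "w \<in> T" "u \<noteq> w" "0 < out u" "0 < out w"
  shows "E u w"
proof (rule ccontr)
  assume no: "\<not> E u w"
  obtain F where F: "graph_on V F" "\<And>x y. x \<in> T \<Longrightarrow> y \<in> T \<Longrightarrow> F x y = E x y"
    "\<And>x. degree E x = degree F x + of_bool (x = u) + of_bool (x = w)"
    using absorb_distinct[OF u] unfolding absorbable_def by blast
  have Fn: "\<not> F u w" using F(2) u no by simp
  have uV: "u \<in> V" "w \<in> V" using u TV by auto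
  have "graph_on V (add_edge u w F)" by (rule graph_on_add_edge[OF F(1) uV u(3)])
  moreover have "degree (add_edge u w F) x = degree E x" for x
    using degree_add_edge[OF F(1) u(3) Fn] F(3)[of x] by simp
  ultimately have "card (missing E T) \<le> card (missing (add_edge u w F) T)" by (rule mx)
  moreover have "missing (add_edge u w F) T \<subset> missing E T"
  proof
    show "missing (add_edge u w F) T \<subseteq> missing E T" using F(2) unfolding missing_def add_edge_def by blast
    have "(u, w) \<in> missing E T" "(u, w) \<notin> missing (add_edge u w F) T" using u no by (auto simp: missing_def add_edge_def)
    then show "missing (add_edge u w F) T \<noteq> missing E T" by blast
  qed
  then have "card (missing (add_edge u w F) T) < card (missing E T)" using finite_missing finV by (intro psubset_card_mono) auto
  ultimately show False by simp
qed

text \<open>Otherwise outside edges of \<open>u\<close> and \<open>w\<close>, together with the edge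
  \<open>pq\<close>, pay for \<open>pu\<close> and \<open>qw\<close>: two missing pairs vanish and
  one appears. Only a vertex \<open>u = w\<close> with a single outside edge cannot pay
  twice.\<close>

lemma closed_rule:
  assumes p: "p \<in> T" "q \<in> T" "p \<noteq> q" "out p = 0" "out q = 0" "E p q"
    and u: "u \<in> T" "w \<in> T" "0 < out u" "0 < out w" "\<not> E p u" "\<not> E q w"
  shows "u = w \<and> out u = 1"
proof (rule ccontr)
  assume c: "\<not> (u = w \<and> out u = 1)"
  have "absorbable u w"
  proof (cases "u = w")
    case True
    then have "2 \<le> out u" using c u by linarith
    then show ?thesis using absorb_same[OF u(1) _ p(1-5)] True by simp
  next
    case False
    then show ?thesis using absorb_distinct[OF u(1,2) _ u(3,4)] by simp
  qed
  then obtain F where F: "graph_on V F" "\<And>x y. x \<in> T \<Longrightarrow> y \<in> T \<Longrightarrow> F x y = E x y"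
    "\<And>x. degree E x = degree F x + of_bool (x = u) + of_bool (x = w)"
    unfolding absorbable_def by blast
  have ne: "p \<noteq> u" "p \<noteq> w" "q \<noteq> u" "q \<noteq> w" using p u by auto
  have V: "p \<in> V" "q \<in> V" "u \<in> V" "w \<in> V" using p u TV by auto
  have Fpq: "F p q" "\<not> F p u" "\<not> F q w" using F(2) p u by auto
  define G1 where "G1 = del_edge p q F"
  define G2 where "G2 = add_edge p u G1"
  define G3 where "G3 = add_edge q w G2"
  have g1: "graph_on V G1" unfolding G1_def by (rule graph_on_del_edge[OF F(1)])
  have g2: "graph_on V G2" unfolding G2_def by (rule graph_on_add_edge[OF g1 V(1,3) ne(1)])
  have g3: "graph_on V G3" unfolding G3_def by (rule graph_on_add_edge[OF g2 V(2,4) ne(4)])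
  have n1: "\<not> G1 p u" using Fpq by (simp add: G1_def del_edge_def)
  have n2: "\<not> G2 q w" using Fpq ne p(3) by (simp add: G2_def add_edge_def G1_def del_edge_def)
  have "degree G3 x = degree E x" for x
    using degree_add_edge[OF g2 ne(4) n2, of x] degree_add_edge[OF g1 ne(1) n1, of x] degree_del_edge[OF F(1) Fpq(1), of x] F(3)[of x]
    unfolding G3_def[symmetric] G2_def[symmetric] G1_def[symmetric] by simp
  then have le: "card (missing E T) \<le> card (missing G3 T)" by (rule mx[OF g3])
  have sub: "missing G3 T \<subseteq> (missing E T - {(p, u), (u, p), (q, w), (w, q)}) \<union> {(p, q), (q, p)}"
    using F(2) unfolding missing_def G3_def G2_def G1_def add_edge_def del_edge_def by blast
  have up: "\<not> E u p" "\<not> E w q" using u sym by metis+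
  have four: "{(p, u), (u, p), (q, w), (w, q)} \<subseteq> missing E T" using p u ne up by (auto simp: missing_def)
  have c4: "card {(p, u), (u, p), (q, w), (w, q)} = 4" using ne p(3) by auto
  have fm: "finite (missing E T)" using finite_missing finV by auto
  have "card (missing G3 T) \<le> card ((missing E T - {(p, u), (u, p), (q, w), (w, q)}) \<union> {(p, q), (q, p)})"
    using sub fm by (intro card_mono) auto
  also have "\<dots> \<le> card (missing E T - {(p, u), (u, p), (q, w), (w, q)}) + card {(p, q), (q, p)}" by (rule card_Un_le)
  finally have 1: "card (missing G3 T) \<le> card (missing E T - {(p, u), (u, p), (q, w), (w, q)}) + card {(p, q), (q, p)}" .
  have 2: "card (missing E T - {(p, u), (u, p), (q, w), (w, q)}) = card (missing E T) - 4"
    using card_Diff_subset[OF _ four] unfolding c4 by blast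
  have "card {(p, q), (q, p)} \<le> 2" by (rule order_trans[OF card_insert_le_m1]) auto
  then have "card (missing G3 T) \<le> card (missing E T) - 4 + 2" using 1 2 by linarith
  moreover have "4 \<le> card (missing E T)" using card_mono[OF fm four] c4 by simp
  ultimately show False using le by linarith
qed

section \<open>Vertices of the top set with and without outside neighbours\<close>

definition C where "C = {x \<in> T. out x = 0}"
definition U where "U = T - C"

lemma C_U_facts: "C \<subseteq> T" "U \<subseteq> T" "finite C" "finite U" "C \<inter> U = {}" "T = C \<union> U" "C \<subseteq> T - big"
  using finV r6 by (auto simp: C_def U_def big_def)

lemma closedD: "c \<in> C \<Longrightarrow> c \<in> T \<and> out c = 0" and openD: "u \<in> U \<Longrightarrow> u \<in> T \<and> 0 < out u"
  by (auto simp: C_def U_def)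

lemma finite_non_nbrs: "finite (non_nbrs E T x)"
  using finV by (simp add: non_nbrs_def)

lemma non_nbrs_sym: "x \<in> T \<Longrightarrow> y \<in> non_nbrs E T x \<Longrightarrow> x \<in> non_nbrs E T y"
  using sym unfolding non_nbrs_def by auto

lemma non_nbrs_open: "u \<in> U \<Longrightarrow> non_nbrs E T u \<subseteq> C"
proof
  fix y assume u: "u \<in> U" and "y \<in> non_nbrs E T u"
  then have y: "y \<in> T" "y \<noteq> u" "\<not> E u y" by (auto simp: non_nbrs_def)
  then have "\<not> 0 < out y" using open_adjacent[of u y] openD[OF u] by auto
  then show "y \<in> C" using y by (simp add: C_def)
qed

lemma closed_non_nbrs: "c \<in> C \<Longrightarrow> card (non_nbrs E T c) + m \<le> r"
  using degree_T[of c] high[of c] closedD[of c] by auto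

lemma card_non_nbrs_split: "c \<in> C \<Longrightarrow> card (non_nbrs E T c) = card (non_nbrs E T c \<inter> C) + card (non_nbrs E T c \<inter> U)"
proof -
  have "non_nbrs E T c = (non_nbrs E T c \<inter> C) \<union> (non_nbrs E T c \<inter> U)" using C_U_facts(6) by (auto simp: non_nbrs_def)
  moreover have "(non_nbrs E T c \<inter> C) \<inter> (non_nbrs E T c \<inter> U) = {}" using C_U_facts(5) by auto
  ultimately show ?thesis using card_Un_disjoint[of "non_nbrs E T c \<inter> C" "non_nbrs E T c \<inter> U"] finite_non_nbrs by auto
qed

text \<open>Open vertices miss only closed ones. A missing pair inside \<open>C\<close> is counted
  from both of its ends; one with an end in \<open>U\<close> is seen from \<open>C\<close> once and
  gets the factor 2.\<close>

lemma card_missing_eq: "card (missing E T) = (\<Sum>c\<in>C. card (non_nbrs E T c \<inter> C) + 2 * card (non_nbrs E T c \<inter> U))"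
proof -
  let ?D = "\<lambda>x y. x \<in> T \<and> y \<in> T \<and> x \<noteq> y \<and> \<not> E x y"
  have D: "nbrs ?D x = non_nbrs E T x" if "x \<in> T" for x using that by (auto simp: non_nbrs_def)
  have "card (missing E T) = (\<Sum>x\<in>C. card (non_nbrs E T x)) + (\<Sum>x\<in>U. card (non_nbrs E T x))"
    unfolding card_missing[OF finV(2)] using sum.union_disjoint[OF C_U_facts(3,4,5)] C_U_facts(6) by metis
  also have "(\<Sum>x\<in>U. card (non_nbrs E T x)) = (\<Sum>x\<in>U. card (nbrs ?D x \<inter> C))"
  proof (rule sum.cong[OF refl])
    fix x assume "x \<in> U"
    then have "non_nbrs E T x = nbrs ?D x \<inter> C" using non_nbrs_open[of x] D[of x] C_U_facts(2) by blast
    then show "card (non_nbrs E T x) = card (nbrs ?D x \<inter> C)" by simp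
  qed
  also have "\<dots> = (\<Sum>x\<in>C. card (nbrs ?D x \<inter> U))"
    by (rule card_nbr_count) (use C_U_facts sym in auto)
  also have "\<dots> = (\<Sum>x\<in>C. card (non_nbrs E T x \<inter> U))"
    using D C_U_facts(1) by (intro sum.cong) auto
  finally have "card (missing E T) = (\<Sum>x\<in>C. card (non_nbrs E T x)) + (\<Sum>x\<in>C. card (non_nbrs E T x \<inter> U))" .
  also have "(\<Sum>x\<in>C. card (non_nbrs E T x)) = (\<Sum>x\<in>C. card (non_nbrs E T x \<inter> C) + card (non_nbrs E T x \<inter> U))"
    by (rule sum.cong) (simp_all add: card_non_nbrs_split)
  finally show ?thesis by (simp add: sum.distrib mult_2)
qed

lemma non_nbrs_subset_bound: "X \<subseteq> non_nbrs E T c \<Longrightarrow> c \<in> C \<Longrightarrow> card X + m \<le> r"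
  using closed_non_nbrs[of c] card_mono[OF finite_non_nbrs, of X c] by simp

lemma open_pair:
  assumes "p \<in> C" "q \<in> C" "p \<noteq> q" "E p q" "u \<in> non_nbrs E T p \<inter> U" "w \<in> non_nbrs E T q \<inter> U"
  shows "u = w \<and> out u = 1"
  using closed_rule[of p q u w] assms closedD[of p] closedD[of q] openD[of u] openD[of w] by (auto simp: non_nbrs_def)

lemma r_le_m2: "r \<le> m + 2" using mr by auto

text \<open>If \<open>out u\<close> is not 1, \<open>open_pair\<close> makes closed non-neighbours
  of \<open>u\<close> pairwise non-adjacent. One of them would then miss two others and
  \<open>u\<close>, more than the \<open>r - m \<le> 2\<close> that are possible.\<close>

lemma three_leaves:
  assumes u: "u \<in> U" "3 \<le> card (non_nbrs E T u)"
  shows "out u = 1"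
proof (rule ccontr)
  assume o: "out u \<noteq> 1"
  obtain X where X: "X \<subseteq> non_nbrs E T u" "card X = 3" using u(2) obtain_subset_with_card_n by metis
  then obtain x y z where xyz: "X = {x, y, z}" "x \<noteq> y" "y \<noteq> z" "x \<noteq> z" by (auto simp: card_3_iff)
  have C3: "x \<in> C" "y \<in> C" "z \<in> C" using non_nbrs_open[OF u(1)] X xyz by auto
  have uT: "u \<in> T" using u C_U_facts by auto
  have leaf: "u \<in> non_nbrs E T v \<inter> U" if "v \<in> X" for v using non_nbrs_sym[OF uT] X that u by auto
  have "\<not> E x y" "\<not> E x z" using open_pair[of x y u u] open_pair[of x z u u] C3 xyz leaf o by auto
  then have "{y, z, u} \<subseteq> non_nbrs E T x" using xyz C3 C_U_facts(1) leaf[of x] by (auto simp: non_nbrs_def)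
  moreover have "u \<noteq> y" "u \<noteq> z" using C3 u C_U_facts(5) by auto
  then have "card {y, z, u} = 3" using xyz by auto
  ultimately have "3 + m \<le> r" using non_nbrs_subset_bound[of "{y, z, u}" x] C3 by simp
  then show False using r_le_m2 by simp
qed

lemma C_bound: "int K \<le> (t + 1 - int (card C)) * (int r - 1)" "int (card C) \<le> t + 1"
  using K_le[OF C_U_facts(7)] closedD by auto

lemma uC_bound:
  assumes "u \<in> U" "out u = 1"
  shows "int K \<le> 1 + (t - int (card C)) * (int r - 1)" "int (card C) \<le> t"
proof -
  have u: "u \<notin> C" "u \<in> T - big" using assms C_U_facts r6 by (auto simp: big_def)
  then have "insert u C \<subseteq> T - big" using C_U_facts by auto
  from K_le[OF this] show "int K \<le> 1 + (t - int (card C)) * (int r - 1)" "int (card C) \<le> t"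
    using u C_U_facts assms closedD by auto
qed

text \<open>By \<open>non_nbrs_open\<close> every missing pair has an end in \<open>C\<close>, and vertices of \<open>C\<close> have at most \<open>r - m \<le> 2\<close>
  non-neighbours in \<open>T\<close>.\<close>

lemma case_m1:
  assumes m: "m + 1 = r"
  shows "card (missing E T) \<le> 6" "x \<in> T \<Longrightarrow> card (non_nbrs E T x) \<le> 2"
proof -
  have mi: "int m = int r - 1" using m by simp
  have r: "6 \<le> int r" using r6 by simp
  have closed1: "card X \<le> 1" if "X \<subseteq> non_nbrs E T c" "c \<in> C" for X c using non_nbrs_subset_bound[OF that] m by simp
  have open2: "card (non_nbrs E T u) \<le> 2" if u: "u \<in> U" for u
  proof (rule ccontr)
    assume "\<not> ?thesis"
    then have "3 \<le> card (non_nbrs E T u)" by simp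
    moreover have "out u = 1" by (rule three_leaves[OF u calculation])
    ultimately show False using degree_T[of u] high[of u] openD[OF u] m by auto
  qed
  then show "card (non_nbrs E T x) \<le> 2" if "x \<in> T" for x
    using closed1[OF order_refl, of x] that C_U_facts(6) by fastforce
  define p where "p c = card (non_nbrs E T c \<inter> U)" for c
  define P where "P = {c \<in> C. 0 < p c}"
  have finP: "finite P" using C_U_facts by (simp add: P_def)
  have p1: "p c \<le> 1" if "c \<in> C" for c unfolding p_def using closed1 that by blast
  have "(\<Sum>c\<in>C. p c) = (\<Sum>c\<in>P. p c)" using C_U_facts by (intro sum.mono_neutral_right) (auto simp: P_def)
  also have "\<dots> \<le> of_nat (card P) * 1" by (rule sum_bounded_above) (use p1 in \<open>auto simp: P_def\<close>)
  finally have sp: "(\<Sum>c\<in>C. p c) \<le> card P" by simp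
  have "card (missing E T) = (\<Sum>c\<in>C. card (non_nbrs E T c)) + (\<Sum>c\<in>C. p c)"
    unfolding card_missing_eq sum.distrib[symmetric] by (rule sum.cong) (simp_all add: card_non_nbrs_split p_def)
  moreover have "(\<Sum>c\<in>C. card (non_nbrs E T c)) \<le> of_nat (card C) * 1"
    by (rule sum_bounded_above) (use closed1 in blast)
  ultimately have M: "card (missing E T) \<le> card C + card P" using sp by simp
  have F: "(t - 4) * int N - 6 \<le> int K" using K_lower mi by simp
  have C5: "card C \<le> 5"
  proof (rule ccontr)
    assume "\<not> card C \<le> 5"
    then have c: "6 \<le> int (card C)" by simp
    then have t: "5 \<le> t" using C_bound by simp
    have "(t + 1 - int (card C)) * (int r - 1) \<le> (t - 5) * (int r - 1)" using c r by (intro mult_right_mono) auto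
    then have "(t - 4) * int N - 6 \<le> (t - 5) * (int r - 1)" using F C_bound(1) by linarith
    moreover have "(t - 4) * (4 * int r + 17) \<le> (t - 4) * int N" using t N_ge by (intro mult_left_mono) auto
    moreover have "0 \<le> (t - 5) * (int r - 6)" using t r by simp
    ultimately show False using t r by (simp add: algebra_simps)
  qed
  \<comment> \<open>With at most one vertex in \<open>P\<close>, the bound \<open>C5\<close>
    suffices. With two or more, all of \<open>P\<close> misses the same open \<open>u\<close> with
    \<open>out u = 1\<close>; this gives \<open>card P \<le> 2\<close> and improves
    \<open>card C \<le> 5\<close> to 4.\<close>
  show "card (missing E T) \<le> 6"
  proof (cases "card P \<le> 1")
    case True
    then show ?thesis using M C5 by simp
  next
    case False
    then obtain c1 c2 where c: "c1 \<in> P" "c2 \<in> P" "c1 \<noteq> c2"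
      using card_le_Suc0_iff_eq[OF finP] by (metis One_nat_def)
    then obtain u where u: "u \<in> non_nbrs E T c1 \<inter> U" unfolding P_def p_def card_gt_0_iff by blast
    have key: "out u = 1 \<and> u \<in> non_nbrs E T d" if d: "d \<in> P" "d \<noteq> c1" for d
    proof -
      obtain w where w: "w \<in> non_nbrs E T d \<inter> U" using d unfolding P_def p_def card_gt_0_iff by blast
      have dc: "d \<in> C" "c1 \<in> C" using d c by (auto simp: P_def)
      have "E c1 d"
      proof (rule ccontr)
        assume "\<not> E c1 d"
        then have "{d, u} \<subseteq> non_nbrs E T c1" using d dc C_U_facts u by (auto simp: non_nbrs_def)
        moreover have "d \<noteq> u" using dc u C_U_facts by auto
        then have "card {d, u} = 2" by simp
        ultimately show False using closed1[of "{d, u}" c1] dc by simp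
      qed
      then show ?thesis using open_pair[of c1 d u w] dc d u w by auto
    qed
    have o: "out u = 1" using key[of c2] c by auto
    have uT: "u \<in> T" "u \<in> U" using u by (auto simp: non_nbrs_def)
    have "P \<subseteq> non_nbrs E T u"
    proof
      fix d assume d: "d \<in> P"
      then have "u \<in> non_nbrs E T d" using key[of d] u by (cases "d = c1") auto
      then show "d \<in> non_nbrs E T u" using non_nbrs_sym[of d u] d C_U_facts by (auto simp: P_def)
    qed
    then have "card P \<le> 2" using card_mono[OF finite_non_nbrs] open2[OF uT(2)] order_trans by blast
    moreover have "card C \<le> 4"
    proof (rule ccontr)
      assume "\<not> card C \<le> 4"
      then have c: "5 \<le> int (card C)" by simp
      note B = uC_bound[OF uT(2) o]
      have t: "5 \<le> t" using B c by simp
      have "(t - int (card C)) * (int r - 1) \<le> (t - 5) * (int r - 1)" using c r by (intro mult_right_mono) auto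
      then have "(t - 4) * int N - 6 \<le> 1 + (t - 5) * (int r - 1)" using F B(1) by linarith
      moreover have "(t - 4) * (4 * int r + 17) \<le> (t - 4) * int N" using t N_ge by (intro mult_left_mono) auto
      moreover have "0 \<le> (t - 5) * (int r - 6)" using t r by simp
      ultimately show False using t r by (simp add: algebra_simps)
    qed
    ultimately show ?thesis using M by simp
  qed
qed

lemma K_lower_m2: "m + 2 = r \<Longrightarrow> (t - 3) * int N - 6 + int (card (missing E T)) \<le> int K"
proof -
  assume "m + 2 = r"
  then have "int r - int m = 2" by simp
  then show ?thesis using K_lower by simp
qed

lemma case_m2_t:
  assumes m: "m + 2 = r" and "C \<noteq> {}"
  shows "t \<le> 3"
proof (rule ccontr)
  assume "\<not> t \<le> 3"
  then have t: "4 \<le> t" by simp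
  have r: "6 \<le> int r" using r6 by simp
  have "1 \<le> int (card C)" using assms C_U_facts(3) by (simp add: Suc_le_eq card_gt_0_iff)
  then have "(t + 1 - int (card C)) * (int r - 1) \<le> t * (int r - 1)" using r by (intro mult_right_mono) auto
  then have "(t - 3) * int N - 6 \<le> t * (int r - 1)" using K_lower_m2[OF m] C_bound(1) by linarith
  moreover have "(t - 3) * (4 * int r + 17) \<le> (t - 3) * int N" using t N_ge by (intro mult_left_mono) auto
  moreover have "0 \<le> (t - 4) * (int r - 6)" using t r by simp
  ultimately show False using t r by (simp add: algebra_simps)
qed

text \<open>\<open>C\<close> and \<open>u\<close> exhaust \<open>T - big\<close>, so
  \<open>t = 3\<close> and \<open>K \<le> 1\<close>. The coefficient of \<open>N\<close> in
  \<open>K_lower_m2\<close> vanishes, leaving 6 + 1.\<close>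

lemma special_bound:
  assumes m: "m + 2 = r" and u: "u \<in> U" "out u = 1" "card C = 3"
  shows "card (missing E T) \<le> 7"
proof -
  have "C \<noteq> {}" using u by auto
  then have "t \<le> 3" using case_m2_t m by blast
  moreover note B = uC_bound[OF u(1,2)]
  ultimately have t: "t = 3" using u(3) by simp
  then show ?thesis using B(1) K_lower_m2[OF m] u(3) by simp
qed

lemma card_C_le: "m + 2 = r \<Longrightarrow> card C \<le> 4"
  using C_bound(2) case_m2_t by (cases "C = {}") auto

lemma non_nbrs_C:
  assumes "C = {x, y, z}" "x \<noteq> y" "x \<noteq> z" "y \<noteq> z"
  shows "card (non_nbrs E T x \<inter> C) = of_bool (\<not> E x y) + of_bool (\<not> E x z)"
proof -
  have "non_nbrs E T x \<inter> C = (if E x y then {} else {y}) \<union> (if E x z then {} else {z})"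
    using assms C_U_facts(1) by (auto simp: non_nbrs_def)
  then show ?thesis using assms by simp
qed

text \<open>The formula shows that the count is even, which improves the 7 of
  \<open>special_bound\<close> to 6. Otherwise adjacent vertices of \<open>C\<close> never both miss
  open vertices, and two non-neighbours per closed vertex leave at most three missing pairs.\<close>

lemma case_m2_three:
  assumes m: "m + 2 = r" and C3: "C = {x, y, z}" "x \<noteq> y" "x \<noteq> z" "y \<noteq> z"
  shows "card (missing E T) = 2 * (of_bool (\<not> E x y) + of_bool (\<not> E x z) + of_bool (\<not> E y z) +
      card (non_nbrs E T x \<inter> U) + card (non_nbrs E T y \<inter> U) + card (non_nbrs E T z \<inter> U))"
    and "card (missing E T) \<le> 6"
proof -
  let ?p = "\<lambda>c. card (non_nbrs E T c \<inter> U)"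
  have C3': "C = {y, x, z}" "C = {z, x, y}" using C3 by auto
  have x: "card (non_nbrs E T x \<inter> C) = of_bool (\<not> E x y) + of_bool (\<not> E x z)"
    "card (non_nbrs E T y \<inter> C) = of_bool (\<not> E x y) + of_bool (\<not> E y z)"
    "card (non_nbrs E T z \<inter> C) = of_bool (\<not> E x z) + of_bool (\<not> E y z)"
    using non_nbrs_C[OF C3] non_nbrs_C[OF C3'(1)] non_nbrs_C[OF C3'(2)] C3 sym[of x y] sym[of x z] sym[of y z] by auto
  have "card (missing E T) = (\<Sum>c\<in>{x, y, z}. card (non_nbrs E T c \<inter> C) + 2 * ?p c)"
    unfolding card_missing_eq by (rule sum.cong[OF C3(1) refl])
  also have "\<dots> = card (non_nbrs E T x \<inter> C) + 2 * ?p x + (card (non_nbrs E T y \<inter> C) + 2 * ?p y) + (card (non_nbrs E T z \<inter> C) + 2 * ?p z)"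
    using C3(2-4) by simp
  finally have "card (missing E T) = card (non_nbrs E T x \<inter> C) + 2 * ?p x + (card (non_nbrs E T y \<inter> C) + 2 * ?p y) + (card (non_nbrs E T z \<inter> C) + 2 * ?p z)" .
  then show eq: "card (missing E T) = 2 * (of_bool (\<not> E x y) + of_bool (\<not> E x z) + of_bool (\<not> E y z) + ?p x + ?p y + ?p z)"
    unfolding x by simp
  have le2: "card (non_nbrs E T c \<inter> C) + ?p c \<le> 2" if "c \<in> C" for c
    using closed_non_nbrs[OF that] card_non_nbrs_split[OF that] m by simp
  have b: "of_bool (\<not> E x y) + of_bool (\<not> E x z) + ?p x \<le> 2" "of_bool (\<not> E x y) + of_bool (\<not> E y z) + ?p y \<le> 2"
     "of_bool (\<not> E x z) + of_bool (\<not> E y z) + ?p z \<le> 2"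
    using le2[of x] le2[of y] le2[of z] C3 unfolding x by auto
  have c3: "card C = 3" using C3 by simp
  have special: "card (missing E T) \<le> 6" if h: "c \<in> C" "d \<in> C" "c \<noteq> d" "E c d" "0 < ?p c" "0 < ?p d" for c d
  proof -
    obtain u w where "u \<in> non_nbrs E T c \<inter> U" "w \<in> non_nbrs E T d \<inter> U" using h(5,6) unfolding card_gt_0_iff by blast
    then have "u \<in> U" "out u = 1" using open_pair[OF h(1-4)] by auto
    then have "card (missing E T) \<le> 7" using special_bound[OF m _ _ c3] by blast
    then show ?thesis by (rule even_le_7[OF eq])
  qed
  show "card (missing E T) \<le> 6"
  proof (rule ccontr)
    assume M: "\<not> card (missing E T) \<le> 6"
    then have ns: "\<not> E x y \<or> ?p x = 0 \<or> ?p y = 0" "\<not> E x z \<or> ?p x = 0 \<or> ?p z = 0" "\<not> E y z \<or> ?p y = 0 \<or> ?p z = 0"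
      using special[of x y] special[of x z] special[of y z] C3 by auto
    have "of_bool (\<not> E x y) + of_bool (\<not> E x z) + of_bool (\<not> E y z) + ?p x + ?p y + ?p z \<le> 3"
      using b ns by (cases "E x y"; cases "E x z"; cases "E y z") auto
    then show False using eq M by simp
  qed
qed

lemma case_m2_missing:
  assumes m: "m + 2 = r"
  shows "card (missing E T) \<le> 6"
proof -
  have le2: "card (non_nbrs E T c \<inter> C) + card (non_nbrs E T c \<inter> U) \<le> 2" if "c \<in> C" for c
    using closed_non_nbrs[OF that] card_non_nbrs_split[OF that] m by simp
  consider "card C = 0" | "card C = 1" | "card C = 2" | "card C = 3" | "card C = 4"
    using card_C_le[OF m] by linarith
  then show ?thesis
  proof cases
    case 1
    then have "C = {}" using C_U_facts by simp
    then show ?thesis by (simp add: card_missing_eq)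
  next
    case 2
    then obtain x where x: "C = {x}" by (rule card_1_singletonE)
    then show ?thesis using le2[of x] unfolding card_missing_eq by simp
  next
    case 3
    then obtain x y where xy: "C = {x, y}" "x \<noteq> y" by (auto simp: card_2_iff)
    have "card (missing E T) = (\<Sum>c\<in>{x, y}. card (non_nbrs E T c \<inter> C) + 2 * card (non_nbrs E T c \<inter> U))"
      unfolding card_missing_eq by (rule sum.cong[OF xy(1) refl])
    then have M: "card (missing E T) = card (non_nbrs E T x \<inter> C) + 2 * card (non_nbrs E T x \<inter> U) + (card (non_nbrs E T y \<inter> C) + 2 * card (non_nbrs E T y \<inter> U))"
      using xy by simp
    show ?thesis
    proof (cases "E x y")
      case False
      then have "y \<in> non_nbrs E T x \<inter> C" "x \<in> non_nbrs E T y \<inter> C" using xy C_U_facts sym[of x y] by (auto simp: non_nbrs_def)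
      then have "0 < card (non_nbrs E T x \<inter> C)" "0 < card (non_nbrs E T y \<inter> C)" using finite_non_nbrs by (auto simp: card_gt_0_iff)
      then show ?thesis using M le2[of x] le2[of y] xy by simp
    next
      case True
      then have "non_nbrs E T x \<inter> C = {}" "non_nbrs E T y \<inter> C = {}" using xy sym[of x y] by (auto simp: non_nbrs_def)
      then have M': "card (missing E T) = 2 * card (non_nbrs E T x \<inter> U) + 2 * card (non_nbrs E T y \<inter> U)" using M by simp
      show ?thesis
      proof (cases "non_nbrs E T x \<inter> U = {} \<or> non_nbrs E T y \<inter> U = {}")
        case True
        then have "card (non_nbrs E T x \<inter> U) = 0 \<or> card (non_nbrs E T y \<inter> U) = 0" by auto
        then show ?thesis using M' le2[of x] le2[of y] xy by auto
      next
        case F: False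
        then obtain u w where uw: "u \<in> non_nbrs E T x \<inter> U" "w \<in> non_nbrs E T y \<inter> U" by blast
        have "non_nbrs E T x \<inter> U \<subseteq> {w}" "non_nbrs E T y \<inter> U \<subseteq> {u}"
          using open_pair[of x y _ w] open_pair[of x y u] uw xy True by blast+
        then have "card (non_nbrs E T x \<inter> U) \<le> 1" "card (non_nbrs E T y \<inter> U) \<le> 1"
          using card_mono[of "{w}"] card_mono[of "{u}"] by fastforce+
        then show ?thesis using M' by simp
      qed
    qed
  next
    case 4
    then obtain x y z where "C = {x, y, z}" "x \<noteq> y" "x \<noteq> z" "y \<noteq> z" by (auto simp: card_3_iff)
    then show ?thesis using case_m2_three(2)[OF m] by blast
  next
    case 5
    then have "C \<noteq> {}" by auto
    then have "t \<le> 3" using case_m2_t m by blast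
    then have "t = 3" using C_bound(2) 5 by simp
    \<comment> \<open>The four vertices of \<open>C\<close> are all of \<open>T - big\<close>, so
      \<open>K = 0\<close> and \<open>K_lower_m2\<close> is precisely the bound.\<close>
    then show ?thesis using C_bound(1) K_lower_m2[OF m] 5 by simp
  qed
qed

text \<open>Three missing pairs with a common vertex do not fit into a triangle plus a path, hence
  the bound on non-neighbours. It can fail only for \<open>m = r - 2\<close>, at an open vertex
  missing exactly the three vertices of \<open>C\<close>.\<close>

lemma few_missing:
  "\<exists>F. graph_on V F \<and> (\<forall>x. degree F x = degree E x) \<and> card (missing F T) \<le> 6 \<and> (\<forall>x\<in>T. card (non_nbrs F T x) \<le> 2)"
proof (cases "m + 1 = r")
  case True
  then show ?thesis using case_m1 g by (intro exI[of _ E]) auto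
next
  case False
  then have m: "m + 2 = r" using mr by auto
  show ?thesis
  proof (cases "\<forall>x\<in>T. card (non_nbrs E T x) \<le> 2")
    case True
    then show ?thesis using case_m2_missing[OF m] g by (intro exI[of _ E]) auto
  next
    case False
    then obtain u where u: "u \<in> T" "3 \<le> card (non_nbrs E T u)" by fastforce
    have "u \<notin> C" using closed_non_nbrs[of u] u m by auto
    then have uU: "u \<in> U" using u by (simp add: U_def)
    have o: "out u = 1" by (rule three_leaves[OF uU u(2)])
    have sub: "non_nbrs E T u \<subseteq> C" by (rule non_nbrs_open[OF uU])
    then have "3 \<le> card C" using u(2) card_mono[OF C_U_facts(3)] order_trans by blast
    then have "C \<noteq> {}" by auto
    then have "t \<le> 3" using case_m2_t m by blast
    then have c3: "card C = 3" using uC_bound(2)[OF uU o] \<open>3 \<le> card C\<close> by simp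
    then have nC: "non_nbrs E T u = C" using sub u(2) C_U_facts(3) by (metis card_seteq)
    obtain x y z where C3: "C = {x, y, z}" "x \<noteq> y" "x \<noteq> z" "y \<noteq> z" using c3 by (auto simp: card_3_iff)
    have leaf: "u \<in> non_nbrs E T c \<inter> U" if "c \<in> C" for c using non_nbrs_sym[OF u(1)] nC that uU by auto
    have pos: "0 < card (non_nbrs E T c \<inter> U)" if "c \<in> C" for c
      using leaf[OF that] finite_non_nbrs by (auto simp: card_gt_0_iff)
    have S: "of_bool (\<not> E x y) + of_bool (\<not> E x z) + of_bool (\<not> E y z) +
        card (non_nbrs E T x \<inter> U) + card (non_nbrs E T y \<inter> U) + card (non_nbrs E T z \<inter> U) \<le> 3"
      using case_m2_three[OF m C3] by simp
    have pos3: "0 < card (non_nbrs E T x \<inter> U)" "0 < card (non_nbrs E T y \<inter> U)" "0 < card (non_nbrs E T z \<inter> U)"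
      using pos C3 by auto
    have adj: "E x y" "E x z" "E y z" using S pos3 by (cases "E x y"; cases "E x z"; cases "E y z"; simp)+
    have p1: "card (non_nbrs E T x \<inter> U) = 1" "card (non_nbrs E T y \<inter> U) = 1" "card (non_nbrs E T z \<inter> U) = 1"
      using S pos3 by linarith+
    have only: "non_nbrs E T c \<inter> U = {u}" if "c \<in> C" for c
    proof -
      have "card (non_nbrs E T c \<inter> U) = 1" using that p1 C3(1) by auto
      then obtain w where "non_nbrs E T c \<inter> U = {w}" by (rule card_1_singletonE)
      then show ?thesis using leaf[OF that] by simp
    qed
    have uc: "u \<noteq> x" "u \<noteq> y" "u \<noteq> z" using uU C_U_facts(5) C3 by auto
    have missE: "p = u \<and> q \<in> C \<or> q = u \<and> p \<in> C" if h: "p \<in> T" "q \<in> T" "p \<noteq> q" "\<not> E p q" for p q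
    proof -
      have qp: "q \<in> non_nbrs E T p" "p \<in> non_nbrs E T q" using h sym by (auto simp: non_nbrs_def)
      consider "p \<in> U" "q \<in> C" | "p \<in> C" "q \<in> U" | "p \<in> C" "q \<in> C"
        using h C_U_facts(6) non_nbrs_open[of p] qp by blast
      then show ?thesis
      proof cases
        case 1
        then show ?thesis using only[of q] qp by blast
      next
        case 2
        then show ?thesis using only[of p] qp by blast
      next
        case 3
        then show ?thesis using h C3(1) adj sym[of x y] sym[of x z] sym[of y z] by auto
      qed
    qed
    \<comment> \<open>The missing pairs form a star with three leaves and centre \<open>u\<close>; one switch turns it into a path.\<close>
    obtain a where a: "E u a" "a \<in> L"
    proof -
      have "nbrs E u \<inter> L \<noteq> {}" using o by (auto simp: out_def)
      then show ?thesis using that unfolding nbrs_def by blast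
    qed
    have ya: "\<not> E y a"
    proof
      assume "E y a"
      then have "a \<in> nbrs E y \<inter> L" using a by simp
      then have "0 < out y" unfolding out_def using fin by (auto simp: card_gt_0_iff)
      then show False using closedD[of y] C3 by simp
    qed
    have xT: "x \<in> T" "y \<in> T" "z \<in> T" using C3 C_U_facts by auto
    have xu: "\<not> E x u" using leaf[of x] C3 by (auto simp: non_nbrs_def)
    have "y \<noteq> a" using a xT L_neq_T by metis
    define F where "F = add_edge x u (add_edge y a (del_edge x y (del_edge u a E)))"
    have gF: "graph_on V F" "\<And>v. degree F v = degree E v"
      unfolding F_def by (rule switch_edges[OF g adj(1) a(1) xu ya uc(1)[symmetric] \<open>y \<noteq> a\<close>])+
    have missF: "missing F T \<subseteq> {(x, y), (y, x), (y, u), (u, y), (z, u), (u, z)}"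
    proof
      fix e assume "e \<in> missing F T"
      then obtain p q where e: "e = (p, q)" "p \<in> T" "q \<in> T" "p \<noteq> q" "\<not> F p q" by (auto simp: missing_def)
      have ap: "a \<noteq> p" "a \<noteq> q" using e a L_neq_T by metis+
      have ne: "\<not> (p = x \<and> q = u)" "\<not> (p = u \<and> q = x)" using e(5) unfolding F_def add_edge_def by blast+
      have "\<not> E p q \<or> p = x \<and> q = y \<or> p = y \<and> q = x" using e(5) ap unfolding F_def add_edge_def del_edge_def by blast
      then show "e \<in> {(x, y), (y, x), (y, u), (u, y), (z, u), (u, z)}"
        using missE[OF e(2-4)] ne e(1) C3(1) by blast
    qed
    have "card (missing F T) \<le> card {(x, y), (y, x), (y, u), (u, y), (z, u), (u, z)}"
      by (rule card_mono[OF _ missF]) simp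
    also have "\<dots> \<le> 6"
      using card_length[of "[(x, y), (y, x), (y, u), (u, y), (z, u), (u, z)]"] by (simp only: list.set list.size)
    finally have "card (missing F T) \<le> 6" .
    moreover have "card (non_nbrs F T p) \<le> 2" if "p \<in> T" for p
    proof -
      let ?X = "if p = x then {y} else if p = y then {x, u} else if p = u then {y, z} else {u}"
      have "q \<in> ?X" if q: "q \<in> non_nbrs F T p" for q
      proof -
        have "(p, q) \<in> missing F T" using q \<open>p \<in> T\<close> by (auto simp: non_nbrs_def missing_def)
        then have "(p, q) \<in> {(x, y), (y, x), (y, u), (u, y), (z, u), (u, z)}" using missF by blast
        then show ?thesis using C3(2-4) uc by auto
      qed
      then have "card (non_nbrs F T p) \<le> card ?X" by (intro card_mono subsetI) auto
      also have "\<dots> \<le> 2" by (simp add: card_insert_if)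
      finally show ?thesis .
    qed
    ultimately show ?thesis using gF by blast
  qed
qed

end

section \<open>From missing pairs to a copy of the graph\<close>

lemma removed_edges_iff:
  "{i, j} \<in> removed_edges \<longleftrightarrow> i = 0 \<and> j = 1 \<or> i = 1 \<and> j = 0 \<or> i = 1 \<and> j = 2 \<or> i = 2 \<and> j = 1 \<or>
     i = 0 \<and> j = 2 \<or> i = 2 \<and> j = 0 \<or> i = 3 \<and> j = 4 \<or> i = 4 \<and> j = 3 \<or>
     i = 4 \<and> j = 5 \<or> i = 5 \<and> j = 4 \<or> i = 5 \<and> j = 6 \<or> i = 6 \<and> j = 5"
  by (simp only: removed_edges_def insert_iff empty_iff doubleton_eq_iff disj_assoc simp_thms)

text \<open>\<open>xs\<close> supplies the vertices for the roles 0 to 6; the others follow in any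
  order, since no removed edge meets an index above 6.\<close>

lemma copy_of_list:
  assumes T: "finite T" "card T = r + 1" and xs: "length xs = 7" "distinct xs" "set xs \<subseteq> T"
    and pairs: "\<And>x y. x \<in> T \<Longrightarrow> y \<in> T \<Longrightarrow> x \<noteq> y \<Longrightarrow> \<not> E x y \<Longrightarrow>
      \<exists>a b. a < 7 \<and> b < 7 \<and> {a, b} \<in> removed_edges \<and> x = xs ! a \<and> y = xs ! b"
  shows "contains_subgraph E (r + 1) (K_minus_K3_P3 r)"
proof -
  obtain ws where ws: "set ws = T - set xs" "distinct ws" using T finite_distinct_list[of "T - set xs"] by auto
  define ys where "ys = xs @ ws"
  have dy: "distinct ys" "set ys = T" using ws xs by (auto simp: ys_def)
  then have ly: "length ys = r + 1" using T distinct_card[of ys] by simp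
  have ysx: "ys ! a = xs ! a" if "a < 7" for a using that xs by (simp add: ys_def nth_append)
  have r6: "7 \<le> r + 1" using ly xs by (simp add: ys_def)
  show ?thesis unfolding contains_subgraph_def
  proof (intro exI[of _ "\<lambda>i. ys ! i"] conjI allI impI)
    show "inj_on ((!) ys) {..<r + 1}" using dy ly by (auto intro!: inj_on_nth)
    fix i j assume ij: "i < r + 1" "j < r + 1" "K_minus_K3_P3 r i j"
    then have ne: "i \<noteq> j" "{i, j} \<notin> removed_edges" by (auto simp: K_minus_K3_P3_def)
    show "E (ys ! i) (ys ! j)"
    proof (rule ccontr)
      assume "\<not> E (ys ! i) (ys ! j)"
      moreover have "ys ! i \<in> T" "ys ! j \<in> T" using ij ly dy(2) nth_mem by metis+
      moreover have "ys ! i \<noteq> ys ! j" using ne ij ly dy by (simp add: nth_eq_iff_index_eq)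
      ultimately obtain a b where ab: "a < 7" "b < 7" "{a, b} \<in> removed_edges" "ys ! i = xs ! a" "ys ! j = xs ! b"
        using pairs by blast
      then have "ys ! i = ys ! a" "ys ! j = ys ! b" using ysx by simp_all
      then have "i = a" "j = b" using ij ly dy ab r6 by (simp_all add: nth_eq_iff_index_eq)
      then show False using ab ne by simp
    qed
  qed
qed

lemma copy_of_triangle_and_path:
  assumes T: "finite T" "card T = r + 1" "6 \<le> r"
    and d: "distinct (xs @ ys)" "length xs \<le> 3" "length ys \<le> 4" "set xs \<union> set ys \<subseteq> T"
    and pairs: "\<And>x y. x \<in> T \<Longrightarrow> y \<in> T \<Longrightarrow> x \<noteq> y \<Longrightarrow> \<not> E x y \<Longrightarrow> x \<in> set xs \<and> y \<in> set xs \<or>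
      (\<exists>i. Suc i < length ys \<and> (x = ys ! i \<and> y = ys ! Suc i \<or> y = ys ! i \<and> x = ys ! Suc i))"
  shows "contains_subgraph E (r + 1) (K_minus_K3_P3 r)"
proof -
  obtain ws where ws: "set ws = T - set xs - set ys" "distinct ws"
    using T finite_distinct_list[of "T - set xs - set ys"] by auto
  have "length ws = card (T - set (xs @ ys))" using distinct_card[OF ws(2)] ws(1) by (simp add: Diff_Un Diff_Int2 set_diff_eq)
  also have "\<dots> = card T - card (set (xs @ ys))" using d by (intro card_Diff_subset) auto
  also have "\<dots> = r + 1 - (length xs + length ys)" using d T distinct_card[OF d(1)] by simp
  finally have lw: "length ws = r + 1 - (length xs + length ys)" .
  define p where "p = 3 - length xs"
  \<comment> \<open>Positions 0 to 2 carry the triangle and 3 to 6 the path. Padding comes after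
    each list, so \<open>ys ! i\<close> lands at \<open>3 + i\<close>.\<close>
  define zs where "zs = xs @ take p ws @ ys @ take (4 - length ys) (drop p ws)"
  have pw: "length xs + p = 3" "p + (4 - length ys) \<le> length ws" using d(2,3) lw T(3) unfolding p_def by linarith+
  have lz: "length (xs @ take p ws) = 3" using pw by simp
  have z7: "length zs = 7" using pw d(3) by (simp add: zs_def)
  have "set (take p ws) \<inter> set (take (4 - length ys) (drop p ws)) = {}"
    using set_take_disj_set_drop_if_distinct[OF ws(2), of p p] set_take_subset[of "4 - length ys" "drop p ws"] by auto
  moreover have "set (take p ws) \<subseteq> set ws" "set (take (4 - length ys) (drop p ws)) \<subseteq> set ws"
    by (auto dest: in_set_takeD in_set_dropD)
  ultimately have dz: "distinct zs" and sz: "set zs \<subseteq> T"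
    using ws d unfolding zs_def by auto
  have zx: "zs ! i = xs ! i" if "i < length xs" for i using that by (simp add: zs_def nth_append)
  have zy: "zs ! (3 + i) = ys ! i" if "i < length ys" for i
  proof -
    have "zs = (xs @ take p ws) @ (ys @ take (4 - length ys) (drop p ws))" by (simp add: zs_def)
    then have "zs ! (3 + i) = (ys @ take (4 - length ys) (drop p ws)) ! i" using lz by (metis nth_append_length_plus)
    then show ?thesis using that by (simp add: nth_append)
  qed
  show ?thesis
  proof (rule copy_of_list[OF T(1,2) z7 dz sz])
    fix x y assume h: "x \<in> T" "y \<in> T" "x \<noteq> y" "\<not> E x y"
    from pairs[OF h] show "\<exists>a b. a < 7 \<and> b < 7 \<and> {a, b} \<in> removed_edges \<and> x = zs ! a \<and> y = zs ! b"
    proof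
      assume "x \<in> set xs \<and> y \<in> set xs"
      then obtain i j where ij: "i < length xs" "j < length xs" "x = xs ! i" "y = xs ! j" by (metis in_set_conv_nth)
      then have "i \<noteq> j" "i < 3" "j < 3" using h d by auto
      then have "i = 0 \<or> i = 1 \<or> i = 2" "j = 0 \<or> j = 1 \<or> j = 2" by linarith+
      then have "{i, j} \<in> removed_edges" using \<open>i \<noteq> j\<close> unfolding removed_edges_iff by (elim disjE) simp_all
      then show ?thesis using ij zx \<open>i < 3\<close> \<open>j < 3\<close> by (intro exI[of _ i] exI[of _ j]) auto
    next
      assume "\<exists>i. Suc i < length ys \<and> (x = ys ! i \<and> y = ys ! Suc i \<or> y = ys ! i \<and> x = ys ! Suc i)"
      then obtain i where i: "Suc i < length ys" "x = ys ! i \<and> y = ys ! Suc i \<or> y = ys ! i \<and> x = ys ! Suc i" by blast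
      have "i = 0 \<or> i = 1 \<or> i = 2" using i(1) d(3) by linarith
      then have e: "{3 + i, 3 + Suc i} \<in> removed_edges" unfolding removed_edges_iff by (elim disjE) simp_all
      have l: "3 + i < 7" "3 + Suc i < 7" using i(1) d(3) by auto
      have z: "zs ! (3 + i) = ys ! i" "zs ! (3 + Suc i) = ys ! Suc i" using zy[of i] zy[OF i(1)] i(1) Suc_lessD by blast+
      show ?thesis
      proof (cases "x = ys ! i \<and> y = ys ! Suc i")
        case True
        then show ?thesis using e l z by (intro exI[of _ "3 + i"] exI[of _ "3 + Suc i"]) auto
      next
        case False
        then show ?thesis using e l z i by (intro exI[of _ "3 + Suc i"] exI[of _ "3 + i"]) (auto simp: insert_commute)
      qed
    qed
  qed
qed

lemma pair_eq_of_card_le_2: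
  assumes "finite D" "card D \<le> 2" "(e, f) \<in> D" "(f, e) \<in> D" "e \<noteq> f"
  shows "D = {(e, f), (f, e)}"
proof -
  have "card {(e, f), (f, e)} = 2" using assms(5) by simp
  moreover have "{(e, f), (f, e)} \<subseteq> D" using assms(3,4) by blast
  ultimately show ?thesis using card_seteq[OF assms(1)] assms(2) by metis
qed

text \<open>At most three missing edges, at most two at any vertex. Two edges sharing a vertex go
  into the triangle, or into the path if the third edge extends them to a path. A matching puts one
  edge into the triangle and two at the ends of the path.\<close>

lemma copy_if_few_missing:
  assumes g: "graph_on V E" and T: "finite T" "card T = r + 1" "6 \<le> r"
    and few: "card (missing E T) \<le> 6" "\<And>x. x \<in> T \<Longrightarrow> card (non_nbrs E T x) \<le> 2"
  shows "contains_subgraph E (r + 1) (K_minus_K3_P3 r)"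
proof -
  let ?D = "missing E T"
  note sym = graph_on_sym[OF g]
  have fD: "finite ?D" using finite_missing T by blast
  have Dsym: "(y, x) \<in> ?D" if "(x, y) \<in> ?D" for x y using that sym by (auto simp: missing_def)
  have Dne: "x \<noteq> y" "x \<in> T" "y \<in> T" "y \<in> non_nbrs E T x" if "(x, y) \<in> ?D" for x y
    using that by (auto simp: missing_def non_nbrs_def)
  have Dn: "(x, y) \<in> ?D \<longleftrightarrow> y \<in> non_nbrs E T x" if "x \<in> T" for x y using that by (auto simp: missing_def non_nbrs_def)
  have Din: "(x, y) \<in> ?D" if "x \<in> T" "y \<in> T" "x \<noteq> y" "\<not> E x y" for x y using that by (simp add: missing_def)
  note copy = copy_of_triangle_and_path[OF T]
  show ?thesis
  proof (cases "\<exists>b\<in>T. 2 \<le> card (non_nbrs E T b)")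
    case True
    then obtain b where b: "b \<in> T" "card (non_nbrs E T b) = 2" using few(2) by (metis le_antisym)
    then obtain a c where ac: "non_nbrs E T b = {a, c}" "a \<noteq> c" by (auto simp: card_2_iff)
    have ab: "(b, a) \<in> ?D" "(b, c) \<in> ?D" using ac Dn b by auto
    note D4 = ab Dsym[OF ab(1)] Dsym[OF ab(2)]
    have ne: "a \<noteq> b" "b \<noteq> c" "a \<in> T" "c \<in> T" using Dne[OF ab(1)] Dne[OF ab(2)] by auto
    define D' where "D' = ?D - {(b, a), (b, c), (a, b), (c, b)}"
    have "card D' = card ?D - card {(b, a), (b, c), (a, b), (c, b)}"
      unfolding D'_def by (rule card_Diff_subset) (use D4 in auto)
    moreover have "card {(b, a), (b, c), (a, b), (c, b)} = 4" using ne ac by auto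
    ultimately have c2: "card D' \<le> 2" using few(1) by simp
    have fD': "finite D'" using fD by (simp add: D'_def)
    show ?thesis
    proof (cases "D' = {}")
      case True
      then have D: "?D \<subseteq> {(b, a), (b, c), (a, b), (c, b)}" by (auto simp: D'_def)
      show ?thesis
      proof (rule copy[of "[a, b, c]" "[]"])
        fix x y assume "x \<in> T" "y \<in> T" "x \<noteq> y" "\<not> E x y"
        then have "(x, y) \<in> {(b, a), (b, c), (a, b), (c, b)}" using D Din by blast
        then show "x \<in> set [a, b, c] \<and> y \<in> set [a, b, c] \<or>
          (\<exists>i. Suc i < length [] \<and> (x = [] ! i \<and> y = [] ! Suc i \<or> y = [] ! i \<and> x = [] ! Suc i))" by auto
      qed (use ne ac b in auto)
    next
      case False
      then obtain e f where ef: "(e, f) \<in> D'" by auto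
      then have efD: "(e, f) \<in> ?D" "(f, e) \<in> ?D" using Dsym by (auto simp: D'_def)
      have fe: "(f, e) \<in> D'" using ef efD by (auto simp: D'_def)
      have "e \<noteq> f" using Dne[OF efD(1)] by simp
      have De: "D' = {(e, f), (f, e)}" by (rule pair_eq_of_card_le_2[OF fD' c2 ef fe \<open>e \<noteq> f\<close>])
      then have D: "?D \<subseteq> {(b, a), (b, c), (a, b), (c, b), (e, f), (f, e)}" unfolding D'_def by blast
      have eT: "e \<in> T" "f \<in> T" using Dne[OF efD(1)] by auto
      have eb: "e \<noteq> b" "f \<noteq> b"
      proof -
        have "(b, z) \<notin> D'" for z using ac Dn[OF b(1), of z] by (auto simp: D'_def)
        then show "e \<noteq> b" "f \<noteq> b" using ef fe by auto
      qed
      \<comment> \<open>The third missing edge hangs at \<open>e'\<close>, one end of the path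
        \<open>a b c\<close>; with \<open>c'\<close> as the other end, \<open>f' e' b c'\<close> is
        a path with three edges.\<close>
      have path: ?thesis if h: "e' \<in> {a, c}" "f' \<notin> {a, c}" "{e', f'} = {e, f}" for e' f'
      proof -
        define c' where "c' = (if e' = a then c else a)"
        have c': "{e', c'} = {a, c}" "c' \<noteq> e'" using h ac by (auto simp: c'_def)
        have f': "f' \<noteq> b" "e' \<noteq> b" "f' \<in> T" using h eb eT by (auto simp: doubleton_eq_iff)
        show ?thesis
        proof (rule copy[of "[]" "[f', e', b, c']"])
          fix x y assume "x \<in> T" "y \<in> T" "x \<noteq> y" "\<not> E x y"
          then have "(x, y) \<in> {(b, a), (b, c), (a, b), (c, b), (e, f), (f, e)}" using D Din by blast
          then have "{x, y} = {b, a} \<or> {x, y} = {b, c} \<or> {x, y} = {e, f}" by auto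
          then have "{x, y} = {b, e'} \<or> {x, y} = {b, c'} \<or> {x, y} = {f', e'}"
            using c'(1) h(3) by (auto simp: doubleton_eq_iff)
          then have "\<exists>i\<in>{0, 1, 2}. {x, y} = {[f', e', b, c'] ! i, [f', e', b, c'] ! Suc i}"
            by (auto simp: insert_commute)
          then obtain i where "i \<in> {0, 1, 2}" "{x, y} = {[f', e', b, c'] ! i, [f', e', b, c'] ! Suc i}" by blast
          then have "Suc i < length [f', e', b, c'] \<and> (x = [f', e', b, c'] ! i \<and> y = [f', e', b, c'] ! Suc i \<or> y = [f', e', b, c'] ! i \<and> x = [f', e', b, c'] ! Suc i)"
            unfolding doubleton_eq_iff by auto
          then show "x \<in> set [] \<and> y \<in> set [] \<or> (\<exists>i. Suc i < length [f', e', b, c'] \<and>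
            (x = [f', e', b, c'] ! i \<and> y = [f', e', b, c'] ! Suc i \<or> y = [f', e', b, c'] ! i \<and> x = [f', e', b, c'] ! Suc i))" by blast
        qed (use c' f' h ne b ac in \<open>auto simp: c'_def\<close>)
      qed
      consider "e \<in> {a, c}" "f \<in> {a, c}" | "e \<in> {a, c}" "f \<notin> {a, c}" | "e \<notin> {a, c}" "f \<in> {a, c}" | "e \<notin> {a, c}" "f \<notin> {a, c}" by blast
      then show ?thesis
      proof cases
        case 1
        show ?thesis
        proof (rule copy[of "[a, b, c]" "[]"])
          fix x y assume "x \<in> T" "y \<in> T" "x \<noteq> y" "\<not> E x y"
          then have "(x, y) \<in> {(b, a), (b, c), (a, b), (c, b), (e, f), (f, e)}" using D Din by blast
          then show "x \<in> set [a, b, c] \<and> y \<in> set [a, b, c] \<or>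
            (\<exists>i. Suc i < length [] \<and> (x = [] ! i \<and> y = [] ! Suc i \<or> y = [] ! i \<and> x = [] ! Suc i))" using 1 by auto
        qed (use ne ac b in auto)
      next
        case 2
        then show ?thesis using path[of e f] by blast
      next
        case 3
        then show ?thesis using path[of f e] by blast
      next
        case 4
        show ?thesis
        proof (rule copy[of "[a, b, c]" "[e, f]"])
          fix x y assume "x \<in> T" "y \<in> T" "x \<noteq> y" "\<not> E x y"
          then have "(x, y) \<in> {(b, a), (b, c), (a, b), (c, b), (e, f), (f, e)}" using D Din by blast
          then show "x \<in> set [a, b, c] \<and> y \<in> set [a, b, c] \<or>
            (\<exists>i. Suc i < length [e, f] \<and> (x = [e, f] ! i \<and> y = [e, f] ! Suc i \<or> y = [e, f] ! i \<and> x = [e, f] ! Suc i))" by auto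
        qed (use ne ac b 4 eb eT \<open>e \<noteq> f\<close> in auto)
      qed
    qed
  next
    case False
    have uniq: "y = z" if "(x, y) \<in> ?D" "(x, z) \<in> ?D" for x y z
    proof (rule ccontr)
      assume "y \<noteq> z"
      have "{y, z} \<subseteq> non_nbrs E T x" using Dne(4) that by blast
      then have "card {y, z} \<le> card (non_nbrs E T x)" using T by (intro card_mono) (auto simp: non_nbrs_def)
      then show False using False Dne(2)[OF that(1)] \<open>y \<noteq> z\<close> by auto
    qed
    show ?thesis
    proof (cases "?D = {}")
      case True
      show ?thesis by (rule copy[of "[]" "[]"]) (use True Din in auto)
    next
      case False
      then obtain a b where ab: "(a, b) \<in> ?D" by auto
      note ab2 = Dsym[OF ab] Dne[OF ab]
      define D1 where "D1 = ?D - {(a, b), (b, a)}"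
      have "card D1 = card ?D - card {(a, b), (b, a)}"
        unfolding D1_def by (rule card_Diff_subset) (use ab ab2 in auto)
      then have c1: "card D1 \<le> 4" using few(1) ab2 by simp
      show ?thesis
      proof (cases "D1 = {}")
        case True
        show ?thesis
        proof (rule copy[of "[a, b]" "[]"])
          fix x y assume "x \<in> T" "y \<in> T" "x \<noteq> y" "\<not> E x y"
          then have "(x, y) \<in> {(a, b), (b, a)}" using True Din unfolding D1_def by blast
          then show "x \<in> set [a, b] \<and> y \<in> set [a, b] \<or>
            (\<exists>i. Suc i < length [] \<and> (x = [] ! i \<and> y = [] ! Suc i \<or> y = [] ! i \<and> x = [] ! Suc i))" by auto
        qed (use ab2 in auto)
      next
        case False
        then obtain c d where cd: "(c, d) \<in> D1" by auto
        then have cdD: "(c, d) \<in> ?D" by (simp add: D1_def)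
        note cd2 = Dsym[OF cdD] Dne[OF cdD]
        have dis: "c \<noteq> a" "c \<noteq> b" "d \<noteq> a" "d \<noteq> b"
          using cd uniq ab ab2(1) cdD cd2(1) unfolding D1_def by blast+
        define D2 where "D2 = D1 - {(c, d), (d, c)}"
        have "card D2 = card D1 - card {(c, d), (d, c)}"
          unfolding D2_def by (rule card_Diff_subset) (use cd cd2 dis in \<open>auto simp: D1_def\<close>)
        then have c2: "card D2 \<le> 2" using c1 cd2 by simp
        have fD2: "finite D2" using fD by (simp add: D1_def D2_def)
        show ?thesis
        proof (cases "D2 = {}")
          case True
          show ?thesis
          proof (rule copy[of "[a, b]" "[c, d]"])
            fix x y assume "x \<in> T" "y \<in> T" "x \<noteq> y" "\<not> E x y"
            then have "(x, y) \<in> {(a, b), (b, a), (c, d), (d, c)}" using True Din unfolding D1_def D2_def by blast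
            then show "x \<in> set [a, b] \<and> y \<in> set [a, b] \<or>
              (\<exists>i. Suc i < length [c, d] \<and> (x = [c, d] ! i \<and> y = [c, d] ! Suc i \<or> y = [c, d] ! i \<and> x = [c, d] ! Suc i))" by auto
          qed (use ab2 cd2 dis in auto)
        next
          case False
          then obtain e f where ef: "(e, f) \<in> D2" by auto
          then have efD: "(e, f) \<in> ?D" by (simp add: D1_def D2_def)
          note ef2 = Dsym[OF efD] Dne[OF efD]
          have dis2: "e \<noteq> a" "e \<noteq> b" "f \<noteq> a" "f \<noteq> b" "e \<noteq> c" "e \<noteq> d" "f \<noteq> c" "f \<noteq> d"
            using ef uniq ab ab2(1) cdD cd2(1) efD ef2(1) unfolding D1_def D2_def by blast+
          have fe: "(f, e) \<in> D2" using ef2 dis2 by (auto simp: D1_def D2_def)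
          have D2e: "D2 = {(e, f), (f, e)}" by (rule pair_eq_of_card_le_2[OF fD2 c2 ef fe ef2(2)])
          have "?D \<subseteq> {(a, b), (b, a)} \<union> ({(c, d), (d, c)} \<union> D2)" unfolding D2_def D1_def by blast
          then have D: "?D \<subseteq> {(a, b), (b, a)} \<union> ({(c, d), (d, c)} \<union> {(e, f), (f, e)})" unfolding D2e .
          show ?thesis
          proof (rule copy[of "[a, b]" "[c, d, e, f]"])
            fix x y assume "x \<in> T" "y \<in> T" "x \<noteq> y" "\<not> E x y"
            then have "(x, y) \<in> {(a, b), (b, a)} \<union> ({(c, d), (d, c)} \<union> {(e, f), (f, e)})" using D Din by (metis subsetD)
            then have "x \<in> {a, b} \<and> y \<in> {a, b} \<or> (\<exists>i\<in>{0, 2}. x = [c, d, e, f] ! i \<and> y = [c, d, e, f] ! Suc i \<or> y = [c, d, e, f] ! i \<and> x = [c, d, e, f] ! Suc i)"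
              by auto
            then show "x \<in> set [a, b] \<and> y \<in> set [a, b] \<or>
              (\<exists>i. Suc i < length [c, d, e, f] \<and> (x = [c, d, e, f] ! i \<and> y = [c, d, e, f] ! Suc i \<or> y = [c, d, e, f] ! i \<and> x = [c, d, e, f] ! Suc i))"
              by fastforce
          qed (use ab2 cd2 ef2 dis dis2 in auto)
        qed
      qed
    qed
  qed
qed

section \<open>Assembling the upper bound\<close>

lemma many_large_degrees:
  assumes g: "graph_on V E" and r: "6 \<le> r" and n: "5 * r + 18 \<le> card V"
    and sum: "(2 * int r - 5) * int (card V) - int r * int r + 4 * int r - 1 \<le> int (\<Sum>x\<in>V. degree E x)"
  shows "r + 1 \<le> card {x \<in> V. r - 2 \<le> degree E x}"
proof (rule ccontr)
  assume "\<not> ?thesis"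
  then have le: "card {x \<in> V. r - 2 \<le> degree E x} \<le> r" by simp
  have finV: "finite V" using graph_on_finite[OF g] .
  \<comment> \<open>Outside these \<open>r\<close> vertices all degrees are at most
    \<open>r - 3\<close>. The degree sum is then at most
    \<open>r * (r - 1) + 2 * (card V - r) * (r - 3)\<close>, which misses the threshold by
    \<open>card V - r - 1\<close>.\<close>
  obtain T where T: "{x \<in> V. r - 2 \<le> degree E x} \<subseteq> T" "T \<subseteq> V" "card T = r"
    using exists_subset_between[OF le _ _ finV] n by auto
  have finT: "finite T" using T finV finite_subset by blast
  define L where "L = V - T"
  have finL: "finite L" using finV by (simp add: L_def)
  have cL: "card L = card V - r" using T finT by (simp add: L_def card_Diff_subset)
  have "(\<Sum>x\<in>T. degree E x) \<le> (\<Sum>x\<in>T. (r - 1) + card (nbrs E x \<inter> L))"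
  proof (rule sum_mono)
    fix x assume x: "x \<in> T"
    have "nbrs E x = (nbrs E x \<inter> T) \<union> (nbrs E x \<inter> L)" using nbrs_subset[OF g, of x] by (auto simp: L_def)
    then have "degree E x \<le> card (nbrs E x \<inter> T) + card (nbrs E x \<inter> L)" unfolding degree_def by (metis card_Un_le)
    moreover have "nbrs E x \<inter> T \<subseteq> T - {x}" using nbrs_subset[OF g, of x] by auto
    then have "card (nbrs E x \<inter> T) \<le> card (T - {x})" using finT by (intro card_mono) auto
    ultimately show "degree E x \<le> (r - 1) + card (nbrs E x \<inter> L)" using x finT T by simp
  qed
  also have "\<dots> = r * (r - 1) + (\<Sum>x\<in>L. card (nbrs E x \<inter> T))"
    using card_nbr_count[OF finT finL] graph_on_sym[OF g] T by (simp add: sum.distrib)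
  finally have 1: "(\<Sum>x\<in>T. degree E x) \<le> r * (r - 1) + (\<Sum>x\<in>L. card (nbrs E x \<inter> T))" .
  have 2: "(\<Sum>x\<in>L. card (nbrs E x \<inter> T)) \<le> (\<Sum>x\<in>L. degree E x)"
    unfolding degree_def using finite_nbrs[OF g] by (intro sum_mono card_mono) auto
  have 3: "(\<Sum>x\<in>L. degree E x) \<le> of_nat (card L) * (r - 3)"
    by (rule sum_bounded_above) (use T(1) in \<open>auto simp: L_def\<close>)
  have 4: "(\<Sum>x\<in>V. degree E x) = (\<Sum>x\<in>T. degree E x) + (\<Sum>x\<in>L. degree E x)"
    unfolding L_def using finV T by (metis add.commute sum.subset_diff)
  have "(\<Sum>x\<in>V. degree E x) \<le> r * (r - 1) + 2 * ((card V - r) * (r - 3))"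
    using 1 2 3 4 cL by simp
  then have "int (\<Sum>x\<in>V. degree E x) \<le> int (r * (r - 1) + 2 * ((card V - r) * (r - 3)))" by (rule of_nat_mono)
  also have "\<dots> = int r * (int r - 1) + 2 * ((int (card V) - int r) * (int r - 3))"
    using r n by (simp add: of_nat_diff)
  finally show False using sum n by (simp add: algebra_simps)
qed

theorem potentially_copy:
  fixes V :: "nat set"
  assumes g: "graph_on V E" and r: "6 \<le> r" and n: "5 * r + 18 \<le> card V"
    and sum: "(2 * int r - 5) * int (card V) - int r * int r + 4 * int r - 1 \<le> int (\<Sum>x\<in>V. degree E x)"
  shows "\<exists>F. graph_on V F \<and> (\<forall>x. degree F x = degree E x) \<and> contains_subgraph F (r + 1) (K_minus_K3_P3 r)"
proof -
  have finV: "finite V" using graph_on_finite[OF g] .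
  let ?W = "\<lambda>k. {x \<in> V. k \<le> degree E x}"
  show ?thesis
  proof (cases "r + 1 \<le> card (?W r)")
    case True
    have "3 \<le> r" "r + 42 \<le> card V" using r n by auto
    then obtain F S A where F: "graph_on V F" "\<forall>x. degree F x = degree E x" and S: "S \<subseteq> V" "card S = r + 1" "almost_clique F S A"
      using potentially_almost_clique[OF _ g _ n sum True] by blast
    have finS: "finite S" using S finV finite_subset by blast
    then have "finite A" using S(3) finite_subset unfolding almost_clique_def by blast
    then obtain xs where xs: "set xs = A" "distinct xs" using finite_distinct_list by blast
    have "contains_subgraph F (r + 1) (K_minus_K3_P3 r)"
    proof (rule copy_of_triangle_and_path[OF finS S(2) r, of xs "[]"])
      show "length xs \<le> 3" using S(3) xs distinct_card[OF xs(2)] unfolding almost_clique_def by simp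
      show "set xs \<union> set [] \<subseteq> S" using S(3) xs unfolding almost_clique_def by simp
      fix x y assume "x \<in> S" "y \<in> S" "x \<noteq> y" "\<not> F x y"
      then have "x \<in> A \<and> y \<in> A" using S(3) unfolding almost_clique_def by blast
      then show "x \<in> set xs \<and> y \<in> set xs \<or> (\<exists>i. Suc i < length [] \<and> (x = [] ! i \<and> y = [] ! Suc i \<or> y = [] ! i \<and> x = [] ! Suc i))"
        using xs by simp
    qed (use xs in auto)
    then show ?thesis using F by blast
  next
    case False
    \<comment> \<open>\<open>m\<close> is the largest degree reached by \<open>r + 1\<close>
      vertices, by \<open>many_large_degrees\<close> either \<open>r - 1\<close> or
      \<open>r - 2\<close>; ties at degree \<open>m\<close> are broken arbitrarily.\<close>
    obtain m T where m: "m + 1 = r \<or> m + 2 = r" and T: "?W (m + 1) \<subseteq> T" "T \<subseteq> ?W m" "card T = r + 1"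
    proof (cases "r + 1 \<le> card (?W (r - 1))")
      case True
      have "?W r \<subseteq> ?W (r - 1)" by auto
      then obtain T where "?W r \<subseteq> T" "T \<subseteq> ?W (r - 1)" "card T = r + 1"
        using exists_subset_between[of "?W r" "r + 1" "?W (r - 1)"] False True finV by auto
      then show ?thesis using that[of "r - 1" T] r by auto
    next
      case inner_lower: False
      have "?W (r - 1) \<subseteq> ?W (r - 2)" by auto
      then obtain T where T: "?W (r - 1) \<subseteq> T" "T \<subseteq> ?W (r - 2)" "card T = r + 1"
        using exists_subset_between[of "?W (r - 1)" "r + 1" "?W (r - 2)"] inner_lower many_large_degrees[OF g r n sum] finV by auto
      have "r - 2 + 1 = r - 1" using r by simp
      then show ?thesis using that[of "r - 2" T] T r by auto
    qed
    let ?P = "\<lambda>F. graph_on V F \<and> (\<forall>x. degree F x = degree E x)"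
    obtain E1 where E1: "?P E1" and mn: "\<And>F. ?P F \<Longrightarrow> card (missing E1 T) \<le> card (missing F T)"
      using ex_has_least_nat[of ?P E "\<lambda>F. card (missing F T)"] g by blast
    have d1: "degree E1 x = degree E x" for x using E1 by blast
    interpret top_split V E1 T r m
    proof
      show "graph_on V E1" using E1 by blast
      show "T \<subseteq> V" using T by auto
      show "degree E1 x \<le> m" if "x \<in> V - T" for x using that T(1) d1 by force
      show "m \<le> degree E1 x" if "x \<in> T" for x using that T(2) d1 by auto
      show "(2 * int r - 5) * int (card V) - int r * int r + 4 * int r - 1 \<le> int (\<Sum>x\<in>V. degree E1 x)" using sum d1 by simp
      show "card (missing E1 T) \<le> card (missing F T)" if "graph_on V F" "\<And>x. degree F x = degree E1 x" for F
        using mn that d1 by simp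
    qed (use T r n m in auto)
    obtain F where F: "graph_on V F" "\<forall>x. degree F x = degree E1 x" "card (missing F T) \<le> 6" "\<forall>x\<in>T. card (non_nbrs F T x) \<le> 2"
      using few_missing by blast
    have "finite T" using T(3) card.infinite by fastforce
    then have "contains_subgraph F (r + 1) (K_minus_K3_P3 r)"
      by (rule copy_if_few_missing[OF F(1) _ T(3) r F(3)]) (use F(4) in blast)
    moreover have "\<forall>x. degree F x = degree E x" using F(2) d1 by simp
    ultimately show ?thesis using F(1) by blast
  qed
qed

section \<open>The extremal sequence\<close>

definition removed_nbrs :: "nat \<Rightarrow> nat set" where
  "removed_nbrs i = {j. {i, j} \<in> removed_edges}"

lemma removed_nbrs_simps:
  "removed_nbrs 0 = {1, 2}" "removed_nbrs 1 = {0, 2}" "removed_nbrs 2 = {0, 1}" "removed_nbrs 3 = {4}"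
  "removed_nbrs 4 = {3, 5}" "removed_nbrs 5 = {4, 6}" "removed_nbrs 6 = {5}" "7 \<le> i \<Longrightarrow> removed_nbrs i = {}" "removed_nbrs (Suc 0) = {0, 2}"
  unfolding removed_nbrs_def removed_edges_iff by auto

lemma removed_nbrs_cases:
  obtains "i = 0" | "i = 1" | "i = 2" | "i = 3" | "i = 4" | "i = 5" | "i = 6" | "7 \<le> (i :: nat)"
  by linarith

text \<open>The hypotheses demand degree sum 7, thus four edges on four vertices, where a triangle
  plus a path offers at most three. Using 4 or 5 as a vertex of degree two pulls in both path ends 3
  and 6, only one of which can be \<open>i0\<close>. So the other three form the triangle, which has
  no neighbour outside.\<close>

lemma four_vertices:
  assumes J: "card J = 4" "i0 \<in> J" and two: "\<And>i. i \<in> J \<Longrightarrow> i \<noteq> i0 \<Longrightarrow> 2 \<le> card (removed_nbrs i \<inter> J)"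
    and one: "1 \<le> card (removed_nbrs i0 \<inter> J)"
  shows False
proof -
  have finJ: "finite J" using J card.infinite by fastforce
  have good: "i \<in> {0, 1, 2, 4, 5} \<and> removed_nbrs i \<subseteq> J" if "i \<in> J" "i \<noteq> i0" for i
  proof -
    have "finite (removed_nbrs i) \<and> card (removed_nbrs i) \<le> 2 \<and> (i \<in> {0, 1, 2, 4, 5} \<or> card (removed_nbrs i) \<le> 1)"
      by (cases i rule: removed_nbrs_cases) (simp_all add: removed_nbrs_simps)
    moreover have "card (removed_nbrs i \<inter> J) \<le> card (removed_nbrs i)" using calculation by (intro card_mono) auto
    ultimately have "i \<in> {0, 1, 2, 4, 5}" "removed_nbrs i \<inter> J = removed_nbrs i"
      using two[OF that] card_seteq[of "removed_nbrs i" "removed_nbrs i \<inter> J"] by auto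
    then show ?thesis by blast
  qed
  have no4: "i \<noteq> 4 \<and> i \<noteq> 5" if i: "i \<in> J" "i \<noteq> i0" for i
  proof (rule ccontr)
    assume "\<not> ?thesis"
    then consider "i = 4" | "i = 5" by blast
    then show False
    proof cases
      case 1
      then have "3 \<in> J" "5 \<in> J" using good[OF i] by (auto simp: removed_nbrs_simps)
      moreover have "i0 = 3" using good[of 3] \<open>3 \<in> J\<close> by auto
      ultimately have "6 \<in> J" using good[of 5] by (auto simp: removed_nbrs_simps)
      then show False using good[of 6] \<open>i0 = 3\<close> by auto
    next
      case 2
      then have "4 \<in> J" "6 \<in> J" using good[OF i] by (auto simp: removed_nbrs_simps)
      moreover have "i0 = 6" using good[of 6] \<open>6 \<in> J\<close> by auto
      ultimately have "3 \<in> J" using good[of 4] by (auto simp: removed_nbrs_simps)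
      then show False using good[of 3] \<open>i0 = 6\<close> by auto
    qed
  qed
  have sub: "J - {i0} \<subseteq> {0, 1, 2}" using good no4 by blast
  moreover have c3: "card (J - {i0}) = 3" using J finJ by simp
  ultimately have eq: "J - {i0} = {0, 1, 2}" by (intro card_seteq) auto
  then have i0: "i0 \<notin> {0, 1, 2}" by blast
  then have "removed_nbrs i0 \<inter> {0, 1, 2} = {}"
    by (cases i0 rule: removed_nbrs_cases) (auto simp: removed_nbrs_simps)
  moreover have "i0 \<notin> removed_nbrs i0"
    by (cases i0 rule: removed_nbrs_cases) (auto simp: removed_nbrs_simps)
  ultimately have "removed_nbrs i0 \<inter> J = {}" using eq by blast
  then show False using one by simp
qed

text \<open>A perfect matching for even \<open>N\<close>; for odd \<open>N\<close> the path 1 - 0 - 2 and a matching on the remaining vertices.\<close>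

definition inner_nbrs :: "nat \<Rightarrow> nat \<Rightarrow> nat set" where
  "inner_nbrs N a = (if odd N then (if a = 0 then {1, 2} else if a \<le> 2 then {0} else if odd a then {a + 1} else {a - 1})
     else if even a then {a + 1} else {a - 1})"

lemma inner_nbrs_props:
  assumes "3 \<le> N" "a < N" "b \<in> inner_nbrs N a"
  shows "b < N" "b \<noteq> a" "a \<in> inner_nbrs N b"
proof -
  have "b < N \<and> b \<noteq> a \<and> a \<in> inner_nbrs N b"
  proof (cases "odd N")
    case odd: True
    show ?thesis
    proof (cases "a \<le> 2")
      case True
      then have "a = 0 \<or> a = 1 \<or> a = 2" by linarith
      then show ?thesis using assms odd by (elim disjE) (auto simp: inner_nbrs_def split: if_splits)
    next
      case False
      show ?thesis
      proof (cases "odd a")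
        case True
        then have "b = a + 1" "a + 1 \<noteq> N" using assms odd False by (auto simp: inner_nbrs_def)
        then show ?thesis using assms odd False True by (auto simp: inner_nbrs_def)
      next
        case e: False
        then have b: "b = a - 1" using assms odd False by (auto simp: inner_nbrs_def)
        have "a \<noteq> 3" using e by auto
        then have "3 \<le> a - 1" "odd (a - 1)" using e False by auto
        then show ?thesis using assms odd b by (auto simp: inner_nbrs_def)
      qed
    qed
  next
    case even: False
    show ?thesis
    proof (cases "even a")
      case True
      then have "b = a + 1" "a + 1 \<noteq> N" using assms even by (auto simp: inner_nbrs_def)
      then show ?thesis using assms even True by (auto simp: inner_nbrs_def)
    next
      case o: False
      then have "b = a - 1" "0 < a" "even (a - 1)" using assms even by (auto simp: inner_nbrs_def odd_pos)
      then show ?thesis using assms even by (auto simp: inner_nbrs_def)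
    qed
  qed
  then show "b < N" "b \<noteq> a" "a \<in> inner_nbrs N b" by auto
qed

lemma card_inner_nbrs: "card (inner_nbrs N a) = (if odd N \<and> a = 0 then 2 else 1)" "finite (inner_nbrs N a)"
  by (auto simp: inner_nbrs_def)

text \<open>\<open>k\<close> dominating vertices, followed by the degrees of the sparse graph raised
  by \<open>k\<close>. A possible entry \<open>k + 2\<close> comes first among the latter, which
  keeps the list sorted.\<close>

definition extremal :: "nat \<Rightarrow> nat \<Rightarrow> nat list" where
  "extremal k N = replicate k (k + N - 1) @ map (\<lambda>a. k + card (inner_nbrs N a)) [0..<N]"

lemma extremal_nth:
  "length (extremal k N) = k + N"
  "i < k \<Longrightarrow> extremal k N ! i = k + N - 1"
  "a < N \<Longrightarrow> extremal k N ! (k + a) = k + card (inner_nbrs N a)"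
  by (simp_all add: extremal_def nth_append)

lemma graphic_extremal:
  assumes N: "3 \<le> N"
  shows "graphic (extremal k N)"
proof -
  let ?d = "extremal k N" and ?n = "k + N"
  define E where "E i j \<longleftrightarrow> i < ?n \<and> j < ?n \<and> i \<noteq> j \<and> (i < k \<or> j < k \<or> j - k \<in> inner_nbrs N (i - k))" for i j
  have "E j i" if "E i j" for i j
  proof (cases "i < k \<or> j < k")
    case True
    then show ?thesis using that by (auto simp: E_def)
  next
    case False
    then have "i - k \<in> inner_nbrs N (j - k)" using inner_nbrs_props(3)[OF N, of "i - k" "j - k"] that by (auto simp: E_def)
    then show ?thesis using that by (auto simp: E_def)
  qed
  moreover have "card {j. E i j} = ?d ! i" if i: "i < ?n" for i
  proof (cases "i < k")
    case True
    then have "{j. E i j} = {..<?n} - {i}" using i by (auto simp: E_def)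
    then show ?thesis using True i by (simp add: extremal_nth)
  next
    case False
    define a where "a = i - k"
    have a: "i = k + a" "a < N" using False i by (auto simp: a_def)
    have "{j. E i j} = {..<k} \<union> (\<lambda>b. k + b) ` inner_nbrs N a"
    proof (intro set_eqI iffI)
      fix j assume "j \<in> {j. E i j}"
      then show "j \<in> {..<k} \<union> (\<lambda>b. k + b) ` inner_nbrs N a" using a
        by (cases "j < k") (auto simp: E_def image_iff intro!: bexI[of _ "j - k"])
    next
      fix j assume "j \<in> {..<k} \<union> (\<lambda>b. k + b) ` inner_nbrs N a"
      then consider "j < k" | b where "j = k + b" "b \<in> inner_nbrs N a" by blast
      then show "j \<in> {j. E i j}"
      proof cases
        case 1
        then show ?thesis using a by (simp add: E_def)
      next
        case 2
        then show ?thesis using a inner_nbrs_props(1,2)[OF N a(2) 2(2)] by (simp add: E_def)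
      qed
    qed
    moreover have "{..<k} \<inter> (\<lambda>b. k + b) ` inner_nbrs N a = {}" by auto
    ultimately have "card {j. E i j} = k + card (inner_nbrs N a)"
      by (simp add: card_Un_disjoint card_inner_nbrs(2) card_image)
    then show ?thesis using a by (simp add: extremal_nth)
  qed
  moreover have "E i j \<Longrightarrow> i < ?n \<and> j < ?n" "\<not> E i i" for i j by (auto simp: E_def)
  ultimately have "realizes E ?d" unfolding realizes_def extremal_nth(1) by blast
  moreover have "sorted_wrt (\<ge>) ?d"
    unfolding extremal_def sorted_wrt_append
  proof (intro conjI ballI)
    show "sorted_wrt (\<ge>) (map (\<lambda>a. k + card (inner_nbrs N a)) [0..<N])"
      unfolding sorted_wrt_map sorted_wrt_iff_nth_less by (auto simp: card_inner_nbrs)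
    show "sorted_wrt (\<ge>) (replicate k (k + N - 1))" by (auto simp: sorted_wrt_iff_nth_less)
    fix x y assume "x \<in> set (replicate k (k + N - 1))" "y \<in> set (map (\<lambda>a. k + card (inner_nbrs N a)) [0..<N])"
    then show "x \<ge> y" using N by (auto simp: card_inner_nbrs split: if_splits)
  qed
  ultimately show ?thesis unfolding graphic_def by blast
qed

lemma sum_extremal:
  assumes "0 < N"
  shows "sum_list (extremal k N) = k * (k + N - 1) + N * (k + 1) + of_bool (odd N)"
proof -
  obtain M where M: "N = Suc M" using assms by (cases N) auto
  have "(\<Sum>a\<leftarrow>[0..<N]. k + card (inner_nbrs N a)) = (\<Sum>a\<in>{0..<N}. (k + 1) + of_bool (odd N \<and> a = 0))"
    by (subst interv_sum_list_conv_sum_set_nat) (auto intro!: sum.cong simp: card_inner_nbrs)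
  also have "\<dots> = N * (k + 1) + (\<Sum>a\<in>{0..<N}. of_bool (odd N \<and> a = 0))" unfolding sum.distrib by simp
  also have "(\<Sum>a\<in>{0..<N}. of_bool (odd N \<and> a = 0)) = (of_bool (odd N) :: nat)"
    unfolding M by (subst sum.atLeast_Suc_lessThan) auto
  finally show ?thesis by (simp add: extremal_def sum_list_replicate)
qed

text \<open>In every realization the first \<open>k\<close> vertices dominate, so the others have at
  most one neighbour among themselves, or two for the vertex \<open>k\<close>. A copy uses at most
  \<open>r - 3\<close> dominating vertices, hence four others, which would need more removed edges
  between them than exist.\<close>

lemma extremal_no_copy:
  assumes r: "6 \<le> r" and N: "3 \<le> N"
  shows "\<not> potentially_graphic (r + 1) (K_minus_K3_P3 r) (extremal (r - 3) N)"
proof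
  define k where "k = r - 3"
  let ?d = "extremal k N" and ?n = "k + N"
  assume "potentially_graphic (r + 1) (K_minus_K3_P3 r) (extremal (r - 3) N)"
  then obtain E f where re: "realizes E ?d" and f: "inj_on f {..<r + 1}"
    and H: "\<And>i j. i < r + 1 \<Longrightarrow> j < r + 1 \<Longrightarrow> K_minus_K3_P3 r i j \<Longrightarrow> E (f i) (f j)"
    unfolding potentially_graphic_def contains_subgraph_def k_def by blast
  have En: "E i j \<Longrightarrow> i < ?n \<and> j < ?n" and Es: "E i j \<Longrightarrow> E j i" and Ei: "\<not> E i i"
    and Ed: "i < ?n \<Longrightarrow> card {j. E i j} = ?d ! i" for i j
    using re unfolding realizes_def by (auto simp: extremal_nth)
  have fin: "finite {j. E i j}" for i by (rule finite_subset[of _ "{..<?n}"]) (use En in auto)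
  have hub: "E i j" if "i < k" "j < ?n" "i \<noteq> j" for i j
  proof -
    have "{j. E i j} \<subseteq> {..<?n} - {i}" using En Ei by auto
    moreover have "card {j. E i j} = card ({..<?n} - {i})" using that Ed[of i] by (simp add: extremal_nth)
    ultimately have "{j. E i j} = {..<?n} - {i}" by (intro card_subset_eq) auto
    then show ?thesis using that by auto
  qed
  have inner: "card {j. E x j \<and> k \<le> j} \<le> (if x = k then 2 else 1)" if x: "k \<le> x" for x
  proof (cases "x < ?n")
    case True
    define a where "a = x - k"
    have a: "x = k + a" "a < N" using True x by (auto simp: a_def)
    have "{j. E x j} = {..<k} \<union> {j. E x j \<and> k \<le> j}" using hub[of _ x] Es True x by auto
    moreover have "{..<k} \<inter> {j. E x j \<and> k \<le> j} = {}" by auto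
    moreover have "finite {j. E x j \<and> k \<le> j}" by (rule finite_subset[OF _ fin[of x]]) auto
    ultimately have "card {j. E x j} = k + card {j. E x j \<and> k \<le> j}"
      using card_Un_disjoint[of "{..<k}" "{j. E x j \<and> k \<le> j}"] by simp
    then show ?thesis using Ed[OF True] a by (auto simp: extremal_nth card_inner_nbrs split: if_splits)
  next
    case False
    then have e: "{j. E x j \<and> k \<le> j} = {}" using En by auto
    show ?thesis unfolding e by simp
  qed
  define J0 where "J0 = {i. i < r + 1 \<and> k \<le> f i}"
  have "card {i. i < r + 1 \<and> f i < k} \<le> card {..<k}"
    by (rule card_inj_on_le[of f]) (use f in \<open>auto simp: inj_on_def\<close>)
  moreover have "{..<r + 1} = J0 \<union> {i. i < r + 1 \<and> f i < k}" by (auto simp: J0_def)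
  then have "r + 1 \<le> card J0 + card {i. i < r + 1 \<and> f i < k}" using card_Un_le by (metis card_lessThan)
  ultimately have "4 \<le> card J0" using r by (simp add: k_def)
  then obtain J where J: "J \<subseteq> J0" "card J = 4" "finite J" using obtain_subset_with_card_n by metis
  have Jr: "i < r + 1" "k \<le> f i" if "i \<in> J" for i using that J by (auto simp: J0_def)
  \<comment> \<open>Each of the other three members of \<open>J\<close> is a removed neighbour of
    \<open>i\<close>, or its image is a neighbour of \<open>f i\<close> outside the first
    \<open>k\<close> vertices.\<close>
  have nbrs: "3 - (if f i = k then 2 else 1) \<le> card (removed_nbrs i \<inter> J)" if i: "i \<in> J" for i
  proof -
    let ?A = "{j \<in> J. j \<noteq> i \<and> j \<notin> removed_nbrs i}"
    have "card ?A \<le> card {j. E (f i) j \<and> k \<le> j}"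
    proof (rule card_inj_on_le[of f])
      show "inj_on f ?A" using f Jr by (auto simp: inj_on_def)
      show "f ` ?A \<subseteq> {j. E (f i) j \<and> k \<le> j}"
        using H[of i] Jr i by (auto simp: K_minus_K3_P3_def removed_nbrs_def)
      show "finite {j. E (f i) j \<and> k \<le> j}" by (rule finite_subset[OF _ fin[of "f i"]]) auto
    qed
    then have A: "card ?A \<le> (if f i = k then 2 else 1)" using inner[of "f i"] Jr[OF i] by linarith
    have "J - {i} \<subseteq> ?A \<union> (removed_nbrs i \<inter> J)" by auto
    then have "card (J - {i}) \<le> card (?A \<union> (removed_nbrs i \<inter> J))" using J by (intro card_mono) auto
    also have "\<dots> \<le> card ?A + card (removed_nbrs i \<inter> J)" by (rule card_Un_le)
    finally have "3 \<le> card ?A + card (removed_nbrs i \<inter> J)" using J i by simp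
    then show ?thesis using A by linarith
  qed
  show False
  proof (cases "\<exists>i\<in>J. f i = k")
    case True
    then obtain i0 where i0: "i0 \<in> J" "f i0 = k" by blast
    have "f i \<noteq> k" if "i \<in> J" "i \<noteq> i0" for i
      using that i0 f Jr by (metis inj_onD lessThan_iff)
    then have "\<And>i. i \<in> J \<Longrightarrow> i \<noteq> i0 \<Longrightarrow> 2 \<le> card (removed_nbrs i \<inter> J)" using nbrs by fastforce
    moreover have "1 \<le> card (removed_nbrs i0 \<inter> J)" using nbrs[OF i0(1)] i0 by simp
    ultimately show False using four_vertices[OF J(2) i0(1)] by blast
  next
    case False
    obtain i0 where i0: "i0 \<in> J" using J by fastforce
    have "2 \<le> card (removed_nbrs i \<inter> J)" if "i \<in> J" for i using nbrs[OF that] False that by auto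
    then show False using four_vertices[OF J(2) i0] i0 by fastforce
  qed
qed

section \<open>The value of sigma\<close>

lemma realizes_iff: "realizes E d \<longleftrightarrow> graph_on {..<length d} E \<and> (\<forall>i<length d. degree E i = d ! i)"
  unfolding realizes_def graph_on_def degree_def nbrs_def by auto

theorem theorem1p1:
  fixes r n :: nat
  assumes "r \<ge> 6" and "n \<ge> 5 * r + 18"
  shows "int (sigma (r + 1) (K_minus_K3_P3 r) n) =
    (if odd (n - r)
     then (int r - 1) * (2 * int n - int r) - 3 * (int n - int r) - 1
     else (int r - 1) * (2 * int n - int r) - 3 * (int n - int r))"
proof -
  define N where "N = n - r + 3"
  define ex where "ex = extremal (r - 3) N"
  have N3: "3 \<le> N" by (simp add: N_def)
  have rN: "r - 3 + N = n" using assms by (simp add: N_def)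
  have par: "odd N \<longleftrightarrow> even (n - r)" by (simp add: N_def)
  have intN: "int (r - 3) = int r - 3" "int N = int n - int r + 3" "int (n - 1) = int n - 1"
    using assms by (auto simp: N_def)
  have "sum_list ex = (r - 3) * (n - 1) + N * (r - 3 + 1) + of_bool (odd N)"
    unfolding ex_def using sum_extremal[of N "r - 3"] N3 rN by simp
  then have "int (sum_list ex) = int (r - 3) * int (n - 1) + int N * (int (r - 3) + 1) + of_bool (odd N)"
    by (simp only: of_nat_add of_nat_mult of_nat_1 of_nat_of_bool)
  then have ex_sum: "int (sum_list ex) = (2 * int r - 5) * int n - int r * int r + 4 * int r - 3 + of_bool (odd N)"
    unfolding intN by (simp add: algebra_simps)
  \<comment> \<open>The least even number above the degree sum of the extremal sequence.\<close>
  define l where "l = sum_list ex + 2"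
  have l_val: "int l = (if odd (n - r)
     then (int r - 1) * (2 * int n - int r) - 3 * (int n - int r) - 1
     else (int r - 1) * (2 * int n - int r) - 3 * (int n - int r))"
  proof (cases "odd (n - r)")
    case True
    then have b: "of_bool (odd N) = (0 :: int)" using par by simp
    show ?thesis unfolding if_P[OF True] using ex_sum[unfolded b] by (simp add: l_def algebra_simps)
  next
    case False
    then have b: "of_bool (odd N) = (1 :: int)" using par by simp
    show ?thesis unfolding if_not_P[OF False] using ex_sum[unfolded b] by (simp add: l_def algebra_simps)
  qed
  have l_ge: "(2 * int r - 5) * int n - int r * int r + 4 * int r - 1 \<le> int l"
    using ex_sum by (simp add: l_def)
  have even_nr: "even (int (n - r)) \<longleftrightarrow> even (int n - int r)" using assms by (simp add: of_nat_diff)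
  have "even (int l)"
    unfolding l_val using even_nr by (auto simp: of_nat_diff)
  then have l_even: "even l" by simp
  have "sigma (r + 1) (K_minus_K3_P3 r) n = l"
    unfolding sigma_def
  proof (rule Least_equality, intro conjI allI impI)
    show "even l" by (rule l_even)
    fix d :: "nat list" assume "length d = n \<and> graphic d \<and> l \<le> sum_list d"
    then have d: "length d = n" "graphic d" "l \<le> sum_list d" by auto
    then obtain E where "realizes E d" unfolding graphic_def by blast
    then have E: "graph_on {..<n} E" "\<And>i. i < n \<Longrightarrow> degree E i = d ! i" using d by (auto simp: realizes_iff)
    have "(\<Sum>i\<in>{..<n}. degree E i) = sum_list d"
      using E(2) d by (simp add: sum_list_sum_nth atLeast0LessThan)
    then have "(2 * int r - 5) * int (card {..<n}) - int r * int r + 4 * int r - 1 \<le> int (\<Sum>i\<in>{..<n}. degree E i)"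
      using l_ge d(3) by simp
    then obtain F where F: "graph_on {..<n} F" "\<forall>x. degree F x = degree E x" "contains_subgraph F (r + 1) (K_minus_K3_P3 r)"
      using potentially_copy[OF E(1) assms(1)] assms(2) by auto
    then have "realizes F d" using E d by (simp add: realizes_iff)
    then show "potentially_graphic (r + 1) (K_minus_K3_P3 r) d" using F unfolding potentially_graphic_def by blast
  next
    fix l' assume h: "even l' \<and> (\<forall>d. length d = n \<and> graphic d \<and> l' \<le> sum_list d \<longrightarrow> potentially_graphic (r + 1) (K_minus_K3_P3 r) d)"
    have "\<not> potentially_graphic (r + 1) (K_minus_K3_P3 r) ex"
      unfolding ex_def by (rule extremal_no_copy[OF assms(1) N3])
    moreover have "graphic ex" unfolding ex_def by (rule graphic_extremal[OF N3])
    moreover have "length ex = n" using rN by (simp add: ex_def extremal_nth)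
    ultimately have "\<not> l' \<le> sum_list ex" using h by blast
    \<comment> \<open>Exceeding \<open>sum_list ex\<close> only gives \<open>l - 1 \<le> l'\<close>;
      parity supplies the last unit.\<close>
    then have "l \<le> l' + 1" by (simp add: l_def)
    then show "l \<le> l'" using l_even h by (metis Suc_eq_plus1 even_Suc le_SucE)
  qed
  then show ?thesis using l_val by simp
qed

end
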